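(* Let $\mathcal A$ be a unital $C^*$-algebra, $p\in[1,\infty)$, and let $L$ be a partially-defined $L$-seminorm on $\mathcal A$. Then the projective $L^p$-Wasserstein distance $\underleftarrow{W}_p$ is a $[0,+\infty]$-valued pseudo-distance function on the quasi-state space $QS(\mathcal A)$. If $L$ is a solid $L$-seminorm, then $\underleftarrow{W}_p$ is a $[0,+\infty]$-valued distance function on $QS(\mathcal A)$.
   Context: $\mathcal A^{sa}$ is the set of self-adjoint elements of $\mathcal A$; $S(\cdot)$ denotes the state space. Unital commutative $C^*$-subalgebras $\mathcal A_\alpha\subseteq\mathcal A$ contain the unit of $\mathcal A$; $X_\alpha$ is the Gelfand spectrum of $\mathcal A_\alpha$ (identified with the pure states of $\mathcal A_\alpha$), and states of $\mathcal A_\alpha$ are identified with Radon probability measures on $X_\alpha$. A quasi-state on $\mathcal A$ is a map $\mu:\mathcal A\to\mathbb C$ that is linear on every unital commutative $C^*$-subalgebra, satisfies $\mu(a+ib)=\mu(a)+i\mu(b)$ for $a,b\in\mathcal A^{sa}$, $\mu(a^*a)\ge0$ for all $a\in\mathcal A$, and $\mu(1)=1$; $QS(\mathcal A)$ is the set of quasi-states. For $\mu\in QS(\mathcal A)$, $\mu_\alpha:=\mu|_{\mathcal A_\alpha}\in S(\mathcal A_\alpha)$. A partially-defined $L$-seminorm on $\mathcal A$ is a map $L:\mathcal A^{sa}\to[0,+\infty]$ with $L(af)=|a|L(f)$ for $a\in\mathbb R$ (with $0\cdot\infty=0$), $L(f+g)\le L(f)+L(g)$, $L(1)=0$. Put $B:=\{a\in\mathcal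 A^{sa}:L(a)<\infty\}$. An $L$-seminorm is a partially-defined $L$-seminorm for which $B$ separates points of $S(\mathcal A)$. An $L$-seminorm is solid if $B\cap\mathcal A_\alpha$ separates points of $S(\mathcal A_\alpha)$ for every maximal unital commutative $C^*$-subalgebra $\mathcal A_\alpha$. For each unital commutative $C^*$-subalgebra $\mathcal A_\alpha$ and $\mu_\alpha,\nu_\alpha\in S(\mathcal A_\alpha)$: $d_{L,\alpha}(\mu_\alpha,\nu_\alpha):=\sup\{|\mu_\alpha(f)-\nu_\alpha(f)|:f\in\mathcal A_\alpha^{sa},L(f)\le1\}$, and $W_{p,\alpha}(\mu_\alpha,\nu_\alpha):=\inf_\pi\big(\int_{X_\alpha\times X_\alpha} d_{L,\alpha}^p(x,y)\,d\pi\big)^{1/p}$, the infimum over Radon probability measures $\pi$ on $X_\alpha\times X_\alpha$ with marginals $\mu_\alpha,\nu_\alpha$. For $\mu,\nu\in QS(\mathcal A)$, $\underleftarrow{W}_p(\mu,\nu):=\sup_\alpha W_{p,\alpha}(\mu_\alpha,\nu_\alpha)$ over all unital commutative $C^*$-subalgebras of $\mathcal A$. A pseudo-distance function is symmetric, vanishes on the diagonal and satisfies the triangle inequality, but may vanish on pairs of distinct points; a distance function additionally vanishes only on the diagonal. *)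

theory Defs
  imports "HOL-Probability.Probability_Measure"
begin

section \<open>Unital C*-algebras\<close>

text \<open>The superclass supplies \<open>1 \<noteq> 0\<close> and \<open>norm 1 = 1\<close>.\<close>

class unital_cstar_algebra = real_normed_algebra_1 + banach +
  fixes scaleC :: "complex \<Rightarrow> 'a \<Rightarrow> 'a"  (infixr \<open>*\<^sub>C\<close> 75)
    and adj :: "'a \<Rightarrow> 'a"
  assumes scaleC_add_right: "c *\<^sub>C (x + y) = c *\<^sub>C x + c *\<^sub>C y"
    and scaleC_add_left: "(c + d) *\<^sub>C x = c *\<^sub>C x + d *\<^sub>C x"
    and scaleC_scaleC: "c *\<^sub>C d *\<^sub>C x = (c * d) *\<^sub>C x"
    and scaleC_of_real: "complex_of_real r *\<^sub>C x = r *\<^sub>R x"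
    and mult_scaleC_left: "(c *\<^sub>C x) * y = c *\<^sub>C (x * y)"
    and mult_scaleC_right: "x * (c *\<^sub>C y) = c *\<^sub>C (x * y)"
    and norm_scaleC: "norm (c *\<^sub>C x) = cmod c * norm x"
    and adj_add: "adj (x + y) = adj x + adj y"
    and adj_scaleC: "adj (c *\<^sub>C x) = cnj c *\<^sub>C adj x"
    and adj_mult: "adj (x * y) = adj y * adj x"
    and adj_adj: "adj (adj x) = x"
    and cstar_identity: "norm (adj x * x) = (norm x)\<^sup>2"

definition selfadjoint :: "'a::unital_cstar_algebra set" where
  "selfadjoint = {a. adj a = a}"

definition unital_comm_cstar_subalgebra :: "'a::unital_cstar_algebra set \<Rightarrow> bool" where
  "unital_comm_cstar_subalgebra M \<longleftrightarrow>
     1 \<in> M \<and>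
     (\<forall>x\<in>M. \<forall>y\<in>M. x + y \<in> M) \<and>
     (\<forall>c. \<forall>x\<in>M. c *\<^sub>C x \<in> M) \<and>
     (\<forall>x\<in>M. \<forall>y\<in>M. x * y \<in> M) \<and>
     (\<forall>x\<in>M. adj x \<in> M) \<and>
     closed M \<and>
     (\<forall>x\<in>M. \<forall>y\<in>M. x * y = y * x)"

definition maximal_unital_comm_cstar_subalgebra :: "'a::unital_cstar_algebra set \<Rightarrow> bool" where
  "maximal_unital_comm_cstar_subalgebra M \<longleftrightarrow>
     unital_comm_cstar_subalgebra M \<and>
     (\<forall>N. unital_comm_cstar_subalgebra N \<and> M \<subseteq> N \<longrightarrow> N = M)"


section \<open>States, quasi-states and the Gelfand spectrum\<close>

definition clinear_on :: "'a::unital_cstar_algebra set \<Rightarrow> ('a \<Rightarrow> complex) \<Rightarrow> bool" where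
  "clinear_on M \<phi> \<longleftrightarrow>
     (\<forall>x\<in>M. \<forall>y\<in>M. \<phi> (x + y) = \<phi> x + \<phi> y) \<and> (\<forall>c. \<forall>x\<in>M. \<phi> (c *\<^sub>C x) = c * \<phi> x)"

text \<open>Functionals on a subalgebra \<open>M\<close> are functions that are extensional on \<open>M\<close>, so that
  equality of functionals is equality on \<open>M\<close>. The state space of the whole algebra is
  \<open>states UNIV\<close>.\<close>

definition states :: "'a::unital_cstar_algebra set \<Rightarrow> ('a \<Rightarrow> complex) set" where
  "states M = {\<phi> \<in> extensional M.
     clinear_on M \<phi> \<and> (\<forall>a\<in>M. \<phi> (adj a * a) \<in> \<real>\<^sub>\<ge>\<^sub>0) \<and> \<phi> 1 = 1}"

definition quasi_states :: "('a::unital_cstar_algebra \<Rightarrow> complex) set" where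
  "quasi_states = {\<mu>.
     (\<forall>M. unital_comm_cstar_subalgebra M \<longrightarrow> clinear_on M \<mu>) \<and>
     (\<forall>a\<in>selfadjoint. \<forall>b\<in>selfadjoint. \<mu> (a + \<i> *\<^sub>C b) = \<mu> a + \<i> * \<mu> b) \<and>
     (\<forall>a. \<mu> (adj a * a) \<in> \<real>\<^sub>\<ge>\<^sub>0) \<and>
     \<mu> 1 = 1}"

definition characters :: "'a::unital_cstar_algebra set \<Rightarrow> ('a \<Rightarrow> complex) set" where
  "characters M = {\<omega> \<in> extensional M.
     clinear_on M \<omega> \<and> (\<forall>x\<in>M. \<forall>y\<in>M. \<omega> (x * y) = \<omega> x * \<omega> y) \<and> \<omega> 1 = 1}"

text \<open>The characters with the weak-* topology, i.e. the topology of pointwise convergence on \<open>M\<close>.\<close>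

definition gelfand_spectrum :: "'a::unital_cstar_algebra set \<Rightarrow> ('a \<Rightarrow> complex) topology" where
  "gelfand_spectrum M = subtopology (product_topology (\<lambda>_. euclidean) M) (characters M)"


section \<open>Radon probability measures\<close>

definition borel_measure_space :: "'b topology \<Rightarrow> 'b measure" where
  "borel_measure_space X = sigma (topspace X) {U. openin X U}"

text \<open>For finite Borel measures on a Hausdorff space, Radon means inner regular with respect to
  compact sets.\<close>

definition radon_probability :: "'b topology \<Rightarrow> 'b measure set" where
  "radon_probability X = {\<pi>.
     space \<pi> = topspace X \<and> sets \<pi> = sets (borel_measure_space X) \<and> prob_space \<pi> \<and>
     (\<forall>E\<in>sets \<pi>. emeasure \<pi> E = (SUP K\<in>{K \<in> sets \<pi>. compactin X K \<and> K \<subseteq> E}. emeasure \<pi> K))}"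

text \<open>The identification of a state \<open>\<phi>\<close> of \<open>M\<close> with a Radon probability measure \<open>m\<close> on the
  Gelfand spectrum of \<open>M\<close> (Riesz representation).\<close>

definition represents_state ::
    "'a::unital_cstar_algebra set \<Rightarrow> ('a \<Rightarrow> complex) measure \<Rightarrow> ('a \<Rightarrow> complex) \<Rightarrow> bool" where
  "represents_state M m \<phi> \<longleftrightarrow>
     m \<in> radon_probability (gelfand_spectrum M) \<and> (\<forall>f\<in>M. \<phi> f = (\<integral>\<omega>. \<omega> f \<partial>m))"

text \<open>The measures live on the Borel sets of the product space, which for a non-second-countable
  spectrum may be more than the product of the Borel sigma-algebras.\<close>

definition couplings ::
    "'a::unital_cstar_algebra set \<Rightarrow> ('a \<Rightarrow> complex) \<Rightarrow> ('a \<Rightarrow> complex) \<Rightarrow>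
     (('a \<Rightarrow> complex) \<times> ('a \<Rightarrow> complex)) measure set" where
  "couplings M \<phi> \<psi> = {\<pi> \<in> radon_probability (prod_topology (gelfand_spectrum M) (gelfand_spectrum M)).
     represents_state M (distr \<pi> (borel_measure_space (gelfand_spectrum M)) fst) \<phi> \<and>
     represents_state M (distr \<pi> (borel_measure_space (gelfand_spectrum M)) snd) \<psi>}"


section \<open>L-seminorms\<close>

text \<open>Only the values of \<open>L\<close> on self-adjoint elements are relevant.\<close>

definition partially_defined_L_seminorm :: "('a::unital_cstar_algebra \<Rightarrow> ennreal) \<Rightarrow> bool" where
  "partially_defined_L_seminorm L \<longleftrightarrow>
     (\<forall>a. \<forall>f\<in>selfadjoint. L (a *\<^sub>R f) = ennreal \<bar>a\<bar> * L f) \<and>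
     (\<forall>f\<in>selfadjoint. \<forall>g\<in>selfadjoint. L (f + g) \<le> L f + L g) \<and>
     L 1 = 0"

definition L_domain :: "('a::unital_cstar_algebra \<Rightarrow> ennreal) \<Rightarrow> 'a set" where
  "L_domain L = {a \<in> selfadjoint. L a < \<infinity>}"

definition separates_points_of :: "'a set \<Rightarrow> ('a \<Rightarrow> complex) set \<Rightarrow> bool" where
  "separates_points_of F S \<longleftrightarrow> (\<forall>\<phi>\<in>S. \<forall>\<psi>\<in>S. \<phi> \<noteq> \<psi> \<longrightarrow> (\<exists>f\<in>F. \<phi> f \<noteq> \<psi> f))"

definition L_seminorm :: "('a::unital_cstar_algebra \<Rightarrow> ennreal) \<Rightarrow> bool" where
  "L_seminorm L \<longleftrightarrow>
     partially_defined_L_seminorm L \<and> separates_points_of (L_domain L) (states UNIV)"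

definition solid_L_seminorm :: "('a::unital_cstar_algebra \<Rightarrow> ennreal) \<Rightarrow> bool" where
  "solid_L_seminorm L \<longleftrightarrow>
     L_seminorm L \<and>
     (\<forall>M. maximal_unital_comm_cstar_subalgebra M \<longrightarrow>
        separates_points_of (L_domain L \<inter> M) (states M))"


section \<open>Wasserstein distances\<close>

definition state_dist ::
    "('a::unital_cstar_algebra \<Rightarrow> ennreal) \<Rightarrow> 'a set \<Rightarrow> ('a \<Rightarrow> complex) \<Rightarrow> ('a \<Rightarrow> complex) \<Rightarrow> ennreal"
  where
  "state_dist L M \<phi> \<psi> =
     (SUP f\<in>{f \<in> M. f \<in> selfadjoint \<and> L f \<le> 1}. ennreal (cmod (\<phi> f - \<psi> f)))"

text \<open>Real powers on the extended half line, for exponents \<open>p > 0\<close>.\<close>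

definition ennreal_powr :: "ennreal \<Rightarrow> real \<Rightarrow> ennreal" where
  "ennreal_powr x p = (if x = \<infinity> then \<infinity> else ennreal (enn2real x powr p))"

text \<open>Characters are (pure) states, so \<^term>\<open>state_dist\<close> applies to points of the spectrum.\<close>

definition wasserstein ::
    "('a::unital_cstar_algebra \<Rightarrow> ennreal) \<Rightarrow> real \<Rightarrow> 'a set \<Rightarrow>
     ('a \<Rightarrow> complex) \<Rightarrow> ('a \<Rightarrow> complex) \<Rightarrow> ennreal" where
  "wasserstein L p M \<phi> \<psi> =
     (INF \<pi>\<in>couplings M \<phi> \<psi>.
        ennreal_powr (\<integral>\<^sup>+ z. ennreal_powr (state_dist L M (fst z) (snd z)) p \<partial>\<pi>) (1 / p))"

definition projective_wasserstein ::
    "('a::unital_cstar_algebra \<Rightarrow> ennreal) \<Rightarrow> real \<Rightarrow>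
     ('a \<Rightarrow> complex) \<Rightarrow> ('a \<Rightarrow> complex) \<Rightarrow> ennreal" where
  "projective_wasserstein L p \<mu> \<nu> =
     (SUP M\<in>{M. unital_comm_cstar_subalgebra M}.
        wasserstein L p M (restrict \<mu> M) (restrict \<nu> M))"

definition pseudo_distance_on :: "'b set \<Rightarrow> ('b \<Rightarrow> 'b \<Rightarrow> ennreal) \<Rightarrow> bool" where
  "pseudo_distance_on S d \<longleftrightarrow>
     (\<forall>x\<in>S. d x x = 0) \<and>
     (\<forall>x\<in>S. \<forall>y\<in>S. d x y = d y x) \<and>
     (\<forall>x\<in>S. \<forall>y\<in>S. \<forall>z\<in>S. d x z \<le> d x y + d y z)"

definition distance_on :: "'b set \<Rightarrow> ('b \<Rightarrow> 'b \<Rightarrow> ennreal) \<Rightarrow> bool" where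
  "distance_on S d \<longleftrightarrow>
     pseudo_distance_on S d \<and> (\<forall>x\<in>S. \<forall>y\<in>S. d x y = 0 \<longrightarrow> x = y)"

end

theory Submission
  imports Defs
begin

text \<open>For a fixed commutative subalgebra, reflexivity needs a Radon measure representing each state, and
  the triangle inequality needs couplings to be glued along a common marginal. Both measures come from
  one principle: a positive functional on a space of functions on a compact Hausdorff space extends to
  all bounded functions (M. Riesz), and is then an integral (Riesz-Markov). For states, positivity on the
  Gelfand transforms holds because a minimal nonempty closed face of the states on which a given element
  is minimal consists of a single character. For gluing, it follows by taking the infimum over the first
  variable, so no disintegration and no metrizability is needed. The triangle inequality is then
  Minkowski's inequality, and the middle marginals agree by the Stone-Weierstrass theorem.

  If the projective distance vanishes, then on each maximal commutative subalgebra the two states agree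
  on all elements with finite seminorm, hence everywhere by solidity; each self-adjoint element lies in
  such a subalgebra.\<close>

section \<open>Radon probability measures on compact Hausdorff spaces\<close>

text \<open>The spectrum may fail to be metrizable, so Borel sets of its square can go beyond the
  product sigma-algebra, and \<open>state_dist\<close> is a supremum of a possibly uncountable
  family of continuous functions that may take the value infinity. Measurability therefore comes
  from semicontinuity: strict superlevel sets of such suprema, and strict sublevel sets of the
  infimum used for gluing, are unions of open sets. This is why all measures live on the Borel sets
  of a product topology and are compared only through integrals of continuous functions.

  On the algebraic side two power series carry the weight. The binomial series makes
  \<open>1 + a\<close> the square of a self-adjoint element when \<open>a\<close> is self-adjoint of
  norm below 1, which is the source of the bounds and positivity statements for states; the
  geometric series bounds the characters.

  For vanishing distance, an element of seminorm at most 1 is 1-Lipschitz for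
  \<open>state_dist\<close>, so the two states differ on it by at most the mean distance under any
  coupling. The mean p-th power controls this mean because a coupling has mass 1.\<close>

lemma urysohn_compact_Hausdorff:
  assumes "compact_space X" "Hausdorff_space X" "closedin X A" "closedin X B" "A \<inter> B = {}"
  obtains f :: "'b \<Rightarrow> real" where "continuous_map X euclideanreal f"
    "\<And>x. x \<in> topspace X \<Longrightarrow> 0 \<le> f x \<and> f x \<le> 1"
    "\<And>x. x \<in> A \<Longrightarrow> f x = 0" "\<And>x. x \<in> B \<Longrightarrow> f x = 1"
proof -
  have "normal_space X"
    using assms(1,2) by (simp add: compact_Hausdorff_or_regular_imp_normal_space)
  then obtain f where f: "continuous_map X (top_of_set {0..1::real}) f"
      "f ` A \<subseteq> {0}" "f ` B \<subseteq> {1}"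
    using Urysohn_lemma[of X A B 0 1] assms by (auto simp: disjnt_def)
  then have "continuous_map X euclideanreal f" "\<And>x. x \<in> topspace X \<Longrightarrow> 0 \<le> f x \<and> f x \<le> 1"
    by (auto simp: continuous_map_in_subtopology Pi_iff image_subset_iff)
  then show ?thesis
    using f by (intro that[of f]) auto
qed

section \<open>Borel sets of an abstract topology\<close>

lemma space_borel_measure_space [simp]: "space (borel_measure_space X) = topspace X"
  unfolding borel_measure_space_def by (intro space_measure_of) (auto dest: openin_subset)

lemma sets_borel_measure_space:
  "sets (borel_measure_space X) = sigma_sets (topspace X) {U. openin X U}"
  unfolding borel_measure_space_def by (intro sets_measure_of) (auto dest: openin_subset)

lemma openin_sets_borel_measure_space: "openin X U \<Longrightarrow> U \<in> sets (borel_measure_space X)"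
  by (simp add: sets_borel_measure_space)

lemma closedin_sets_borel_measure_space:
  assumes "closedin X K" shows "K \<in> sets (borel_measure_space X)"
proof -
  have "topspace X - (topspace X - K) \<in> sets (borel_measure_space X)"
    using assms openin_sets_borel_measure_space[of X "topspace X - K"]
      sets.compl_sets[of _ "borel_measure_space X"]
    by (simp add: closedin_def)
  moreover have "topspace X - (topspace X - K) = K"
    using closedin_subset[OF assms] by auto
  ultimately show ?thesis by simp
qed

lemma continuous_map_measurable:
  assumes "sets N = sets (borel_measure_space X)" "continuous_map X Y f"
  shows "f \<in> measurable N (borel_measure_space Y)"
proof -
  have sp: "space N = topspace X" using sets_eq_imp_space_eq[OF assms(1)] by simp
  show ?thesis
    unfolding borel_measure_space_def[of Y]
  proof (rule measurable_measure_of)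
    show "f \<in> space N \<rightarrow> topspace Y"
      using assms(2) sp by (auto simp: continuous_map_def)
    show "f -` U \<inter> space N \<in> sets N" if "U \<in> {U. openin Y U}" for U
      using that openin_continuous_map_preimage[OF assms(2), of U] assms(1) sp
      by (auto simp: vimage_def Int_def conj_commute intro: openin_sets_borel_measure_space)
  qed (auto dest: openin_subset)
qed

lemma continuous_map_borel_measurable:
  assumes "sets N = sets (borel_measure_space X)" "continuous_map X euclidean f"
  shows "f \<in> borel_measurable N"
proof (rule borel_measurableI)
  have sp: "space N = topspace X" using sets_eq_imp_space_eq[OF assms(1)] by simp
  fix U :: "'b set" assume "open U"
  then show "f -` U \<inter> space N \<in> sets N"
    using openin_continuous_map_preimage[OF assms(2), of U] assms(1) sp
    by (auto simp: vimage_def Int_def conj_commute intro: openin_sets_borel_measure_space)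
qed

section \<open>Radon probability measures: regularity, uniqueness, images\<close>

lemma radon_probabilityD:
  assumes "N \<in> radon_probability X"
  shows "space N = topspace X" "sets N = sets (borel_measure_space X)" "prob_space N"
  using assms by (auto simp: radon_probability_def)

text \<open>Inner regularity in epsilon form with real-valued measures. The supremum in the
  definition ranges over compact sets that are also Borel; in a Hausdorff space compact sets are
  closed, so every witness \<open>K\<close> qualifies.\<close>

lemma radon_probabilityI:
  assumes "space N = topspace X" "sets N = sets (borel_measure_space X)" "prob_space N"
    and "Hausdorff_space X"
    and reg: "\<And>E e. E \<in> sets N \<Longrightarrow> e > 0 \<Longrightarrow>
      \<exists>K. compactin X K \<and> K \<subseteq> E \<and> measure N E \<le> measure N K + e"
  shows "N \<in> radon_probability X"
proof -
  interpret prob_space N by fact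
  have "emeasure N E = (SUP K\<in>{K \<in> sets N. compactin X K \<and> K \<subseteq> E}. emeasure N K)"
    (is "_ = ?R") if E: "E \<in> sets N" for E
  proof (rule antisym)
    show "emeasure N E \<le> ?R"
    proof (rule ennreal_le_epsilon)
      fix e :: real assume "0 < e"
      then obtain K where K: "compactin X K" "K \<subseteq> E" "measure N E \<le> measure N K + e"
        using reg E by blast
      then have KN: "K \<in> sets N"
        using assms closedin_sets_borel_measure_space compactin_imp_closedin by blast
      have "emeasure N E \<le> emeasure N K + ennreal e"
        using K(3) \<open>0 < e\<close> by (simp add: emeasure_eq_measure flip: ennreal_plus)
      also have "emeasure N K \<le> ?R"
        using KN K by (intro SUP_upper) auto
      finally show "emeasure N E \<le> ?R + ennreal e" by (simp add: add_right_mono)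
    qed
    show "?R \<le> emeasure N E"
      using E by (intro SUP_least emeasure_mono) auto
  qed
  then show ?thesis using assms by (auto simp: radon_probability_def)
qed

lemma radon_probability_inner_regular:
  assumes N: "N \<in> radon_probability X" and E: "E \<in> sets N" and "e > 0"
  obtains K where "compactin X K" "K \<subseteq> E" "K \<in> sets N" "measure N E \<le> measure N K + e"
proof -
  interpret prob_space N using N radon_probabilityD by blast
  let ?A = "{K \<in> sets N. compactin X K \<and> K \<subseteq> E}"
  have "\<exists>K\<in>?A. measure N E \<le> measure N K + e"
  proof (rule ccontr)
    assume neg: "\<not> (\<exists>K\<in>?A. measure N E \<le> measure N K + e)"
    have *: "measure N K \<le> measure N E - e" if "K \<in> ?A" for K
    proof -
      have "\<not> measure N E \<le> measure N K + e"
        using that neg by blast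
      then show ?thesis by simp
    qed
    have "emeasure N K \<le> ennreal (measure N E - e)" if "K \<in> ?A" for K
      unfolding emeasure_eq_measure by (intro ennreal_leI * that)
    then have "(SUP K\<in>?A. emeasure N K) \<le> ennreal (measure N E - e)"
      by (intro SUP_least) auto
    moreover have "emeasure N E = (SUP K\<in>?A. emeasure N K)"
      using N E by (auto simp: radon_probability_def)
    ultimately have "ennreal (measure N E) \<le> ennreal (measure N E - e)"
      by (simp add: emeasure_eq_measure)
    \<comment> \<open>The empty set is a competitor, so \<open>measure N E - e\<close> is
      nonnegative and \<open>ennreal\<close> does not truncate it.\<close>
    moreover have "{} \<in> ?A" by auto
    ultimately show False
      using *[of "{}"] \<open>e > 0\<close> by (simp add: ennreal_le_iff)
  qed
  then show ?thesis using that by blast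
qed

lemma continuous_map_compact_bounded:
  fixes f :: "'b \<Rightarrow> 'c::real_normed_vector"
  assumes "compact_space X" "continuous_map X euclidean f"
  obtains B where "B > 0" "\<And>x. x \<in> topspace X \<Longrightarrow> norm (f x) \<le> B"
proof -
  have "compact (f ` topspace X)"
    using image_compactin[OF _ assms(2)] assms(1) by (auto simp: compact_space_def)
  then have "bounded (f ` topspace X)" by (rule compact_imp_bounded)
  then show ?thesis using that by (auto simp: bounded_pos)
qed

lemma integrable_continuous_map:
  fixes f :: "'b \<Rightarrow> 'c::{banach,second_countable_topology}"
  assumes "compact_space X" and N: "N \<in> radon_probability X" and f: "continuous_map X euclidean f"
  shows "integrable N f"
proof -
  interpret prob_space N using N radon_probabilityD by blast
  obtain B where "\<And>x. x \<in> topspace X \<Longrightarrow> norm (f x) \<le> B"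
    using continuous_map_compact_bounded[OF assms(1) f] by metis
  then show ?thesis
    using radon_probabilityD[OF N] f
    by (intro integrable_const_bound[where B=B] AE_I2 continuous_map_borel_measurable) auto
qed

text \<open>For open \<open>U\<close>, choose a compact \<open>K\<close> inside \<open>U\<close> of
  almost full measure and a Urysohn function between the two indicators: its integral compares the
  measures of \<open>K\<close> and \<open>U\<close>. By symmetry the measures agree on open sets, an
  intersection-stable generator.\<close>

lemma radon_probability_eqI:
  assumes X: "compact_space X" "Hausdorff_space X"
    and N: "N \<in> radon_probability X" and N': "N' \<in> radon_probability X"
    and eq: "\<And>f :: 'b \<Rightarrow> real. continuous_map X euclideanreal f \<Longrightarrow> (\<integral>x. f x \<partial>N) = (\<integral>x. f x \<partial>N')"
  shows "N = N'"
proof -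
  have le: "measure N U \<le> measure N' U"
    if N: "N \<in> radon_probability X" and N': "N' \<in> radon_probability X"
      and eq: "\<And>f :: 'b \<Rightarrow> real. continuous_map X euclideanreal f \<Longrightarrow> (\<integral>x. f x \<partial>N) = (\<integral>x. f x \<partial>N')"
      and U: "openin X U" for N N' U
  proof (rule field_le_epsilon)
    interpret N: prob_space N using N radon_probabilityD by blast
    interpret N': prob_space N' using N' radon_probabilityD by blast
    have UN: "U \<in> sets N" "U \<in> sets N'"
      using openin_sets_borel_measure_space[OF U] radon_probabilityD(2)[OF N] radon_probabilityD(2)[OF N']
      by auto
    fix e :: real assume "0 < e"
    then obtain K where K: "compactin X K" "K \<subseteq> U" "K \<in> sets N" "measure N U \<le> measure N K + e"
      using radon_probability_inner_regular[OF N UN(1)] by blast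
    have "closedin X K" "closedin X (topspace X - U)"
      using K U X by (auto simp: compactin_imp_closedin)
    then obtain f where f: "continuous_map X euclideanreal f"
      "\<And>x. x \<in> topspace X \<Longrightarrow> 0 \<le> f x \<and> f x \<le> (1::real)"
      "\<And>x. x \<in> topspace X - U \<Longrightarrow> f x = 0" "\<And>x. x \<in> K \<Longrightarrow> f x = 1"
      using urysohn_compact_Hausdorff[OF X, of "topspace X - U" K] K(2) by blast
    have sp: "space N = topspace X" "space N' = topspace X"
      using N N' radon_probabilityD(1) by blast+
    have "measure N K = (\<integral>x. indicator K x \<partial>N)" using K by simp
    also have "\<dots> \<le> (\<integral>x. f x \<partial>N)"
    proof (rule integral_mono)
      show "integrable N f" by (rule integrable_continuous_map[OF X(1) N f(1)])
      show "integrable N (indicat_real K)"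
        using K(3) by (simp add: N.emeasure_eq_measure)
      show "indicat_real K x \<le> f x" if "x \<in> space N" for x
        using f(2)[of x] f(4)[of x] that sp by (auto simp: indicator_def)
    qed
    also have "\<dots> = (\<integral>x. f x \<partial>N')" using eq f by blast
    also have "\<dots> \<le> (\<integral>x. indicator U x \<partial>N')"
    proof (rule integral_mono)
      show "integrable N' f" by (rule integrable_continuous_map[OF X(1) N' f(1)])
      show "integrable N' (indicat_real U)"
        using UN(2) by (simp add: N'.emeasure_eq_measure)
      show "f x \<le> indicat_real U x" if "x \<in> space N'" for x
        using f(2)[of x] f(3)[of x] that sp by (auto simp: indicator_def)
    qed
    also have "\<dots> = measure N' U" using UN by simp
    finally show "measure N U \<le> measure N' U + e" using K by simp
  qed
  interpret N: prob_space N using N radon_probabilityD by blast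
  interpret N': prob_space N' using N' radon_probabilityD by blast
  show ?thesis
  proof (rule measure_eqI_generator_eq[where E="{U. openin X U}" and \<Omega>="topspace X" and A="\<lambda>_. topspace X"])
    show "emeasure N U = emeasure N' U" if "U \<in> {U. openin X U}" for U
      using le[OF N N' eq, of U] le[OF N' N eq[symmetric], of U] that
      by (simp add: N.emeasure_eq_measure N'.emeasure_eq_measure)
    show "sets N = sigma_sets (topspace X) {U. openin X U}"
      "sets N' = sigma_sets (topspace X) {U. openin X U}"
      using radon_probabilityD(2)[OF N] radon_probabilityD(2)[OF N']
      by (auto simp: sets_borel_measure_space)
  qed (auto simp: Int_stable_def dest: openin_subset)
qed

text \<open>A compact subset of the preimage of \<open>E\<close> has a compact image inside
  \<open>E\<close>, of at least the same measure.\<close>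

lemma radon_probability_distr:
  assumes f: "continuous_map X Y f" and "Hausdorff_space Y" and N: "N \<in> radon_probability X"
  shows "distr N (borel_measure_space Y) f \<in> radon_probability Y"
proof (rule radon_probabilityI)
  let ?D = "distr N (borel_measure_space Y) f"
  interpret prob_space N using N radon_probabilityD by blast
  have fm: "f \<in> measurable N (borel_measure_space Y)"
    using continuous_map_measurable f radon_probabilityD(2)[OF N] by blast
  show "prob_space ?D" by (rule prob_space_distr[OF fm])
  fix E and e :: real assume E: "E \<in> sets ?D" and "e > 0"
  have sp: "space N = topspace X" using radon_probabilityD(1)[OF N] by simp
  have "f -` E \<inter> space N \<in> sets N" using E fm measurable_sets by fastforce
  then obtain K where K: "compactin X K" "K \<subseteq> f -` E \<inter> space N" "K \<in> sets N"
      "measure N (f -` E \<inter> space N) \<le> measure N K + e"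
    using radon_probability_inner_regular[OF N _ \<open>e > 0\<close>] by blast
  have cK: "compactin Y (f ` K)"
    using K f image_compactin by blast
  then have fK: "f ` K \<in> sets (borel_measure_space Y)"
    using assms(2) closedin_sets_borel_measure_space compactin_imp_closedin by blast
  have "measure N K \<le> measure N (f -` (f ` K) \<inter> space N)"
    using K measurable_sets[OF fm fK] by (intro finite_measure_mono) auto
  then show "\<exists>K. compactin Y K \<and> K \<subseteq> E \<and> measure ?D E \<le> measure ?D K + e"
    using cK K E fm fK by (intro exI[of _ "f ` K"]) (auto simp: measure_distr)
qed (use assms in auto)

subsection \<open>The Riesz representation theorem\<close>

text \<open>Functions are total on the type, while continuity only concerns
  \<open>topspace X\<close>. By \<open>nonneg\<close>, applied to differences,
  \<open>\<Lambda>\<close> depends only on the values of a continuous function on the space.\<close>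

locale normalized_positive_functional =
  fixes X :: "'b topology" and \<Lambda> :: "('b \<Rightarrow> real) \<Rightarrow> real"
  assumes compact: "compact_space X" and Hausdorff: "Hausdorff_space X"
    and add: "continuous_map X euclideanreal f \<Longrightarrow> continuous_map X euclideanreal g \<Longrightarrow>
      \<Lambda> (\<lambda>x. f x + g x) = \<Lambda> f + \<Lambda> g"
    and scale: "continuous_map X euclideanreal f \<Longrightarrow> \<Lambda> (\<lambda>x. c * f x) = c * \<Lambda> f"
    and nonneg: "continuous_map X euclideanreal f \<Longrightarrow> (\<And>x. x \<in> topspace X \<Longrightarrow> 0 \<le> f x) \<Longrightarrow> 0 \<le> \<Lambda> f"
    and one: "\<Lambda> (\<lambda>_. 1) = 1"
begin

lemma diff:
  assumes "continuous_map X euclideanreal f" "continuous_map X euclideanreal g"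
  shows "\<Lambda> (\<lambda>x. f x - g x) = \<Lambda> f - \<Lambda> g"
  using add[of f "\<lambda>x. (-1) * g x"] scale[of g "-1"] assms by (simp add: continuous_intros)

lemma mono:
  assumes "continuous_map X euclideanreal f" "continuous_map X euclideanreal g"
    and "\<And>x. x \<in> topspace X \<Longrightarrow> f x \<le> g x"
  shows "\<Lambda> f \<le> \<Lambda> g"
  using nonneg[of "\<lambda>x. g x - f x"] diff[of g f] assms by (simp add: continuous_intros)

lemma const: "\<Lambda> (\<lambda>_. c) = c"
  using scale[of "\<lambda>_. 1" c] one by simp

lemma sum:
  assumes "finite I" "\<And>i. i \<in> I \<Longrightarrow> continuous_map X euclideanreal (f i)"
  shows "\<Lambda> (\<lambda>x. \<Sum>i\<in>I. f i x) = (\<Sum>i\<in>I. \<Lambda> (f i))"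
  using assms by (induction I rule: finite_induct) (simp_all add: const add continuous_map_sum)

text \<open>The usual construction asks for the support to lie in \<open>U\<close>. Here
  \<open>f\<close> merely vanishes off \<open>U\<close>, a pointwise condition; the room between
  \<open>f\<close> and the boundary of \<open>U\<close> is recovered by truncation.\<close>

definition below :: "'b set \<Rightarrow> ('b \<Rightarrow> real) set" where
  "below U = {f. continuous_map X euclideanreal f \<and> (\<forall>x\<in>topspace X. 0 \<le> f x \<and> f x \<le> 1) \<and>
     (\<forall>x\<in>topspace X - U. f x = 0)}"

definition content :: "'b set \<Rightarrow> ennreal" where
  "content U = (SUP f\<in>below U. ennreal (\<Lambda> f))"

definition outer :: "'b set \<Rightarrow> ennreal" where
  "outer E = (INF U\<in>{U. openin X U \<and> E \<subseteq> U}. content U)"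

lemma belowD:
  assumes "f \<in> below U"
  shows "continuous_map X euclideanreal f" "\<And>x. x \<in> topspace X \<Longrightarrow> 0 \<le> f x"
    "\<And>x. x \<in> topspace X \<Longrightarrow> f x \<le> 1" "\<And>x. x \<in> topspace X \<Longrightarrow> x \<notin> U \<Longrightarrow> f x = 0"
  using assms by (auto simp: below_def)

lemma zero_in_below: "(\<lambda>_. 0) \<in> below U"
  by (simp add: below_def)

lemma content_upper: "f \<in> below U \<Longrightarrow> ennreal (\<Lambda> f) \<le> content U"
  unfolding content_def by (rule SUP_upper)

lemma below_nonneg: "f \<in> below U \<Longrightarrow> 0 \<le> \<Lambda> f"
  using nonneg belowD by blast

text \<open>The substitute for compact support: lowering \<open>f\<close> by \<open>e\<close> costs
  at most \<open>e\<close>, and the result vanishes off the closed set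
  \<open>{x. e \<le> f x}\<close>, which lies inside \<open>U\<close> when \<open>e\<close> is
  positive.\<close>

lemma truncate_below:
  assumes f: "f \<in> below U" and "e \<ge> 0"
    and V: "\<And>x. x \<in> topspace X \<Longrightarrow> e < f x \<Longrightarrow> x \<in> V"
  shows "(\<lambda>x. max (f x - e) 0) \<in> below V" "\<Lambda> f \<le> \<Lambda> (\<lambda>x. max (f x - e) 0) + e"
proof -
  have c: "continuous_map X euclideanreal (\<lambda>x. max (f x - e) 0)"
    using belowD[OF f] by (intro continuous_intros) auto
  show "(\<lambda>x. max (f x - e) 0) \<in> below V"
    using belowD[OF f] \<open>e \<ge> 0\<close> c V unfolding below_def by (force simp: max_def)
  have "\<Lambda> f \<le> \<Lambda> (\<lambda>x. max (f x - e) 0 + e)"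
    using belowD[OF f] c by (intro mono continuous_intros) auto
  then show "\<Lambda> f \<le> \<Lambda> (\<lambda>x. max (f x - e) 0) + e"
    using add[OF c, of "\<lambda>_. e"] const by simp
qed

text \<open>Since truncation costs arbitrarily little, upper bounds on a content need only be
  checked on truncated functions. The summand \<open>c\<close> is carried along for the Caratheodory
  criterion, where it is the outer measure of \<open>E - U\<close>.\<close>

lemma content_add_leI:
  assumes "\<And>f e. f \<in> below U \<Longrightarrow> e > 0 \<Longrightarrow> ennreal (\<Lambda> (\<lambda>x. max (f x - e) 0)) + c \<le> d"
  shows "content U + c \<le> d"
proof -
  have "(SUP f\<in>below U. ennreal (\<Lambda> f) + c) \<le> d"
  proof (rule SUP_least, rule ennreal_le_epsilon)
    fix f and e :: real assume f: "f \<in> below U" and "0 < e"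
    then have h: "(\<lambda>x. max (f x - e) 0) \<in> below U" "\<Lambda> f \<le> \<Lambda> (\<lambda>x. max (f x - e) 0) + e"
      using truncate_below[OF f, of e U] belowD(4)[OF f] by force+
    then have "ennreal (\<Lambda> f) \<le> ennreal (\<Lambda> (\<lambda>x. max (f x - e) 0)) + ennreal e"
      using below_nonneg[OF h(1)] \<open>0 < e\<close> by (simp flip: ennreal_plus)
    then have "ennreal (\<Lambda> f) + c \<le> (ennreal (\<Lambda> (\<lambda>x. max (f x - e) 0)) + c) + ennreal e"
      using add_right_mono[of _ _ c] by (simp add: ac_simps)
    also have "\<dots> \<le> d + ennreal e"
      using assms[OF f \<open>0 < e\<close>] by (rule add_right_mono)
    finally show "ennreal (\<Lambda> f) + c \<le> d + ennreal e" .
  qed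
  then show ?thesis
    unfolding content_def using zero_in_below by (subst ennreal_SUP_add_left[symmetric]) auto
qed

lemmas content_leI = content_add_leI[where c=0, simplified]

lemma closedin_superlevel: "continuous_map X euclideanreal f \<Longrightarrow> closedin X {x \<in> topspace X. e \<le> f x}"
  using closedin_continuous_map_preimage[of X euclideanreal f "{e..}"] by simp

lemma content_mono: "U \<subseteq> V \<Longrightarrow> content U \<le> content V"
  unfolding content_def by (rule SUP_subset_mono) (auto simp: below_def)

text \<open>A partition of unity for two sets: \<open>g\<close> separates \<open>K - U\<close> from
  \<open>K - V\<close>, and \<open>h\<close> vanishes off \<open>K\<close>, so \<open>h * g\<close>
  vanishes off \<open>U\<close> and \<open>h * (1 - g)\<close> off \<open>V\<close>.\<close>

lemma content_Un:
  assumes U: "openin X U" and V: "openin X V"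
  shows "content (U \<union> V) \<le> content U + content V"
proof (rule content_leI)
  fix f and e :: real assume f: "f \<in> below (U \<union> V)" and "0 < e"
  define K where "K = {x \<in> topspace X. e \<le> f x}"
  define h where "h = (\<lambda>x. max (f x - e) 0)"
  have h: "h \<in> below (U \<union> V)"
    unfolding h_def using \<open>0 < e\<close> belowD(4)[OF f] by (intro truncate_below[OF f]) force+
  have K: "closedin X K" unfolding K_def by (rule closedin_superlevel[OF belowD(1)[OF f]])
  have KUV: "K \<subseteq> U \<union> V"
    using belowD(4)[OF f] \<open>0 < e\<close> unfolding K_def by force
  have h0: "h x = 0" if "x \<in> topspace X" "x \<notin> K" for x
    using that by (auto simp: h_def K_def)
  obtain g :: "'b \<Rightarrow> real" where g: "continuous_map X euclideanreal g"
      "\<And>x. x \<in> topspace X \<Longrightarrow> 0 \<le> g x \<and> g x \<le> 1"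
      "\<And>x. x \<in> K - U \<Longrightarrow> g x = 0" "\<And>x. x \<in> K - V \<Longrightarrow> g x = 1"
  proof -
    have "closedin X (K - U)" "closedin X (K - V)" "(K - U) \<inter> (K - V) = {}"
      using K U V KUV by (auto intro: closedin_diff)
    from urysohn_compact_Hausdorff[OF compact Hausdorff this] that show ?thesis by metis
  qed
  have 1: "(\<lambda>x. h x * g x) \<in> below U"
    unfolding below_def using belowD[OF h] g h0
    by (fastforce intro!: continuous_intros mult_nonneg_nonneg mult_le_one)
  have 2: "(\<lambda>x. h x * (1 - g x)) \<in> below V"
    unfolding below_def using belowD[OF h] g h0
    by (fastforce intro!: continuous_intros mult_nonneg_nonneg mult_le_one)
  have "\<Lambda> h = \<Lambda> (\<lambda>x. h x * g x) + \<Lambda> (\<lambda>x. h x * (1 - g x))"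
    using add[OF belowD(1)[OF 1] belowD(1)[OF 2]] by (simp add: algebra_simps)
  then have "ennreal (\<Lambda> h) = ennreal (\<Lambda> (\<lambda>x. h x * g x)) + ennreal (\<Lambda> (\<lambda>x. h x * (1 - g x)))"
    using below_nonneg[OF 1] below_nonneg[OF 2] by simp
  also have "\<dots> \<le> content U + content V"
    by (intro add_mono content_upper 1 2)
  finally show "ennreal (\<Lambda> (\<lambda>x. max (f x - e) 0)) \<le> content U + content V"
    unfolding h_def .
qed

lemma content_empty: "content {} = 0"
proof -
  have "\<Lambda> f = 0" if "f \<in> below {}" for f
    using mono[of f "\<lambda>_. 0"] const[of 0] below_nonneg[OF that] belowD[OF that] by fastforce
  then show ?thesis
    unfolding content_def by (auto simp: zero_in_below intro!: SUP_eqI)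
qed

lemma content_UN_finite:
  fixes U :: "nat \<Rightarrow> 'b set"
  assumes "\<And>i. openin X (U i)"
  shows "content (\<Union>i<n. U i) \<le> (\<Sum>i<n. content (U i))"
proof (induction n)
  case (Suc n)
  have "content (\<Union>i<Suc n. U i) \<le> content (\<Union>i<n. U i) + content (U n)"
    using content_Un[of "\<Union>i<n. U i" "U n"] assms by (auto simp: lessThan_Suc Un_commute)
  also have "\<dots> \<le> (\<Sum>i<Suc n. content (U i))"
    using Suc by (simp add: add_right_mono)
  finally show ?case .
qed (simp add: content_empty)

text \<open>The superlevel set \<open>K\<close> is compact, so finitely many of the sets already
  carry the truncated function.\<close>

lemma content_UN:
  fixes U :: "nat \<Rightarrow> 'b set"
  assumes U: "\<And>i. openin X (U i)"
  shows "content (\<Union>i. U i) \<le> (\<Sum>i. content (U i))"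
proof (rule content_leI)
  fix f and e :: real assume f: "f \<in> below (\<Union>i. U i)" and "0 < e"
  define K where "K = {x \<in> topspace X. e \<le> f x}"
  have "compactin X K"
    unfolding K_def using closedin_superlevel[OF belowD(1)[OF f]] compact closedin_compact_space by blast
  moreover have "K \<subseteq> \<Union> (range U)"
    using belowD(4)[OF f] \<open>0 < e\<close> unfolding K_def by force
  ultimately obtain \<F> where "finite \<F>" "\<F> \<subseteq> range U" "K \<subseteq> \<Union>\<F>"
    using U compactinD[of X K "range U"] by blast
  then obtain C where C: "finite C" "K \<subseteq> \<Union> (U ` C)"
    by (metis finite_subset_image)
  then obtain n where "C \<subseteq> {..<n}"
    using finite_nat_iff_bounded by auto
  then have n: "K \<subseteq> (\<Union>i<n. U i)" using C(2) by blast
  have h: "(\<lambda>x. max (f x - e) 0) \<in> below (\<Union>i<n. U i)"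
  proof (rule truncate_below(1)[OF f])
    show "x \<in> (\<Union>i<n. U i)" if "x \<in> topspace X" "e < f x" for x
    proof -
      have "x \<in> K" using that by (simp add: K_def)
      then show ?thesis using n by blast
    qed
  qed (use \<open>0 < e\<close> in simp)
  have "ennreal (\<Lambda> (\<lambda>x. max (f x - e) 0)) \<le> content (\<Union>i<n. U i)"
    by (rule content_upper[OF h])
  also have "\<dots> \<le> (\<Sum>i<n. content (U i))" by (rule content_UN_finite[OF U])
  also have "\<dots> \<le> (\<Sum>i. content (U i))" by (rule sum_le_suminf) auto
  finally show "ennreal (\<Lambda> (\<lambda>x. max (f x - e) 0)) \<le> (\<Sum>i. content (U i))" .
qed

section \<open>The outer measure and the Caratheodory criterion\<close>

lemma outer_openin: "openin X U \<Longrightarrow> outer U = content U"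
  unfolding outer_def by (intro antisym INF_lower INF_greatest) (auto intro: content_mono)

lemma outer_mono: "E \<subseteq> F \<Longrightarrow> outer E \<le> outer F"
  unfolding outer_def by (rule INF_superset_mono) auto

lemma content_topspace: "content (topspace X) = 1"
proof (rule antisym)
  show "content (topspace X) \<le> 1"
    unfolding content_def
  proof (rule SUP_least)
    fix f assume f: "f \<in> below (topspace X)"
    then have "\<Lambda> f \<le> 1"
      using mono[of f "\<lambda>_. 1"] belowD[OF f] const[of 1] by simp
    then show "ennreal (\<Lambda> f) \<le> 1" by simp
  qed
  have "(\<lambda>_. 1) \<in> below (topspace X)" by (simp add: below_def)
  from content_upper[OF this] show "1 \<le> content (topspace X)" by (simp add: one)
qed

lemma outer_le_one: "E \<subseteq> topspace X \<Longrightarrow> outer E \<le> 1"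
  using outer_mono[of E "topspace X"] outer_openin[of "topspace X"] content_topspace by simp

lemma outer_approx:
  assumes "E \<subseteq> topspace X" "0 < e"
  obtains U where "openin X U" "E \<subseteq> U" "content U \<le> outer E + ennreal e"
proof -
  have "outer E \<noteq> \<infinity>" using outer_le_one[OF assms(1)] by (auto simp: top_unique)
  then have "outer E < outer E + ennreal e"
    using assms(2) by (cases "outer E") (auto simp flip: ennreal_plus simp: ennreal_less_iff)
  then obtain U where "openin X U" "E \<subseteq> U" "content U < outer E + ennreal e"
    unfolding outer_def INF_less_iff by auto
  then show ?thesis using that by (meson less_imp_le)
qed

lemma outer_measure_space: "outer_measure_space (Pow (topspace X)) outer"
  unfolding outer_measure_space_def
proof (intro conjI)
  show "positive (Pow (topspace X)) outer"
    by (simp add: positive_def outer_openin content_empty)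
  show "increasing (Pow (topspace X)) outer"
    by (simp add: increasing_def outer_mono)
  show "countably_subadditive (Pow (topspace X)) outer"
    unfolding countably_subadditive_def
  proof (intro allI impI)
    fix A :: "nat \<Rightarrow> 'b set" assume A: "range A \<subseteq> Pow (topspace X)"
    show "outer (\<Union>i. A i) \<le> (\<Sum>i. outer (A i))"
    proof (rule ennreal_le_epsilon)
      fix e :: real assume "0 < e"
      have "\<exists>U. openin X U \<and> A i \<subseteq> U \<and> content U \<le> outer (A i) + ennreal (e * (1/2)^Suc i)" for i
        using outer_approx[of "A i" "e * (1/2)^Suc i"] A \<open>0 < e\<close>
        by (metis PowD mult_pos_pos range_subsetD zero_less_divide_1_iff zero_less_numeral zero_less_power)
      then obtain U where U: "\<And>i. openin X (U i)" "\<And>i. A i \<subseteq> U i"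
          "\<And>i. content (U i) \<le> outer (A i) + ennreal (e * (1/2)^Suc i)" by metis
      have "outer (\<Union>i. A i) \<le> outer (\<Union>i. U i)"
        using U(2) by (intro outer_mono) blast
      also have "\<dots> = content (\<Union>i. U i)"
        using U(1) by (intro outer_openin) blast
      also have "\<dots> \<le> (\<Sum>i. content (U i))"
        by (rule content_UN[OF U(1)])
      also have "\<dots> \<le> (\<Sum>i. outer (A i) + ennreal (e * (1/2)^Suc i))"
        using U(3) by (intro suminf_le) auto
      also have "\<dots> = (\<Sum>i. outer (A i)) + (\<Sum>i. ennreal (e * (1/2)^Suc i))"
        by (rule suminf_add[symmetric]) auto
      also have "(\<Sum>i. ennreal (e * (1/2)^Suc i)) = ennreal e"
        using sums_mult[OF power_half_series, of e] \<open>0 < e\<close>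
        by (intro suminf_ennreal_eq) (auto simp: mult_nonneg_nonneg)
      finally show "outer (\<Union>i. A i) \<le> (\<Sum>i. outer (A i)) + ennreal e" .
    qed
  qed
qed

lemma outer_subadditive:
  assumes "A \<subseteq> topspace X" "B \<subseteq> topspace X"
  shows "outer (A \<union> B) \<le> outer A + outer B"
proof -
  interpret sigma_algebra "topspace X" "Pow (topspace X)" by (rule sigma_algebra_Pow)
  have "subadditive (Pow (topspace X)) outer"
    using outer_measure_space countably_subadditive_subadditive
    by (auto simp: outer_measure_space_def)
  moreover have "A \<union> B = A \<union> (B - A)" "A \<inter> (B - A) = {}" by auto
  ultimately have "outer (A \<union> B) \<le> outer A + outer (B - A)"
    using assms unfolding subadditive_def by (metis Diff_subset PowI order_trans)
  also have "\<dots> \<le> outer A + outer B"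
    by (intro add_left_mono outer_mono) auto
  finally show ?thesis .
qed

text \<open>Let \<open>W\<close> be open around \<open>E\<close>. A truncated function
  \<open>h\<close> below \<open>W \<inter> U\<close> vanishes off the closed set \<open>K\<close>,
  so \<open>h + g\<close> stays below \<open>W\<close> for each \<open>g\<close> below
  \<open>W - K\<close>. Because \<open>E - U\<close> lies in \<open>W - K\<close>, this gives the
  nontrivial half of the Caratheodory criterion.\<close>

lemma openin_lambda_system:
  assumes U: "openin X U"
  shows "U \<in> lambda_system (topspace X) (Pow (topspace X)) outer"
proof -
  interpret sigma_algebra "topspace X" "Pow (topspace X)" by (rule sigma_algebra_Pow)
  have *: "outer (E \<inter> U) + outer (E - U) \<le> content W" if W: "openin X W" "E \<subseteq> W" for E W
  proof -
    have le: "ennreal (\<Lambda> (\<lambda>x. max (f x - e) 0)) + outer (E - U) \<le> content W"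
      if f: "f \<in> below (W \<inter> U)" and "0 < e" for f and e :: real
    proof -
      define K where "K = {x \<in> topspace X. e \<le> f x}"
      define h where "h = (\<lambda>x. max (f x - e) 0)"
      have h: "h \<in> below (W \<inter> U)"
        unfolding h_def using \<open>0 < e\<close> belowD(4)[OF f] by (intro truncate_below[OF f]) force+
      have K: "closedin X K" unfolding K_def by (rule closedin_superlevel[OF belowD(1)[OF f]])
      have KU: "K \<subseteq> W \<inter> U"
        using belowD(4)[OF f] \<open>0 < e\<close> unfolding K_def by force
      have "ennreal (\<Lambda> h) + content (W - K) \<le> content W"
      proof -
        have "ennreal (\<Lambda> h) + content (W - K) = (SUP g\<in>below (W - K). ennreal (\<Lambda> h) + ennreal (\<Lambda> g))"
          unfolding content_def using zero_in_below by (intro ennreal_SUP_add_right) auto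
        also have "\<dots> \<le> content W"
        proof (rule SUP_least)
          fix g assume g: "g \<in> below (W - K)"
          have "(\<lambda>x. h x + g x) \<in> below W"
          proof -
            have "h x + g x \<le> 1 \<and> (x \<notin> W \<longrightarrow> h x + g x = 0)" if "x \<in> topspace X" for x
              using belowD(3,4)[OF g, of x] belowD(3,4)[OF h, of x] that
              by (cases "x \<in> K") (auto simp: K_def h_def)
            then show ?thesis
              using belowD(1,2)[OF h] belowD(1,2)[OF g] unfolding below_def
              by (auto intro!: continuous_intros)
          qed
          from content_upper[OF this]
          show "ennreal (\<Lambda> h) + ennreal (\<Lambda> g) \<le> content W"
            using add[OF belowD(1)[OF h] belowD(1)[OF g]] below_nonneg[OF h] below_nonneg[OF g]
            by simp
        qed
        finally show ?thesis .
      qed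
      moreover have "outer (E - U) \<le> content (W - K)"
        using W U K KU outer_openin[of "W - K"] outer_mono[of "E - U" "W - K"]
        by (metis Diff_mono Int_lower2 dual_order.trans openin_diff)
      ultimately show ?thesis
        unfolding h_def by (meson add_left_mono order_trans)
    qed
    have "outer (E \<inter> U) \<le> content (W \<inter> U)"
      using outer_mono[of "E \<inter> U" "W \<inter> U"] outer_openin[OF openin_Int[OF W(1) U]] W(2) by auto
    then have "outer (E \<inter> U) + outer (E - U) \<le> content (W \<inter> U) + outer (E - U)"
      by (rule add_right_mono)
    also have "\<dots> \<le> content W"
      by (rule content_add_leI[OF le])
    finally show ?thesis .
  qed
  have "outer (E \<inter> U) + outer (E - U) = outer E" if "E \<subseteq> topspace X" for E
  proof (rule antisym)
    show "outer (E \<inter> U) + outer (E - U) \<le> outer E"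
      unfolding outer_def[of E] using * by (intro INF_greatest) auto
    show "outer E \<le> outer (E \<inter> U) + outer (E - U)"
      using outer_subadditive[of "E \<inter> U" "E - U"] that by (simp add: Int_Diff_Un le_infI1 Diff_subset[THEN order_trans])
  qed
  then show ?thesis
    using U openin_subset by (auto simp: lambda_system_eq)
qed

section \<open>The Riesz measure and its integral\<close>

definition riesz_measure :: "'b measure" where
  "riesz_measure = measure_of (topspace X) {U. openin X U} outer"

lemma sets_riesz_measure: "sets riesz_measure = sets (borel_measure_space X)"
  unfolding riesz_measure_def sets_borel_measure_space
  by (rule sets_measure_of) (auto dest: openin_subset)

lemma space_riesz_measure: "space riesz_measure = topspace X"
  unfolding riesz_measure_def by (rule space_measure_of) (auto dest: openin_subset)

text \<open>\<open>measure_of\<close> yields zero unless the set function is a measure on the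
  generated sigma-algebra. Caratheodory supplies this: the sets splitting \<open>outer\<close>
  additively form a sigma-algebra, and it contains the open sets.\<close>

lemma emeasure_riesz_measure:
  assumes "A \<in> sets riesz_measure"
  shows "emeasure riesz_measure A = outer A"
proof -
  interpret sigma_algebra "topspace X" "Pow (topspace X)" by (rule sigma_algebra_Pow)
  have Pow: "{U. openin X U} \<subseteq> Pow (topspace X)" by (auto dest: openin_subset)
  have ms: "measure_space (topspace X) (lambda_system (topspace X) (Pow (topspace X)) outer) outer"
    by (rule caratheodory_lemma[OF outer_measure_space])
  have "sigma_sets (topspace X) {U. openin X U} \<subseteq> lambda_system (topspace X) (Pow (topspace X)) outer"
    using ms openin_lambda_system
    by (intro sigma_algebra.sigma_sets_subset) (auto simp: measure_space_def)
  from measure_down[OF ms _ this]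
  have "measure_space (topspace X) (sigma_sets (topspace X) {U. openin X U}) outer"
    using sigma_algebra_sigma_sets[OF Pow] by blast
  then show ?thesis
    using assms Pow unfolding riesz_measure_def
    by (intro emeasure_measure_of[OF refl]) (auto simp: measure_space_def sets_measure_of)
qed

lemma prob_space_riesz_measure: "prob_space riesz_measure"
  using emeasure_riesz_measure[of "topspace X"] sets_riesz_measure space_riesz_measure
    outer_openin[of "topspace X"] content_topspace openin_sets_borel_measure_space[of X "topspace X"]
  by (intro prob_spaceI) simp

text \<open>The construction is outer regular by open sets. Passing to complements turns an open set
  around the complement of \<open>E\<close> into a closed, hence compact, subset of
  \<open>E\<close>.\<close>

lemma radon_riesz_measure: "riesz_measure \<in> radon_probability X"
proof (rule radon_probabilityI)
  interpret prob_space riesz_measure by (rule prob_space_riesz_measure)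
  fix E and e :: real assume E: "E \<in> sets riesz_measure" and "e > 0"
  have ES: "E \<subseteq> topspace X" using E sets.sets_into_space space_riesz_measure by blast
  obtain U where U: "openin X U" "topspace X - E \<subseteq> U" "content U \<le> outer (topspace X - E) + ennreal e"
    using outer_approx[of "topspace X - E" e] \<open>e > 0\<close> by auto
  have UN: "U \<in> sets riesz_measure"
    using U openin_sets_borel_measure_space sets_riesz_measure by blast
  have CE: "topspace X - E \<in> sets riesz_measure"
    using sets.compl_sets[OF E] space_riesz_measure by simp
  have "emeasure riesz_measure U \<le> emeasure riesz_measure (topspace X - E) + ennreal e"
    using U outer_openin emeasure_riesz_measure[OF UN] emeasure_riesz_measure[OF CE] by simp
  then have "prob U \<le> prob (topspace X - E) + e"
    using \<open>e > 0\<close> by (simp add: emeasure_eq_measure flip: ennreal_plus)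
  then have "prob E \<le> prob (topspace X - U) + e"
    using prob_compl[OF E] prob_compl[OF UN] space_riesz_measure by simp
  moreover have "compactin X (topspace X - U)"
    using U(1) compact by (intro closedin_compact_space) auto
  ultimately show "\<exists>K. compactin X K \<and> K \<subseteq> E \<and> prob E \<le> prob K + e"
    using U(2) by blast
qed (auto simp: sets_riesz_measure space_riesz_measure prob_space_riesz_measure Hausdorff)

text \<open>Slicing \<open>f\<close> horizontally into \<open>n\<close> layers of height \<open>1/n\<close>: each layer is at most \<open>1/n\<close> times the
  indicator of an open superlevel set.\<close>

lemma le_integral_unit:
  assumes f: "continuous_map X euclideanreal f" "\<And>x. x \<in> topspace X \<Longrightarrow> 0 \<le> f x"
    "\<And>x. x \<in> topspace X \<Longrightarrow> f x \<le> 1"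
  shows "\<Lambda> f \<le> (\<integral>x. f x \<partial>riesz_measure)"
proof (rule field_le_epsilon)
  interpret prob_space riesz_measure by (rule prob_space_riesz_measure)
  fix e :: real assume "e > 0"
  then obtain m where "1 / real (Suc m) < e"
    using nat_approx_posE by blast
  define n where "n = Suc m"
  have n: "n > 0" "1 / n < e" using \<open>1 / real (Suc m) < e\<close> by (auto simp: n_def)
  define g where "g k x = min (max (f x - k / n) 0) (1 / n)" for k :: nat and x
  define U where "U k = {x \<in> topspace X. k / n < f x}" for k :: nat
  have g: "continuous_map X euclideanreal (g k)" for k
    unfolding g_def using f(1) by (intro continuous_intros) auto
  have U: "openin X (U k)" for k
    unfolding U_def using openin_continuous_map_preimage[OF f(1), of "{k / n<..}"] by simp
  have UN: "U k \<in> sets riesz_measure" for k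
    using U openin_sets_borel_measure_space sets_riesz_measure by blast
  have sum_g: "(\<Sum>k<j. g k x) = min (f x) (j / n)" if "x \<in> topspace X" for x j
  proof (induction j)
    case (Suc j)
    have "0 \<le> 1 / real n" "real (Suc j) / n = j / n + 1 / n"
      by (simp_all add: add_divide_distrib)
    then have "min (f x) (j / n) + g j x = min (f x) (real (Suc j) / n)"
      unfolding g_def by linarith
    then show ?case using Suc by simp
  qed (use f(2) that in simp)
  \<comment> \<open>At most \<open>n * f x + 1\<close> indices \<open>k\<close> satisfy
    \<open>k / n < f x\<close>; after division by \<open>n\<close> the surplus 1 becomes the error
    \<open>1 / n\<close>.\<close>
  have sum_U: "(\<Sum>k<j. indicat_real (U k) x) \<le> n * f x + 1" if "x \<in> topspace X" for x j
  proof (induction j)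
    case (Suc j)
    have *: "(\<Sum>k<Suc j. indicat_real (U k) x) \<le> real (Suc j)"
      using sum_mono[of "{..<Suc j}" "\<lambda>k. indicat_real (U k) x" "\<lambda>_. 1"] by (auto simp: indicator_def)
    show ?case
    proof (cases "x \<in> U j")
      case True
      then have "j \<le> n * f x" using n by (auto simp: U_def field_simps)
      then show ?thesis using * by simp
    next
      case False
      then show ?thesis using Suc by simp
    qed
  qed (use f(2) that in simp)
  have "\<Lambda> (g k) \<le> measure riesz_measure (U k) / n" for k
  proof -
    have "0 \<le> g k x" "g k x \<le> 1 / n" for x using n by (auto simp: g_def)
    then have "0 \<le> n * g k x" "n * g k x \<le> 1" for x
      using n by (auto simp: field_simps)
    moreover have "g k x = 0" if "x \<in> topspace X - U k" for x
      using that n by (auto simp: U_def g_def)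
    moreover have "continuous_map X euclideanreal (\<lambda>x. n * g k x)"
      using g by (intro continuous_intros) auto
    ultimately have "(\<lambda>x. n * g k x) \<in> below (U k)"
      by (simp add: below_def)
    then have "ennreal (\<Lambda> (\<lambda>x. n * g k x)) \<le> emeasure riesz_measure (U k)"
      using content_upper outer_openin[OF U] emeasure_riesz_measure[OF UN] by simp
    then have "n * \<Lambda> (g k) \<le> measure riesz_measure (U k)"
      using scale[OF g] by (simp add: emeasure_eq_measure)
    then show ?thesis using n by (simp add: field_simps)
  qed
  moreover have "\<Lambda> f = (\<Sum>k<n. \<Lambda> (g k))"
  proof -
    have "\<Lambda> f = \<Lambda> (\<lambda>x. \<Sum>k<n. g k x)"
      using sum_g[of _ n] f n g by (intro antisym mono continuous_map_sum) auto
    then show ?thesis using sum[of "{..<n}" g] g by simp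
  qed
  ultimately have "\<Lambda> f \<le> (\<Sum>k<n. measure riesz_measure (U k)) / n"
    by (simp add: sum_divide_distrib sum_mono)
  also have "(\<Sum>k<n. measure riesz_measure (U k)) = (\<integral>x. (\<Sum>k<n. indicat_real (U k) x) \<partial>riesz_measure)"
    using UN by (subst Bochner_Integration.integral_sum) (auto simp: emeasure_eq_measure)
  also have "\<dots> \<le> (\<integral>x. n * f x + 1 \<partial>riesz_measure)"
  proof (rule integral_mono)
    show "integrable riesz_measure (\<lambda>x. \<Sum>k<n. indicat_real (U k) x)"
      using UN by (auto simp: emeasure_eq_measure)
    show "integrable riesz_measure (\<lambda>x. n * f x + 1)"
      using f(1) by (intro integrable_continuous_map[OF compact radon_riesz_measure] continuous_intros) auto
  qed (use sum_U space_riesz_measure in auto)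
  also have "\<dots> = n * (\<integral>x. f x \<partial>riesz_measure) + 1"
    using integrable_continuous_map[OF compact radon_riesz_measure f(1)] prob_space by simp
  finally have "\<Lambda> f \<le> (n * (\<integral>x. f x \<partial>riesz_measure) + 1) / n"
    using n by (simp add: divide_right_mono)
  also have "\<dots> = (\<integral>x. f x \<partial>riesz_measure) + 1 / n"
    using n by (simp add: field_simps)
  finally show "\<Lambda> f \<le> (\<integral>x. f x \<partial>riesz_measure) + e" using n by simp
qed

text \<open>For values in the unit interval the inequality for \<open>g\<close> and the one for
  \<open>1 - g\<close> together give equality; the general case follows by affine rescaling.\<close>

lemma integral_riesz_measure:
  assumes f: "continuous_map X euclideanreal f"
  shows "(\<integral>x. f x \<partial>riesz_measure) = \<Lambda> f"
proof -
  interpret prob_space riesz_measure by (rule prob_space_riesz_measure)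
  note int = integrable_continuous_map[OF compact radon_riesz_measure]
  obtain B where B: "B > 0" "\<And>x. x \<in> topspace X \<Longrightarrow> \<bar>f x\<bar> \<le> B"
    using continuous_map_compact_bounded[OF compact f] by (metis real_norm_def)
  \<comment> \<open>The affine map sending \<open>-B\<close> to 0 and \<open>B\<close> to 1, applied
    to \<open>f\<close>.\<close>
  define g where "g x = 1 / 2 + (1 / (2 * B)) * f x" for x
  have g: "continuous_map X euclideanreal g"
    unfolding g_def using f by (intro continuous_intros) auto
  have g01: "0 \<le> g x" "g x \<le> 1" if "x \<in> topspace X" for x
    using B(2)[OF that] B(1) by (auto simp: g_def field_simps)
  have cB: "continuous_map X euclideanreal (\<lambda>x. (1 / (2 * B)) * f x)"
    using f by (intro continuous_intros) auto
  have "\<Lambda> (\<lambda>x. 1 - g x) \<le> (\<integral>x. 1 - g x \<partial>riesz_measure)"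
    using g g01 by (intro le_integral_unit continuous_intros) auto
  then have "\<Lambda> g \<ge> (\<integral>x. g x \<partial>riesz_measure)"
    using diff[of "\<lambda>_. 1" g] g one int[OF g] prob_space by simp
  moreover have "\<Lambda> g \<le> (\<integral>x. g x \<partial>riesz_measure)"
    using g g01 by (intro le_integral_unit)
  moreover have "\<Lambda> g = 1 / 2 + (1 / (2 * B)) * \<Lambda> f"
    unfolding g_def using add[OF _ cB, of "\<lambda>_. 1 / 2"] scale[OF f, of "1 / (2 * B)"] const[of "1 / 2"]
    by (simp del: times_divide_eq_left)
  moreover have "(\<integral>x. g x \<partial>riesz_measure) = 1 / 2 + (1 / (2 * B)) * (\<integral>x. f x \<partial>riesz_measure)"
    unfolding g_def using int[OF f] prob_space by simp
  ultimately show ?thesis using B(1) by simp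
qed

end

subsection \<open>Representing partially defined positive functionals\<close>

text \<open>A positive functional that is only defined on a space of functions containing the constants is
  given by its graph \<open>G\<close>.\<close>

definition positive_linear_relation :: "'b set \<Rightarrow> (('b \<Rightarrow> real) \<times> real) set \<Rightarrow> bool" where
  "positive_linear_relation S G \<longleftrightarrow>
     ((\<lambda>_. 1), 1) \<in> G \<and>
     (\<forall>g r h s. (g, r) \<in> G \<longrightarrow> (h, s) \<in> G \<longrightarrow> ((\<lambda>x. g x + h x), r + s) \<in> G) \<and>
     (\<forall>c g r. (g, r) \<in> G \<longrightarrow> ((\<lambda>x. c * g x), c * r) \<in> G) \<and>
     (\<forall>g r. (g, r) \<in> G \<longrightarrow> (\<forall>x\<in>S. 0 \<le> g x) \<longrightarrow> 0 \<le> r)"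

lemma positive_linear_relationD:
  assumes "positive_linear_relation S G"
  shows "((\<lambda>_. 1), 1) \<in> G"
    "\<And>g r h s. (g, r) \<in> G \<Longrightarrow> (h, s) \<in> G \<Longrightarrow> ((\<lambda>x. g x + h x), r + s) \<in> G"
    "\<And>c g r. (g, r) \<in> G \<Longrightarrow> ((\<lambda>x. c * g x), c * r) \<in> G"
    "\<And>g r. (g, r) \<in> G \<Longrightarrow> (\<And>x. x \<in> S \<Longrightarrow> 0 \<le> g x) \<Longrightarrow> 0 \<le> r"
  using assms unfolding positive_linear_relation_def by blast+

text \<open>Used in both directions it shows that the second component of a pair is determined by
  the values of the function on \<open>S\<close>.\<close>

lemma positive_linear_relation_mono:
  assumes G: "positive_linear_relation S G" and "(g, r) \<in> G" "(h, s) \<in> G"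
    and "\<And>x. x \<in> S \<Longrightarrow> g x \<le> h x"
  shows "r \<le> s"
proof -
  have "((\<lambda>x. h x + (-1) * g x), s + (-1) * r) \<in> G"
    using assms positive_linear_relationD(2,3)[OF G] by blast
  then show ?thesis
    using positive_linear_relationD(4)[OF G] assms(4) by fastforce
qed

text \<open>One step of the M. Riesz extension. Any number between the values of the minorants and
  of the majorants of \<open>h\<close> in \<open>G\<close> would do as \<open>a\<close>; the infimum
  over majorants is taken. Constants lie in \<open>G\<close> and \<open>h\<close> is bounded, so
  both kinds exist.\<close>

lemma positive_linear_relation_extend:
  assumes G: "positive_linear_relation S G" and h: "\<And>x. x \<in> S \<Longrightarrow> \<bar>h x\<bar> \<le> B"
  obtains a where "positive_linear_relation S {((\<lambda>x. g x + t * h x), r + t * a) |g r t. (g, r) \<in> G}"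
proof -
  note D = positive_linear_relationD[OF G]
  define R where "R = {r. \<exists>g. (g, r) \<in> G \<and> (\<forall>x\<in>S. h x \<le> g x)}"
  define a where "a = Inf R"
  have const: "((\<lambda>_. c), c) \<in> G" for c
    using D(3)[OF D(1), of c] by simp
  have "B \<in> R" unfolding R_def using const[of B] h by force
  have lower: "r \<le> r'" if "(g, r) \<in> G" "\<And>x. x \<in> S \<Longrightarrow> g x \<le> h x" "r' \<in> R" for g r r'
    using that positive_linear_relation_mono[OF G that(1)] unfolding R_def by (blast intro: order_trans)
  have a_le: "a \<le> r" if "(g, r) \<in> G" "\<And>x. x \<in> S \<Longrightarrow> h x \<le> g x" for g r
  proof -
    have "bdd_below R"
      using lower[OF const[of "-B"]] h by (intro bdd_belowI[of _ "-B"]) force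
    moreover have "r \<in> R" using that unfolding R_def by blast
    ultimately show ?thesis unfolding a_def by (rule cInf_lower[rotated])
  qed
  have a_ge: "r \<le> a" if "(g, r) \<in> G" "\<And>x. x \<in> S \<Longrightarrow> g x \<le> h x" for g r
    unfolding a_def using \<open>B \<in> R\<close> lower[OF that] by (intro cInf_greatest) auto
  let ?H = "{((\<lambda>x. g x + t * h x), r + t * a) |g r t. (g, r) \<in> G}"
  have HI: "((\<lambda>x. g x + t * h x), r + t * a) \<in> ?H" if "(g, r) \<in> G" for g r t
    using that by blast
  have "positive_linear_relation S ?H"
    unfolding positive_linear_relation_def
  proof (intro conjI allI impI)
    show "((\<lambda>_. 1), 1) \<in> ?H"
    proof -
      have "((\<lambda>x. 1 + 0 * h x), 1 + 0 * a) \<in> ?H" by (rule HI[OF D(1)])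
      then show ?thesis by simp
    qed
  next
    fix g1 r1 g2 r2 assume "(g1, r1) \<in> ?H" "(g2, r2) \<in> ?H"
    then obtain k1 s1 t1 k2 s2 t2 where k: "(k1, s1) \<in> G" "(k2, s2) \<in> G"
        "g1 = (\<lambda>x. k1 x + t1 * h x)" "r1 = s1 + t1 * a" "g2 = (\<lambda>x. k2 x + t2 * h x)" "r2 = s2 + t2 * a"
      by blast
    then have "(\<lambda>x. g1 x + g2 x) = (\<lambda>x. (k1 x + k2 x) + (t1 + t2) * h x)"
        "r1 + r2 = (s1 + s2) + (t1 + t2) * a" "((\<lambda>x. k1 x + k2 x), s1 + s2) \<in> G"
      using D(2) by (auto simp: algebra_simps)
    then show "((\<lambda>x. g1 x + g2 x), r1 + r2) \<in> ?H"
      using HI[of "\<lambda>x. k1 x + k2 x" "s1 + s2" "t1 + t2"] by simp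
  next
    fix c g1 r1 assume "(g1, r1) \<in> ?H"
    then obtain k s t where k: "(k, s) \<in> G" "g1 = (\<lambda>x. k x + t * h x)" "r1 = s + t * a"
      by blast
    then have "(\<lambda>x. c * g1 x) = (\<lambda>x. c * k x + (c * t) * h x)"
        "c * r1 = c * s + (c * t) * a" "((\<lambda>x. c * k x), c * s) \<in> G"
      using D(3)[OF k(1), of c] by (auto simp: algebra_simps)
    then show "((\<lambda>x. c * g1 x), c * r1) \<in> ?H"
      using HI[of "\<lambda>x. c * k x" "c * s" "c * t"] by simp
  next
    fix g1 r1 assume "(g1, r1) \<in> ?H" and nn: "\<forall>x\<in>S. 0 \<le> g1 x"
    then obtain k s t where k: "(k, s) \<in> G" "g1 = (\<lambda>x. k x + t * h x)" "r1 = s + t * a"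
      by blast
    have nn': "0 \<le> k x + t * h x" if "x \<in> S" for x
      using nn that k(2) by simp
    \<comment> \<open>Dividing \<open>k + t h \<ge> 0\<close> by \<open>t\<close> makes
      \<open>(-1/t) * k\<close> a minorant of \<open>h\<close> for positive \<open>t\<close> and a
      majorant for negative \<open>t\<close>.\<close>
    consider "t = 0" | "t > 0" | "t < 0" by linarith
    then show "0 \<le> r1"
    proof cases
      case 1
      then show ?thesis using k nn D(4) by auto
    next
      case 2
      have "(-1/t) * k x \<le> h x" if "x \<in> S" for x
        using nn'[OF that] 2 by (simp add: field_simps)
      then have "(-1/t) * s \<le> a"
        by (rule a_ge[OF D(3)[OF k(1)]])
      then show ?thesis using 2 k by (simp add: field_simps)
    next
      case 3
      have "h x \<le> (-1/t) * k x" if "x \<in> S" for x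
        using nn'[OF that] 3 by (simp add: field_simps)
      then have "a \<le> (-1/t) * s"
        by (rule a_le[OF D(3)[OF k(1)]])
      then show ?thesis using 3 k by (simp add: field_simps)
    qed
  qed
  then show ?thesis by (rule that)
qed

text \<open>Zorn's lemma for graphs ordered by inclusion: the one-step extension by a bounded
  \<open>h\<close> cannot enlarge a maximal graph, so \<open>h\<close> is already in its
  domain.\<close>

lemma positive_linear_relation_total_extension:
  assumes "positive_linear_relation S G"
  obtains H where "positive_linear_relation S H" "G \<subseteq> H"
    "\<And>h B. (\<And>x. x \<in> S \<Longrightarrow> \<bar>h x\<bar> \<le> B) \<Longrightarrow> \<exists>r. (h, r) \<in> H"
proof -
  let ?A = "{H. positive_linear_relation S H \<and> G \<subseteq> H}"
  have "\<exists>M\<in>?A. \<forall>H\<in>?A. M \<subseteq> H \<longrightarrow> H = M"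
  proof (rule subset_Zorn_nonempty)
    fix C assume C: "C \<noteq> {}" "subset.chain ?A C"
    then have CD: "\<And>H. H \<in> C \<Longrightarrow> positive_linear_relation S H \<and> G \<subseteq> H"
      by (auto simp: subset_chain_def)
    have two: "\<exists>H\<in>C. a \<in> H \<and> b \<in> H" if ab: "a \<in> \<Union>C" "b \<in> \<Union>C" for a b
    proof -
      obtain H H' where H: "H \<in> C" "a \<in> H" "H' \<in> C" "b \<in> H'" using ab by auto
      moreover have "H \<subseteq> H' \<or> H' \<subseteq> H"
        using C(2) H(1,3) by (simp add: subset_chain_def)
      ultimately show ?thesis by blast
    qed
    have "positive_linear_relation S (\<Union>C)"
      unfolding positive_linear_relation_def
    proof (intro conjI allI impI)
      show "((\<lambda>_. 1), 1) \<in> \<Union>C" using C(1) CD positive_linear_relationD(1) by blast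
      show "((\<lambda>x. g x + h x), r + s) \<in> \<Union>C" if gr: "(g, r) \<in> \<Union>C" and hs: "(h, s) \<in> \<Union>C" for g r h s
      proof -
        obtain H where "H \<in> C" "(g, r) \<in> H" "(h, s) \<in> H"
          using two[OF gr hs] by blast
        then show ?thesis using CD[of H] positive_linear_relationD(2) by blast
      qed
      show "((\<lambda>x. c * g x), c * r) \<in> \<Union>C" if "(g, r) \<in> \<Union>C" for c g r
        using that CD positive_linear_relationD(3) by blast
      show "0 \<le> r" if gr: "(g, r) \<in> \<Union>C" and "\<forall>x\<in>S. 0 \<le> g x" for g r
        using that CD positive_linear_relationD(4) by blast
    qed
    then show "\<Union>C \<in> ?A" using C CD by blast
  qed (use assms in auto)
  then obtain M where M: "positive_linear_relation S M" "G \<subseteq> M"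
      "\<And>H. positive_linear_relation S H \<Longrightarrow> M \<subseteq> H \<Longrightarrow> H = M"
    by (auto intro: order_trans)
  have "\<exists>r. (h, r) \<in> M" if h: "\<And>x. x \<in> S \<Longrightarrow> \<bar>h x\<bar> \<le> B" for h B
  proof -
    obtain a where a: "positive_linear_relation S {((\<lambda>x. g x + t * h x), r + t * a) |g r t. (g, r) \<in> M}"
      by (rule positive_linear_relation_extend[OF M(1) h])
    let ?H = "{((\<lambda>x. g x + t * h x), r + t * a) |g r t. (g, r) \<in> M}"
    have HI: "((\<lambda>x. g x + t * h x), r + t * a) \<in> ?H" if "(g, r) \<in> M" for g r t
      using that by blast
    have "M \<subseteq> ?H"
    proof
      fix z assume "z \<in> M"
      moreover obtain g r where z: "z = (g, r)" by force
      ultimately have "(g, r) \<in> M" by simp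
      then have "((\<lambda>x. g x + 0 * h x), r + 0 * a) \<in> ?H" by blast
      then show "z \<in> ?H" using z by simp
    qed
    then have HM: "?H = M" using M(3) a by blast
    \<comment> \<open>The zero function as a multiple of 1; adding \<open>1 * h\<close> to it puts
      \<open>h\<close> itself into the extension.\<close>
    have "((\<lambda>x. 0 * 1), 0 * 1) \<in> M"
      by (rule positive_linear_relationD(3)[OF M(1) positive_linear_relationD(1)[OF M(1)]])
    from HI[OF this, of 1] have "(h, a) \<in> ?H" by simp
    then show ?thesis unfolding HM by blast
  qed
  then show ?thesis using that M by blast
qed

text \<open>The extended graph covers all bounded functions, in particular all continuous ones, so
  Riesz-Markov applies to it even when the functions in \<open>G\<close> are far from dense.\<close>

theorem positive_linear_relation_radon_measure:
  assumes X: "compact_space X" "Hausdorff_space X"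
    and G: "positive_linear_relation (topspace X) G"
    and cont: "\<And>g r. (g, r) \<in> G \<Longrightarrow> continuous_map X euclideanreal g"
  obtains N where "N \<in> radon_probability X" "\<And>g r. (g, r) \<in> G \<Longrightarrow> (\<integral>x. g x \<partial>N) = r"
proof -
  obtain H where H: "positive_linear_relation (topspace X) H" "G \<subseteq> H"
    and total: "\<And>h B. (\<And>x. x \<in> topspace X \<Longrightarrow> \<bar>h x\<bar> \<le> B) \<Longrightarrow> \<exists>r. (h, r) \<in> H"
    using positive_linear_relation_total_extension[OF G] by metis
  note D = positive_linear_relationD[OF H(1)]
  \<comment> \<open>Positivity makes the value unique wherever one exists; outside the domain of
    \<open>H\<close> the choice is arbitrary.\<close>
  define \<Lambda> where "\<Lambda> h = (SOME r. (h, r) \<in> H)" for h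
  have eq: "\<Lambda> h = r" if "(h, r) \<in> H" for h r
  proof -
    have "(h, \<Lambda> h) \<in> H" unfolding \<Lambda>_def using that by (rule someI)
    from positive_linear_relation_mono[OF H(1) this that] positive_linear_relation_mono[OF H(1) that this]
    show ?thesis by simp
  qed
  have mem: "(h, \<Lambda> h) \<in> H" if h: "continuous_map X euclideanreal h" for h
  proof -
    obtain B where "\<And>x. x \<in> topspace X \<Longrightarrow> \<bar>h x\<bar> \<le> B"
      using continuous_map_compact_bounded[OF X(1) h] by (metis real_norm_def)
    then have "\<exists>r. (h, r) \<in> H" by (rule total)
    then show ?thesis unfolding \<Lambda>_def by (rule someI_ex)
  qed
  interpret normalized_positive_functional X \<Lambda>
  proof
    show "0 \<le> \<Lambda> f" if "continuous_map X euclideanreal f" "\<And>x. x \<in> topspace X \<Longrightarrow> 0 \<le> f x" for f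
      by (rule D(4)[OF mem[OF that(1)] that(2)])
  qed (use X D(1,2,3) mem eq in auto)
  have "(\<integral>x. g x \<partial>riesz_measure) = r" if "(g, r) \<in> G" for g r
    using integral_riesz_measure[OF cont[OF that]] eq[of g r] H(2) that by auto
  then show ?thesis using that radon_riesz_measure by blast
qed

subsection \<open>Gluing of couplings\<close>

text \<open>An infimum of continuous functions over an arbitrary index set is upper semicontinuous:
  its strict sublevel sets are unions of open sets.\<close>

lemma INF_measurable_borel_measure_space:
  fixes f :: "'b \<times> 'c \<Rightarrow> real"
  assumes f: "continuous_map (prod_topology X Y) euclideanreal f"
    and ne: "topspace X \<noteq> {}" and B: "\<And>z. z \<in> topspace (prod_topology X Y) \<Longrightarrow> \<bar>f z\<bar> \<le> B"
  shows "(\<lambda>y. INF x\<in>topspace X. f (x, y)) \<in> borel_measurable (borel_measure_space Y)"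
proof -
  have bdd: "bdd_below ((\<lambda>x. f (x, y)) ` topspace X)" if "y \<in> topspace Y" for y
    using B that by (intro bdd_belowI2[of _ "-B"]) (force simp: abs_le_iff)
  have "{y \<in> topspace Y. (INF x\<in>topspace X. f (x, y)) < a} \<in> sets (borel_measure_space Y)" for a
  proof -
    have "openin Y {y \<in> topspace Y. f (x, y) < a}" if x: "x \<in> topspace X" for x
    proof -
      have "continuous_map Y (prod_topology X Y) (\<lambda>y. (x, y))"
        using x by (intro continuous_map_pairedI) auto
      from continuous_map_compose[OF this f]
      have "continuous_map Y euclideanreal (\<lambda>y. f (x, y))" by (simp add: o_def)
      from openin_continuous_map_preimage[OF this, of "{..<a}"] show ?thesis by simp
    qed
    then have "openin Y (\<Union>x\<in>topspace X. {y \<in> topspace Y. f (x, y) < a})" by blast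
    moreover have "{y \<in> topspace Y. (INF x\<in>topspace X. f (x, y)) < a} =
        (\<Union>x\<in>topspace X. {y \<in> topspace Y. f (x, y) < a})"
      using ne bdd by (auto simp: cINF_less_iff)
    ultimately show ?thesis by (simp add: openin_sets_borel_measure_space)
  qed
  then show ?thesis by (simp add: borel_measurable_iff_less)
qed

text \<open>The glued measure extends the functional \<open>f(x,y) + g(y,z) \<mapsto> \<integral>f d\<pi>\<^sub>1 + \<integral>g d\<pi>\<^sub>2\<close>. It is positive:
  if \<open>f(x,y) + g(y,z) \<ge> 0\<close> everywhere, then \<open>h(y) = inf\<^sub>x f(x,y)\<close> satisfies \<open>f(x,y) \<ge> h(y)\<close> and
  \<open>g(y,z) \<ge> -h(y)\<close>, and \<open>h\<close> has the same integral against both copies of the middle marginal.\<close>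

lemma gluing:
  assumes X: "compact_space X" "Hausdorff_space X" and Y: "compact_space Y" "Hausdorff_space Y"
    and Z: "compact_space Z" "Hausdorff_space Z"
    and \<pi>1: "\<pi>1 \<in> radon_probability (prod_topology X Y)"
    and \<pi>2: "\<pi>2 \<in> radon_probability (prod_topology Y Z)"
    and marg: "distr \<pi>1 (borel_measure_space Y) snd = distr \<pi>2 (borel_measure_space Y) fst"
  obtains \<rho> where "\<rho> \<in> radon_probability (prod_topology X (prod_topology Y Z))"
    "distr \<rho> (borel_measure_space (prod_topology X Y)) (\<lambda>w. (fst w, fst (snd w))) = \<pi>1"
    "distr \<rho> (borel_measure_space (prod_topology Y Z)) snd = \<pi>2"
proof -
  let ?XY = "prod_topology X Y" and ?YZ = "prod_topology Y Z"
  let ?T = "prod_topology X ?YZ"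
  let ?p = "\<lambda>w. (fst w, fst (snd w))"
  have XY: "compact_space ?XY" "Hausdorff_space ?XY" and YZ: "compact_space ?YZ" "Hausdorff_space ?YZ"
    and T: "compact_space ?T" "Hausdorff_space ?T"
    using X Y Z by (auto simp: compact_space_prod_topology Hausdorff_space_prod_topology)
  interpret \<pi>1: prob_space \<pi>1 using \<pi>1 radon_probabilityD by blast
  interpret \<pi>2: prob_space \<pi>2 using \<pi>2 radon_probabilityD by blast
  \<comment> \<open>A probability measure needs a nonempty space, so there are points over which to
    take the infimum.\<close>
  have ne: "topspace X \<noteq> {}"
    using \<pi>1.not_empty radon_probabilityD(1)[OF \<pi>1] by auto
  have p: "continuous_map ?T ?XY ?p"
  proof -
    have "continuous_map ?T Y (fst \<circ> snd)"
      by (rule continuous_map_compose[OF continuous_map_snd continuous_map_fst])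
    then show ?thesis
      using continuous_map_fst[of X ?YZ] by (intro continuous_map_pairedI) (auto simp: o_def)
  qed
  have q: "continuous_map ?T ?YZ snd" by (rule continuous_map_snd)
  have m1: "snd \<in> measurable \<pi>1 (borel_measure_space Y)"
    using radon_probabilityD(2)[OF \<pi>1] continuous_map_snd by (rule continuous_map_measurable)
  have m2: "fst \<in> measurable \<pi>2 (borel_measure_space Y)"
    using radon_probabilityD(2)[OF \<pi>2] continuous_map_fst by (rule continuous_map_measurable)
  define G where "G = {((\<lambda>w. f (?p w) + g (snd w)), (\<integral>u. f u \<partial>\<pi>1) + (\<integral>v. g v \<partial>\<pi>2)) |f g.
    continuous_map ?XY euclideanreal f \<and> continuous_map ?YZ euclideanreal g}"
  have GI: "((\<lambda>w. f (?p w) + g (snd w)), (\<integral>u. f u \<partial>\<pi>1) + (\<integral>v. g v \<partial>\<pi>2)) \<in> G"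
    if "continuous_map ?XY euclideanreal f" "continuous_map ?YZ euclideanreal g" for f g
    unfolding G_def using that by blast
  note int1 = integrable_continuous_map[OF XY(1) \<pi>1] and int2 = integrable_continuous_map[OF YZ(1) \<pi>2]
  have "positive_linear_relation (topspace ?T) G"
    unfolding positive_linear_relation_def
  proof (intro conjI allI impI)
    show "((\<lambda>_. 1), 1) \<in> G"
      using GI[of "\<lambda>_. 1" "\<lambda>_. 0"] \<pi>1.prob_space by simp
  next
    fix k r k' r' assume "(k, r) \<in> G" "(k', r') \<in> G"
    then obtain f g f' g' where fg: "k = (\<lambda>w. f (?p w) + g (snd w))" "r = (\<integral>u. f u \<partial>\<pi>1) + (\<integral>v. g v \<partial>\<pi>2)"
        "k' = (\<lambda>w. f' (?p w) + g' (snd w))" "r' = (\<integral>u. f' u \<partial>\<pi>1) + (\<integral>v. g' v \<partial>\<pi>2)"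
      and c: "continuous_map ?XY euclideanreal f" "continuous_map ?YZ euclideanreal g"
        "continuous_map ?XY euclideanreal f'" "continuous_map ?YZ euclideanreal g'"
      unfolding G_def by blast
    have "((\<lambda>w. (f (?p w) + f' (?p w)) + (g (snd w) + g' (snd w))),
        (\<integral>u. f u + f' u \<partial>\<pi>1) + (\<integral>v. g v + g' v \<partial>\<pi>2)) \<in> G"
      using c by (intro GI[of "\<lambda>u. f u + f' u" "\<lambda>v. g v + g' v"] continuous_intros)
    then show "((\<lambda>x. k x + k' x), r + r') \<in> G"
      using int1[OF c(1)] int1[OF c(3)] int2[OF c(2)] int2[OF c(4)] unfolding fg
      by (simp add: algebra_simps)
  next
    fix a k r assume "(k, r) \<in> G"
    then obtain f g where fg: "k = (\<lambda>w. f (?p w) + g (snd w))" "r = (\<integral>u. f u \<partial>\<pi>1) + (\<integral>v. g v \<partial>\<pi>2)"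
      and c: "continuous_map ?XY euclideanreal f" "continuous_map ?YZ euclideanreal g"
      unfolding G_def by blast
    have "((\<lambda>w. a * f (?p w) + a * g (snd w)), (\<integral>u. a * f u \<partial>\<pi>1) + (\<integral>v. a * g v \<partial>\<pi>2)) \<in> G"
      using c by (intro GI[of "\<lambda>u. a * f u" "\<lambda>v. a * g v"] continuous_intros) auto
    then show "((\<lambda>x. a * k x), a * r) \<in> G"
      unfolding fg by (simp add: algebra_simps)
  next
    fix k r assume "(k, r) \<in> G" and nn: "\<forall>w\<in>topspace ?T. 0 \<le> k w"
    then obtain f g where fg: "k = (\<lambda>w. f (?p w) + g (snd w))" "r = (\<integral>u. f u \<partial>\<pi>1) + (\<integral>v. g v \<partial>\<pi>2)"
      and c: "continuous_map ?XY euclideanreal f" "continuous_map ?YZ euclideanreal g"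
      unfolding G_def by blast
    obtain B where B: "\<And>u. u \<in> topspace ?XY \<Longrightarrow> \<bar>f u\<bar> \<le> B"
      using continuous_map_compact_bounded[OF XY(1) c(1)] by (metis real_norm_def)
    define h where "h y = (INF x\<in>topspace X. f (x, y))" for y
    have hm: "h \<in> borel_measurable (borel_measure_space Y)"
      unfolding h_def by (rule INF_measurable_borel_measure_space[OF c(1) ne B])
    have bdd: "bdd_below ((\<lambda>x. f (x, y)) ` topspace X)" if "y \<in> topspace Y" for y
      using B that by (intro bdd_belowI2[of _ "-B"]) (force simp: abs_le_iff)
    have h_le: "h y \<le> f (x, y)" if "x \<in> topspace X" "y \<in> topspace Y" for x y
      unfolding h_def using that bdd by (intro cINF_lower) auto
    have h_ge: "c \<le> h y" if "\<And>x. x \<in> topspace X \<Longrightarrow> c \<le> f (x, y)" for y c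
      unfolding h_def using ne that by (intro cINF_greatest) auto
    obtain x0 where x0: "x0 \<in> topspace X" using ne by blast
    have hB: "\<bar>h y\<bar> \<le> B" if "y \<in> topspace Y" for y
    proof -
      have "h y \<le> B" using h_le[OF x0 that] B[of "(x0, y)"] x0 that by simp
      moreover have "- B \<le> h y"
      proof (rule h_ge)
        fix x assume "x \<in> topspace X"
        then show "- B \<le> f (x, y)" using B[of "(x, y)"] that by simp
      qed
      ultimately show ?thesis by simp
    qed
    have ih1: "integrable \<pi>1 (\<lambda>u. h (snd u))"
      using measurable_compose[OF m1 hm] hB radon_probabilityD(1)[OF \<pi>1]
      by (intro \<pi>1.integrable_const_bound[where B=B] AE_I2) auto
    have ih2: "integrable \<pi>2 (\<lambda>v. h (fst v))"
      using measurable_compose[OF m2 hm] hB radon_probabilityD(1)[OF \<pi>2]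
      by (intro \<pi>2.integrable_const_bound[where B=B] AE_I2) auto
    have "(\<integral>u. h (snd u) \<partial>\<pi>1) \<le> (\<integral>u. f u \<partial>\<pi>1)"
      using ih1 int1[OF c(1)] h_le radon_probabilityD(1)[OF \<pi>1] by (intro integral_mono) auto
    moreover have "(\<integral>u. h (snd u) \<partial>\<pi>1) = (\<integral>v. h (fst v) \<partial>\<pi>2)"
      using integral_distr[OF m1 hm] integral_distr[OF m2 hm] marg by simp
    moreover have "- (\<integral>v. g v \<partial>\<pi>2) \<le> (\<integral>v. h (fst v) \<partial>\<pi>2)"
    proof -
      have "- g v \<le> h (fst v)" if "v \<in> topspace ?YZ" for v
      proof (rule h_ge)
        fix x assume "x \<in> topspace X"
        then have "(x, v) \<in> topspace ?T" using that by simp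
        then have "0 \<le> k (x, v)" using nn by blast
        then show "- g v \<le> f (x, fst v)" by (simp add: fg)
      qed
      then have "(\<integral>v. - g v \<partial>\<pi>2) \<le> (\<integral>v. h (fst v) \<partial>\<pi>2)"
        using ih2 int2[OF c(2)] radon_probabilityD(1)[OF \<pi>2] by (intro integral_mono) auto
      then show ?thesis by simp
    qed
    ultimately show "0 \<le> r" by (simp add: fg)
  qed
  moreover have "continuous_map ?T euclideanreal k" if kr: "(k, r) \<in> G" for k r
  proof -
    obtain f g where fg: "k = (\<lambda>w. f (?p w) + g (snd w))" "r = (\<integral>u. f u \<partial>\<pi>1) + (\<integral>v. g v \<partial>\<pi>2)"
      and c: "continuous_map ?XY euclideanreal f" "continuous_map ?YZ euclideanreal g"
      using kr unfolding G_def by blast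
    show ?thesis
      unfolding fg using continuous_map_compose[OF p c(1)] continuous_map_compose[OF q c(2)]
      by (intro continuous_map_add) (auto simp: o_def)
  qed
  ultimately obtain \<rho> where \<rho>: "\<rho> \<in> radon_probability ?T" "\<And>k r. (k, r) \<in> G \<Longrightarrow> (\<integral>w. k w \<partial>\<rho>) = r"
    using positive_linear_relation_radon_measure[OF T, of G] by blast
  have pm: "?p \<in> measurable \<rho> (borel_measure_space ?XY)" and qm: "snd \<in> measurable \<rho> (borel_measure_space ?YZ)"
    using radon_probabilityD(2)[OF \<rho>(1)] p q by (blast intro: continuous_map_measurable)+
  have "distr \<rho> (borel_measure_space ?XY) ?p = \<pi>1"
  proof (rule radon_probability_eqI[OF XY radon_probability_distr[OF p XY(2) \<rho>(1)] \<pi>1])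
    fix f assume f: "continuous_map ?XY euclideanreal f"
    have "(\<integral>u. f u \<partial>distr \<rho> (borel_measure_space ?XY) ?p) = (\<integral>w. f (?p w) \<partial>\<rho>)"
      using f by (intro integral_distr pm continuous_map_borel_measurable) auto
    then show "(\<integral>u. f u \<partial>distr \<rho> (borel_measure_space ?XY) ?p) = (\<integral>u. f u \<partial>\<pi>1)"
      using \<rho>(2)[OF GI[OF f, of "\<lambda>_. 0"]] by simp
  qed
  moreover have "distr \<rho> (borel_measure_space ?YZ) snd = \<pi>2"
  proof (rule radon_probability_eqI[OF YZ radon_probability_distr[OF q YZ(2) \<rho>(1)] \<pi>2])
    fix g assume g: "continuous_map ?YZ euclideanreal g"
    have "(\<integral>v. g v \<partial>distr \<rho> (borel_measure_space ?YZ) snd) = (\<integral>w. g (snd w) \<partial>\<rho>)"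
      using g by (intro integral_distr qm continuous_map_borel_measurable) auto
    then show "(\<integral>v. g v \<partial>distr \<rho> (borel_measure_space ?YZ) snd) = (\<integral>v. g v \<partial>\<pi>2)"
      using \<rho>(2)[OF GI[OF _ g, of "\<lambda>_. 0"]] by simp
  qed
  ultimately show ?thesis using that \<rho>(1) by blast
qed

section \<open>Minkowski's inequality\<close>

lemma ennreal_powr_ennreal: "0 \<le> x \<Longrightarrow> ennreal_powr (ennreal x) p = ennreal (x powr p)"
  by (simp add: ennreal_powr_def)

lemma ennreal_powr_top [simp]: "ennreal_powr top p = top"
  by (simp add: ennreal_powr_def)

lemma ennreal_powr_zero [simp]: "ennreal_powr 0 p = 0"
  by (simp add: ennreal_powr_def)

lemma ennreal_powr_mono:
  assumes "x \<le> y" "0 \<le> p"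
  shows "ennreal_powr x p \<le> ennreal_powr y p"
  using assms
  by (cases x; cases y) (auto simp: ennreal_powr_ennreal top_unique intro!: ennreal_leI powr_mono2)

lemma ennreal_powr_inverse: "0 < p \<Longrightarrow> ennreal_powr (ennreal_powr x (1 / p)) p = x"
  by (cases x) (auto simp: ennreal_powr_ennreal powr_powr)

lemma ennreal_powr_measurable [measurable]:
  assumes [measurable]: "f \<in> borel_measurable M"
  shows "(\<lambda>x. ennreal_powr (f x) p) \<in> borel_measurable M"
proof -
  have "{x \<in> space M. f x = \<infinity>} = f -` {\<infinity>} \<inter> space M" by auto
  then have "{x \<in> space M. f x = \<infinity>} \<in> sets M" by simp
  moreover have "(\<lambda>x. ennreal (enn2real (f x) powr p)) \<in> borel_measurable M" by measurable
  ultimately show ?thesis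
    unfolding ennreal_powr_def by (intro measurable_If) auto
qed

text \<open>Convexity of the power: \<open>(x + y) / (a + b)\<close> is the mean of
  \<open>x / a\<close> and \<open>y / b\<close> with weights \<open>a / (a + b)\<close> and
  \<open>b / (a + b)\<close>. In Minkowski's inequality \<open>a\<close> and \<open>b\<close> become
  the two norms.\<close>

lemma powr_add_le_weighted:
  fixes x y a b p :: real
  assumes "0 \<le> x" "0 \<le> y" "0 < a" "0 < b" "1 \<le> p"
  shows "(x + y) powr p \<le> (a + b) powr (p - 1) * (a powr (1 - p) * x powr p + b powr (1 - p) * y powr p)"
proof -
  have pos: "(u + v) powr p \<le> (a + b) powr (p - 1) * (a powr (1 - p) * u powr p + b powr (1 - p) * v powr p)"
    if "0 < u" "0 < v" for u v
  proof -
    have "((a / (a + b)) * (u / a) + (b / (a + b)) * (v / b)) powr p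
        \<le> (a / (a + b)) * (u / a) powr p + (b / (a + b)) * (v / b) powr p"
      using convex_onD[OF powr_convex[OF assms(5)], of "b / (a + b)" "u / a" "v / b"] assms that
      by (simp add: field_simps)
    also have "(a / (a + b)) * (u / a) + (b / (a + b)) * (v / b) = (u + v) / (a + b)"
      using assms by (simp add: add_divide_distrib)
    finally have *: "((u + v) / (a + b)) powr p
        \<le> (a / (a + b)) * (u / a) powr p + (b / (a + b)) * (v / b) powr p" .
    have "(u + v) powr p = (a + b) powr p * ((u + v) / (a + b)) powr p"
      using assms that by (simp add: powr_divide)
    also have "\<dots> \<le> (a + b) powr p * ((a / (a + b)) * (u / a) powr p + (b / (a + b)) * (v / b) powr p)"
      using * by (rule mult_left_mono) simp
    also have "\<dots> = (a + b) powr (p - 1) * (a powr (1 - p) * u powr p + b powr (1 - p) * v powr p)"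
    proof -
      have "(a + b) powr p * ((c / (a + b)) * (w / c) powr p) = (a + b) powr (p - 1) * (c powr (1 - p) * w powr p)"
        if "0 < c" "0 < w" for c w
        using assms that by (simp add: powr_divide powr_diff)
      from this[of a u] this[of b v] show ?thesis
        using assms that by (simp only: distrib_left)
    qed
    finally show ?thesis .
  qed
  \<comment> \<open>If one argument is zero, the claim says that the coefficient of the other is at
    least 1.\<close>
  have scale: "1 \<le> (a + b) powr (p - 1) * c powr (1 - p)" if "0 < c" "c \<le> a + b" for c
  proof -
    have "1 \<le> ((a + b) / c) powr (p - 1)"
      using that assms by (intro ge_one_powr_ge_zero) auto
    also have "\<dots> = (a + b) powr (p - 1) * c powr (1 - p)"
      using that assms by (simp add: powr_divide powr_diff)
    finally show ?thesis .
  qed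
  consider "x = 0" | "y = 0" | "0 < x" "0 < y" using assms by linarith
  then show ?thesis
  proof cases
    case 1
    then show ?thesis
      using mult_right_mono[OF scale[of b], of "y powr p"] assms by (simp add: mult.assoc)
  next
    case 2
    then show ?thesis
      using mult_right_mono[OF scale[of a], of "x powr p"] assms by (simp add: mult.assoc)
  qed (rule pos)
qed

text \<open>Integrate the weighted inequality with \<open>a\<close> and \<open>b\<close> just above
  the two norms: \<open>a powr (1 - p) * a powr p\<close> is \<open>a\<close>, likewise for
  \<open>b\<close>, and the right-hand side collapses to \<open>(a + b) powr p\<close>.\<close>

lemma nn_integral_minkowski:
  assumes f: "f \<in> borel_measurable M" and g: "g \<in> borel_measurable M" and p: "1 \<le> p"
  shows "ennreal_powr (\<integral>\<^sup>+ x. ennreal_powr (f x + g x) p \<partial>M) (1 / p)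
    \<le> ennreal_powr (\<integral>\<^sup>+ x. ennreal_powr (f x) p \<partial>M) (1 / p)
      + ennreal_powr (\<integral>\<^sup>+ x. ennreal_powr (g x) p \<partial>M) (1 / p)"
    (is "?L \<le> ?A + ?B")
proof (cases "?A = top \<or> ?B = top")
  case False
  then obtain A B where AB: "?A = ennreal A" "?B = ennreal B" "0 \<le> A" "0 \<le> B"
    by (metis ennreal_cases)
  show ?thesis
  proof (rule ennreal_le_epsilon)
    fix e :: real assume "e > 0"
    \<comment> \<open>The added \<open>e / 2\<close> keeps the weights positive when a norm is
      zero.\<close>
    define a where "a = A + e / 2"
    define b where "b = B + e / 2"
    have ab: "0 < a" "0 < b" "A \<le> a" "B \<le> b" using AB \<open>e > 0\<close> by (auto simp: a_def b_def)
    define C where "C = (a + b) powr (p - 1)"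
    have If: "(\<integral>\<^sup>+ x. ennreal_powr (f x) p \<partial>M) \<le> ennreal (a powr p)"
    proof -
      have "(\<integral>\<^sup>+ x. ennreal_powr (f x) p \<partial>M) = ennreal_powr ?A p"
        using p by (simp add: ennreal_powr_inverse)
      also have "\<dots> \<le> ennreal_powr (ennreal a) p"
        using AB(1) ab p by (intro ennreal_powr_mono) (auto intro: ennreal_leI)
      finally show ?thesis using ab by (simp add: ennreal_powr_ennreal)
    qed
    have Ig: "(\<integral>\<^sup>+ x. ennreal_powr (g x) p \<partial>M) \<le> ennreal (b powr p)"
    proof -
      have "(\<integral>\<^sup>+ x. ennreal_powr (g x) p \<partial>M) = ennreal_powr ?B p"
        using p by (simp add: ennreal_powr_inverse)
      also have "\<dots> \<le> ennreal_powr (ennreal b) p"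
        using AB(2) ab p by (intro ennreal_powr_mono) (auto intro: ennreal_leI)
      finally show ?thesis using ab by (simp add: ennreal_powr_ennreal)
    qed
    have pt: "ennreal_powr (u + v) p \<le> ennreal C * (ennreal (a powr (1 - p)) * ennreal_powr u p
        + ennreal (b powr (1 - p)) * ennreal_powr v p)" for u v :: ennreal
    proof (cases "u = top \<or> v = top")
      case True
      then show ?thesis using ab by (auto simp: C_def ennreal_mult_eq_top_iff)
    next
      case False
      then obtain x y where "u = ennreal x" "v = ennreal y" "0 \<le> x" "0 \<le> y"
        by (metis ennreal_cases)
      then show ?thesis
        using powr_add_le_weighted[of x y a b p] ab p
        by (simp add: C_def ennreal_powr_ennreal flip: ennreal_plus ennreal_mult'')
    qed
    have "(\<integral>\<^sup>+ x. ennreal_powr (f x + g x) p \<partial>M)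
        \<le> (\<integral>\<^sup>+ x. ennreal C * (ennreal (a powr (1 - p)) * ennreal_powr (f x) p
          + ennreal (b powr (1 - p)) * ennreal_powr (g x) p) \<partial>M)"
      by (intro nn_integral_mono pt)
    also have "\<dots> = ennreal C * (ennreal (a powr (1 - p)) * (\<integral>\<^sup>+ x. ennreal_powr (f x) p \<partial>M)
          + ennreal (b powr (1 - p)) * (\<integral>\<^sup>+ x. ennreal_powr (g x) p \<partial>M))"
      using f g by (simp add: nn_integral_cmult nn_integral_add)
    also have "\<dots> \<le> ennreal C * (ennreal (a powr (1 - p)) * ennreal (a powr p)
          + ennreal (b powr (1 - p)) * ennreal (b powr p))"
      by (intro mult_left_mono add_mono If Ig) auto
    also have "\<dots> = ennreal (C * (a powr (1 - p) * a powr p + b powr (1 - p) * b powr p))"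
      by (simp add: C_def flip: ennreal_plus ennreal_mult'')
    also have "C * (a powr (1 - p) * a powr p + b powr (1 - p) * b powr p) = (a + b) powr p"
      using ab by (simp add: C_def powr_diff flip: powr_add)
    finally have "?L \<le> ennreal_powr (ennreal ((a + b) powr p)) (1 / p)"
      using p by (intro ennreal_powr_mono) auto
    also have "\<dots> = ennreal (a + b)"
      using ab p by (simp add: ennreal_powr_ennreal powr_powr)
    also have "\<dots> = ?A + ?B + ennreal e"
      using AB \<open>e > 0\<close> by (simp add: a_def b_def flip: ennreal_plus)
    finally show "?L \<le> ?A + ?B + ennreal e" .
  qed
qed auto

section \<open>Commutative C*-subalgebras\<close>

lemma scaleC_zero_left [simp]: "0 *\<^sub>C (x::'a::unital_cstar_algebra) = 0"
  using scaleC_of_real[of 0 x] by simp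

lemma scaleC_minus_one: "(-1) *\<^sub>C (x::'a::unital_cstar_algebra) = - x"
  using scaleC_of_real[of "-1" x] by simp

lemma adj_scaleR: "adj (r *\<^sub>R (x::'a::unital_cstar_algebra)) = r *\<^sub>R adj x"
  using adj_scaleC[of "complex_of_real r" x] by (simp add: scaleC_of_real)

lemma adj_minus: "adj (- (x::'a::unital_cstar_algebra)) = - adj x"
  using adj_scaleR[of "-1" x] by simp

lemma adj_diff: "adj ((x::'a::unital_cstar_algebra) - y) = adj x - adj y"
  using adj_add[of x "- y"] by (simp add: adj_minus)

lemma adj_one [simp]: "adj (1::'a::unital_cstar_algebra) = 1"
  using adj_mult[of "adj 1" "1::'a"] by (simp add: adj_adj)

lemma adj_power: "adj ((x::'a::unital_cstar_algebra) ^ n) = adj x ^ n"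
  by (induction n) (simp_all add: adj_mult power_commutes)

lemma norm_adj: "norm (adj (x::'a::unital_cstar_algebra)) = norm x"
proof -
  have le: "norm y \<le> norm (adj y)" for y :: 'a
  proof (cases "y = 0")
    case False
    have "(norm y)\<^sup>2 \<le> norm (adj y) * norm y"
      using norm_mult_ineq[of "adj y" y] by (simp add: cstar_identity)
    then show ?thesis using False by (simp add: power2_eq_square)
  qed simp
  show ?thesis using le[of x] le[of "adj x"] by (simp add: adj_adj)
qed

lemma bounded_linear_adj: "bounded_linear (adj :: 'a::unital_cstar_algebra \<Rightarrow> 'a)"
  by (rule bounded_linear_intro[where K=1]) (simp_all add: adj_add adj_scaleR norm_adj)

lemma selfadjoint_iff: "a \<in> selfadjoint \<longleftrightarrow> adj a = a"
  by (simp add: selfadjoint_def)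

definition re_part :: "'a::unital_cstar_algebra \<Rightarrow> 'a" where
  "re_part a = (1/2) *\<^sub>R (a + adj a)"

definition im_part :: "'a::unital_cstar_algebra \<Rightarrow> 'a" where
  "im_part a = (- \<i> / 2) *\<^sub>C (a - adj a)"

lemma re_part_selfadjoint: "re_part a \<in> selfadjoint"
  by (simp add: selfadjoint_iff re_part_def adj_scaleR adj_add adj_adj add.commute)

lemma im_part_selfadjoint: "im_part a \<in> selfadjoint"
proof -
  have "adj (im_part a) = (\<i> / 2) *\<^sub>C (adj a - a)"
    by (simp add: im_part_def adj_scaleC adj_diff adj_adj)
  also have "adj a - a = (-1) *\<^sub>C (a - adj a)" by (simp add: scaleC_minus_one)
  finally show ?thesis by (simp add: selfadjoint_iff im_part_def scaleC_scaleC)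
qed

lemma re_part_im_part: "a = re_part a + \<i> *\<^sub>C im_part a"
proof -
  have "\<i> *\<^sub>C im_part a = complex_of_real (1/2) *\<^sub>C (a - adj a)"
    by (simp add: im_part_def scaleC_scaleC)
  then have "re_part a + \<i> *\<^sub>C im_part a = (1/2) *\<^sub>R ((a + adj a) + (a - adj a))"
    unfolding re_part_def scaleC_of_real by (simp only: scaleR_add_right)
  then show ?thesis by (simp flip: scaleR_2)
qed

section \<open>Closure properties and power series in a commutative subalgebra\<close>

locale comm_subalgebra =
  fixes M :: "'a::unital_cstar_algebra set"
  assumes subalgebra: "unital_comm_cstar_subalgebra M"
begin

lemma
  shows one_mem: "1 \<in> M"
    and add_mem: "x \<in> M \<Longrightarrow> y \<in> M \<Longrightarrow> x + y \<in> M"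
    and scaleC_mem: "x \<in> M \<Longrightarrow> c *\<^sub>C x \<in> M"
    and mult_mem: "x \<in> M \<Longrightarrow> y \<in> M \<Longrightarrow> x * y \<in> M"
    and adj_mem: "x \<in> M \<Longrightarrow> adj x \<in> M"
    and closed: "closed M"
    and commute: "x \<in> M \<Longrightarrow> y \<in> M \<Longrightarrow> x * y = y * x"
  using subalgebra unfolding unital_comm_cstar_subalgebra_def by blast+

lemma scaleR_mem: "x \<in> M \<Longrightarrow> r *\<^sub>R x \<in> M"
  using scaleC_mem[of x "complex_of_real r"] by (simp add: scaleC_of_real)

lemma minus_mem: "x \<in> M \<Longrightarrow> - x \<in> M"
  using scaleR_mem[of x "-1"] by simp

lemma diff_mem: "x \<in> M \<Longrightarrow> y \<in> M \<Longrightarrow> x - y \<in> M"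
  using add_mem[of x "- y"] minus_mem[of y] by simp

lemma zero_mem: "0 \<in> M"
  using scaleR_mem[OF one_mem, of 0] by simp

lemma power_mem: "x \<in> M \<Longrightarrow> x ^ n \<in> M"
  by (induction n) (simp_all add: one_mem mult_mem)

lemma suminf_mem:
  assumes "summable f" "\<And>n. f n \<in> M"
  shows "suminf f \<in> M"
proof -
  have "(\<Sum>i<n. f i) \<in> M" for n
    by (induction n) (simp_all add: zero_mem add_mem assms(2))
  from closed_sequentially[OF closed this summable_LIMSEQ[OF assms(1)]] show ?thesis .
qed

lemma re_part_mem: "x \<in> M \<Longrightarrow> re_part x \<in> M"
  unfolding re_part_def by (intro scaleR_mem add_mem adj_mem)

lemma im_part_mem: "x \<in> M \<Longrightarrow> im_part x \<in> M"
  unfolding im_part_def by (intro scaleC_mem diff_mem adj_mem)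

text \<open>The binomial series with exponent 1/2 converges for norm below 1, and its sum stays in
  the closed set \<open>M\<close>. In the Cauchy square, Vandermonde's identity turns the
  coefficients into \<open>1 gchoose k\<close>, which vanish from \<open>k = 2\<close> on. The point
  is that \<open>1 + a\<close> has the form \<open>adj b * b\<close>, on which states are
  nonnegative.\<close>

lemma sqrt_exists:
  assumes a: "a \<in> M" "adj a = a" "norm a < 1"
  obtains b where "b \<in> M" "adj b = b" "b * b = 1 + a"
proof -
  define c where "c n = ((1/2::real) gchoose n)" for n
  have "ereal (norm (norm a)) < conv_radius c"
    unfolding c_def using a(3) by (subst conv_radius_gchoose) (auto simp: one_ereal_def)
  then have "summable (\<lambda>n. norm (c n * norm a ^ n))"
    by (rule abs_summable_in_conv_radius)
  then have sn: "summable (\<lambda>n. norm (c n *\<^sub>R a ^ n))"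
    by (rule summable_comparison_test'[where N=0])
      (auto simp: abs_mult norm_power_ineq intro!: mult_left_mono)
  then have s: "summable (\<lambda>n. c n *\<^sub>R a ^ n)" by (rule summable_norm_cancel)
  define b where "b = (\<Sum>n. c n *\<^sub>R a ^ n)"
  have "adj b = (\<Sum>n. adj (c n *\<^sub>R a ^ n))"
    unfolding b_def by (rule bounded_linear.suminf[OF bounded_linear_adj s])
  then have "adj b = b"
    by (simp add: b_def adj_scaleR adj_power a(2))
  moreover have "b \<in> M"
    unfolding b_def using s a(1) by (intro suminf_mem scaleR_mem power_mem)
  moreover have "b * b = 1 + a"
  proof -
    have "(\<Sum>i\<le>k. (c i *\<^sub>R a ^ i) * (c (k - i) *\<^sub>R a ^ (k - i))) = (1 gchoose k) *\<^sub>R a ^ k" for k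
    proof -
      have "(\<Sum>i\<le>k. (c i *\<^sub>R a ^ i) * (c (k - i) *\<^sub>R a ^ (k - i))) = (\<Sum>i\<le>k. (c i * c (k - i)) *\<^sub>R a ^ k)"
        by (intro sum.cong) (auto simp flip: power_add)
      also have "\<dots> = (\<Sum>i\<le>k. c i * c (k - i)) *\<^sub>R a ^ k"
        by (simp add: scaleR_sum_left)
      also have "(\<Sum>i\<le>k. c i * c (k - i)) = (1/2 + 1/2) gchoose k"
        unfolding c_def gbinomial_Vandermonde[symmetric] by (simp add: atMost_atLeast0)
      finally show ?thesis by simp
    qed
    then have "b * b = (\<Sum>k. ((1::real) gchoose k) *\<^sub>R a ^ k)"
      using Cauchy_product[OF sn sn] by (simp add: b_def)
    also have "\<dots> = (\<Sum>k\<in>{0, 1}. ((1::real) gchoose k) *\<^sub>R a ^ k)"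
    proof (rule suminf_finite)
      fix k :: nat assume "k \<notin> {0, 1}"
      then have "(1::nat) choose k = 0" by (intro binomial_eq_0) auto
      moreover have "(1::real) gchoose k = real (1 choose k)" by (simp add: binomial_gbinomial)
      ultimately show "((1::real) gchoose k) *\<^sub>R a ^ k = 0" by simp
    qed simp
    finally show ?thesis by simp
  qed
  ultimately show ?thesis using that by blast
qed

lemma neumann_inverse_exists:
  assumes b: "b \<in> M" "norm b < 1"
  obtains c where "c \<in> M" "(1 - b) * c = 1"
proof -
  have s: "summable (\<lambda>n. b ^ n)" by (rule complete_algebra_summable_geometric[OF b(2)])
  have "(\<Sum>n. b ^ n) = 1 + (\<Sum>n. b ^ Suc n)"
    using suminf_split_head[OF s] by simp
  also have "(\<Sum>n. b ^ Suc n) = b * (\<Sum>n. b ^ n)"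
    using suminf_mult[OF s, of b] by simp
  finally have "(1 - b) * (\<Sum>n. b ^ n) = 1" by (simp add: algebra_simps)
  moreover have "(\<Sum>n. b ^ n) \<in> M"
    using s b(1) by (intro suminf_mem power_mem)
  ultimately show ?thesis by (intro that)
qed

end

section \<open>States and characters\<close>

lemma clinear_onD:
  assumes "clinear_on M \<phi>"
  shows "x \<in> M \<Longrightarrow> y \<in> M \<Longrightarrow> \<phi> (x + y) = \<phi> x + \<phi> y" "x \<in> M \<Longrightarrow> \<phi> (c *\<^sub>C x) = c * \<phi> x"
    "x \<in> M \<Longrightarrow> \<phi> (r *\<^sub>R x) = r *\<^sub>R \<phi> x"
  using assms unfolding clinear_on_def by (auto simp flip: scaleC_of_real simp: scaleR_conv_of_real)

lemma statesD:
  assumes "\<phi> \<in> states M"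
  shows "\<phi> \<in> extensional M" "clinear_on M \<phi>" "a \<in> M \<Longrightarrow> \<phi> (adj a * a) \<in> \<real>\<^sub>\<ge>\<^sub>0" "\<phi> 1 = 1"
  using assms by (auto simp: states_def)

lemma charactersD:
  assumes "\<omega> \<in> characters M"
  shows "\<omega> \<in> extensional M" "clinear_on M \<omega>" "x \<in> M \<Longrightarrow> y \<in> M \<Longrightarrow> \<omega> (x * y) = \<omega> x * \<omega> y" "\<omega> 1 = 1"
  using assms by (auto simp: characters_def)

section \<open>The weak-* topology: closed conditions, bounds, compactness\<close>

abbreviation weak_topology :: "'a set \<Rightarrow> ('a \<Rightarrow> complex) topology" where
  "weak_topology M \<equiv> product_topology (\<lambda>_. euclidean) M"

lemma continuous_map_eval:
  "a \<in> M \<Longrightarrow> continuous_map (weak_topology M) euclidean (\<lambda>\<phi>. \<phi> a)"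
  by (rule continuous_map_product_projection)

lemma closedin_Collect_all:
  assumes "\<And>i. closedin X {x \<in> topspace X. P i x}"
  shows "closedin X {x \<in> topspace X. \<forall>i. P i x}"
proof -
  have "{x \<in> topspace X. \<forall>i. P i x} = (\<Inter>i. {x \<in> topspace X. P i x})" by auto
  then show ?thesis using assms by (auto intro: closedin_Inter)
qed

lemma closedin_Collect_imp:
  assumes "P \<Longrightarrow> closedin X {x \<in> topspace X. Q x}"
  shows "closedin X {x \<in> topspace X. P \<longrightarrow> Q x}"
  using assms by (cases P) auto

lemma closedin_Collect_conj:
  assumes "closedin X {x \<in> topspace X. P x}" "closedin X {x \<in> topspace X. Q x}"
  shows "closedin X {x \<in> topspace X. P x \<and> Q x}"
  using closedin_Int[OF assms] by (simp add: Collect_conj_eq Int_ac)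

lemma closedin_Collect_eq:
  fixes f g :: "'b \<Rightarrow> complex"
  assumes "continuous_map X euclidean f" "continuous_map X euclidean g"
  shows "closedin X {x \<in> topspace X. f x = g x}"
  using closedin_continuous_map_preimage[OF continuous_map_diff[OF assms], of "{0}"] by simp

lemma closedin_Collect_mem:
  assumes "continuous_map X euclidean f" "closed A"
  shows "closedin X {x \<in> topspace X. f x \<in> A}"
  using closedin_continuous_map_preimage[OF assms(1), of A] assms(2) by simp

context comm_subalgebra
begin

lemma closedin_clinear_on:
  "closedin (weak_topology M) {\<phi> \<in> topspace (weak_topology M). clinear_on M \<phi>}"
proof -
  let ?W = "weak_topology M"
  have 1: "closedin ?W {\<phi> \<in> topspace ?W. \<phi> (x + y) = \<phi> x + \<phi> y}" if "x \<in> M" "y \<in> M" for x y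
    by (intro closedin_Collect_eq continuous_map_add continuous_map_eval add_mem that)
  have 2: "closedin ?W {\<phi> \<in> topspace ?W. \<phi> (c *\<^sub>C x) = c * \<phi> x}" if x: "x \<in> M" for x c
  proof (intro closedin_Collect_eq continuous_map_eval scaleC_mem x)
    have "continuous_map euclidean euclidean ((*) c)"
      by (simp add: continuous_on_mult_left)
    from continuous_map_compose[OF continuous_map_eval[OF x] this]
    show "continuous_map ?W euclidean (\<lambda>\<phi>. c * \<phi> x)" by (simp add: o_def)
  qed
  have "closedin ?W {\<phi> \<in> topspace ?W. (\<forall>x y. x \<in> M \<longrightarrow> y \<in> M \<longrightarrow> \<phi> (x + y) = \<phi> x + \<phi> y) \<and>
      (\<forall>c x. x \<in> M \<longrightarrow> \<phi> (c *\<^sub>C x) = c * \<phi> x)}"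
    by (intro closedin_Collect_conj closedin_Collect_all closedin_Collect_imp 1 2)
  moreover have "clinear_on M \<phi> \<longleftrightarrow> (\<forall>x y. x \<in> M \<longrightarrow> y \<in> M \<longrightarrow> \<phi> (x + y) = \<phi> x + \<phi> y) \<and>
      (\<forall>c x. x \<in> M \<longrightarrow> \<phi> (c *\<^sub>C x) = c * \<phi> x)" for \<phi>
    unfolding clinear_on_def by blast
  ultimately show ?thesis by simp
qed

lemma closedin_unital: "closedin (weak_topology M) {\<phi> \<in> topspace (weak_topology M). \<phi> 1 = 1}"
  by (intro closedin_Collect_eq continuous_map_eval one_mem) simp

lemma closedin_states: "closedin (weak_topology M) (states M)"
proof -
  let ?W = "weak_topology M"
  have "closedin ?W {\<phi> \<in> topspace ?W. \<phi> (adj a * a) \<in> \<real>\<^sub>\<ge>\<^sub>0}" if "a \<in> M" for a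
    by (intro closedin_Collect_mem continuous_map_eval mult_mem adj_mem that closed_nonneg_Reals_complex)
  then have "closedin ?W {\<phi> \<in> topspace ?W. \<forall>a. a \<in> M \<longrightarrow> \<phi> (adj a * a) \<in> \<real>\<^sub>\<ge>\<^sub>0}"
    by (intro closedin_Collect_all closedin_Collect_imp)
  from closedin_Collect_conj[OF closedin_clinear_on closedin_Collect_conj[OF this closedin_unital]]
  show ?thesis by (simp add: states_def Ball_def PiE_def)
qed

lemma closedin_characters: "closedin (weak_topology M) (characters M)"
proof -
  let ?W = "weak_topology M"
  have "closedin ?W {\<phi> \<in> topspace ?W. \<phi> (x * y) = \<phi> x * \<phi> y}" if xy: "x \<in> M" "y \<in> M" for x y
  proof (intro closedin_Collect_eq continuous_map_eval mult_mem xy)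
    have "continuous_map ?W (prod_topology euclidean euclidean) (\<lambda>\<phi>. (\<phi> x, \<phi> y))"
      by (intro continuous_map_pairedI continuous_map_eval xy)
    moreover have "continuous_map (prod_topology euclidean euclidean) euclidean (\<lambda>z. fst z * snd z :: complex)"
      by (auto intro!: continuous_intros)
    ultimately have "continuous_map ?W euclidean ((\<lambda>z. fst z * snd z) \<circ> (\<lambda>\<phi>. (\<phi> x, \<phi> y)))"
      by (rule continuous_map_compose)
    then show "continuous_map ?W euclidean (\<lambda>\<phi>. \<phi> x * \<phi> y)" by (simp add: o_def)
  qed
  then have "closedin ?W {\<phi> \<in> topspace ?W. \<forall>x y. x \<in> M \<longrightarrow> y \<in> M \<longrightarrow> \<phi> (x * y) = \<phi> x * \<phi> y}"
    by (intro closedin_Collect_all closedin_Collect_imp)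
  from closedin_Collect_conj[OF closedin_clinear_on closedin_Collect_conj[OF this closedin_unital]]
  show ?thesis by (simp add: characters_def Ball_def PiE_def)
qed

text \<open>For norm below 1, both \<open>1 + a\<close> and \<open>1 - a\<close> are squares of
  self-adjoint elements, so the state is nonnegative on them: its value at \<open>a\<close> is real
  and lies between -1 and 1. The rest is scaling.\<close>

lemma state_selfadjoint:
  assumes \<phi>: "\<phi> \<in> states M" and a: "a \<in> M" "adj a = a"
  shows "\<phi> a \<in> \<real>" "cmod (\<phi> a) \<le> norm a"
proof -
  note lin = clinear_onD[OF statesD(2)[OF \<phi>]]
  have unit: "\<phi> x \<in> \<real> \<and> - 1 \<le> Re (\<phi> x)" if x: "x \<in> M" "adj x = x" "norm x < 1" for x
  proof -
    obtain b where b: "b \<in> M" "adj b = b" "b * b = 1 + x" using sqrt_exists[OF x] by blast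
    then have "\<phi> (1 + x) \<in> \<real>\<^sub>\<ge>\<^sub>0" using statesD(3)[OF \<phi>, of b] by simp
    then have "1 + \<phi> x \<in> \<real>\<^sub>\<ge>\<^sub>0" using lin(1)[OF one_mem x(1)] statesD(4)[OF \<phi>] by simp
    then show ?thesis by (auto simp: complex_nonneg_Reals_iff complex_is_Real_iff)
  qed
  \<comment> \<open>Any \<open>r\<close> above \<open>norm a\<close> scales \<open>a\<close> into
    the open unit ball; the bound by all such \<open>r\<close> is then a bound by
    \<open>norm a\<close>.\<close>
  have bound: "\<phi> a \<in> \<real> \<and> \<bar>Re (\<phi> a)\<bar> \<le> r" if r: "norm a < r" for r
  proof -
    have r0: "r > 0" using r norm_ge_zero[of a] by linarith
    define x where "x = (1 / r) *\<^sub>R a"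
    have x: "x \<in> M" "adj x = x" "norm x < 1"
      using r r0 a by (auto simp: x_def scaleR_mem adj_scaleR)
    have "\<phi> (- x) = - \<phi> x" using lin(3)[OF x(1), of "-1"] by simp
    then have "\<phi> x \<in> \<real>" "\<bar>Re (\<phi> x)\<bar> \<le> 1"
      using unit[OF x] unit[of "- x"] x by (auto simp: minus_mem adj_minus abs_le_iff)
    moreover have "\<phi> a = r *\<^sub>R \<phi> x"
      using lin(3)[OF x(1), of r] r0 by (simp add: x_def)
    ultimately show ?thesis
      using r0 by (simp add: complex_is_Real_iff abs_mult)
  qed
  show R: "\<phi> a \<in> \<real>" using bound[of "norm a + 1"] by simp
  have "\<bar>Re (\<phi> a)\<bar> \<le> norm a"
    by (rule dense_ge) (rule bound[THEN conjunct2])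
  then show "cmod (\<phi> a) \<le> norm a" using R by (simp add: in_Reals_norm)
qed

text \<open>The factor 2 comes from bounding real and imaginary part separately. For compactness it
  only matters that the bound depends on \<open>a\<close> alone.\<close>

lemma state_norm_le:
  assumes \<phi>: "\<phi> \<in> states M" and a: "a \<in> M"
  shows "cmod (\<phi> a) \<le> 2 * norm a"
proof -
  note lin = clinear_onD[OF statesD(2)[OF \<phi>]]
  have re: "norm (re_part a) \<le> norm a"
    using norm_triangle_ineq[of a "adj a"] by (simp add: re_part_def norm_adj)
  have im: "norm (im_part a) \<le> norm a"
    using norm_triangle_ineq4[of a "adj a"] by (simp add: im_part_def norm_scaleC norm_adj norm_divide)
  have "\<phi> a = \<phi> (re_part a) + \<i> * \<phi> (im_part a)"
    using lin(1)[OF re_part_mem[OF a] scaleC_mem[OF im_part_mem[OF a]], of \<i>] lin(2)[OF im_part_mem[OF a]]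
      re_part_im_part[of a] by simp
  then have "cmod (\<phi> a) \<le> cmod (\<phi> (re_part a)) + cmod (\<phi> (im_part a))"
    using norm_triangle_ineq[of "\<phi> (re_part a)" "\<i> * \<phi> (im_part a)"] by (simp add: norm_mult)
  also have "\<dots> \<le> norm (re_part a) + norm (im_part a)"
    using state_selfadjoint(2)[OF \<phi>] re_part_selfadjoint[of a] im_part_selfadjoint[of a]
    by (intro add_mono) (simp_all add: re_part_mem im_part_mem a selfadjoint_iff)
  finally show ?thesis using re im by simp
qed

text \<open>The Banach-Alaoglu argument: pointwise bounds place \<open>S\<close> in a product of
  closed discs, which is compact by Tychonoff.\<close>

lemma compactin_weak_topology:
  assumes "closedin (weak_topology M) S" "\<And>\<phi> a. \<phi> \<in> S \<Longrightarrow> a \<in> M \<Longrightarrow> cmod (\<phi> a) \<le> B a"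
  shows "compactin (weak_topology M) S"
proof (rule closed_compactin[OF _ _ assms(1)])
  show "compactin (weak_topology M) (PiE M (\<lambda>a. cball 0 (B a)))"
    by (simp add: compactin_PiE)
  show "S \<subseteq> PiE M (\<lambda>a. cball 0 (B a))"
    using assms(2) closedin_subset[OF assms(1)] by (auto simp: PiE_def Pi_def subset_eq)
qed

lemma compactin_states: "compactin (weak_topology M) (states M)"
  by (rule compactin_weak_topology[OF closedin_states]) (rule state_norm_le)

text \<open>Otherwise some \<open>x\<close> of norm below 1 has value 1. Then \<open>1 - x\<close>
  is invertible by the geometric series, yet the character sends it to 0.\<close>

lemma character_norm_le:
  assumes \<omega>: "\<omega> \<in> characters M" and a: "a \<in> M"
  shows "cmod (\<omega> a) \<le> norm a"
proof (rule ccontr)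
  note lin = clinear_onD[OF charactersD(2)[OF \<omega>]]
  assume "\<not> ?thesis"
  then have n: "norm a < cmod (\<omega> a)" by simp
  then have nz: "\<omega> a \<noteq> 0" by auto
  define x where "x = (1 / \<omega> a) *\<^sub>C a"
  have x: "x \<in> M" "norm x < 1" "\<omega> x = 1"
    using n nz a by (auto simp: x_def norm_scaleC norm_divide lin(2) scaleC_mem field_simps)
  obtain c where c: "c \<in> M" "(1 - x) * c = 1" using neumann_inverse_exists[OF x(1,2)] by blast
  have "1 - x = 1 + (-1) *\<^sub>R x" by simp
  then have "\<omega> (1 - x) = 0"
    using lin(1)[OF one_mem scaleR_mem[OF x(1)], of "-1"] lin(3)[OF x(1), of "-1"] x(3) charactersD(4)[OF \<omega>] by simp
  then have "\<omega> ((1 - x) * c) = 0"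
    using charactersD(3)[OF \<omega> diff_mem[OF one_mem x(1)] c(1)] by simp
  then show False using c(2) charactersD(4)[OF \<omega>] by simp
qed

lemma compactin_characters: "compactin (weak_topology M) (characters M)"
  by (rule compactin_weak_topology[OF closedin_characters]) (rule character_norm_le)

text \<open>Arens' trick: shifting \<open>a\<close> by the imaginary scalar \<open>t\<close> changes
  the squared norm by at most \<open>t\<^sup>2\<close>, whereas the squared value of the character
  also gains a term linear in \<open>t\<close> unless the imaginary part vanishes.\<close>

lemma character_selfadjoint_real:
  assumes \<omega>: "\<omega> \<in> characters M" and a: "a \<in> M" "adj a = a"
  shows "\<omega> a \<in> \<real>"
proof -
  note lin = clinear_onD[OF charactersD(2)[OF \<omega>]]
  define \<beta> where "\<beta> = Im (\<omega> a)"
  have ineq: "\<beta>\<^sup>2 + 2 * \<beta> * t \<le> (norm a)\<^sup>2" for t :: real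
  proof -
    let ?x = "a + (\<i> * t) *\<^sub>C 1"
    have x: "?x \<in> M" using a by (intro add_mem scaleC_mem one_mem)
    have "adj ?x * ?x = a * a + (t\<^sup>2) *\<^sub>R 1"
    proof -
      have "adj ?x = a + (- (\<i> * t)) *\<^sub>C 1" by (simp add: adj_add adj_scaleC a(2))
      then have "adj ?x * ?x = a * a + ((\<i> * t) *\<^sub>C a + (- (\<i> * t)) *\<^sub>C a) + (- (\<i> * t) * (\<i> * t)) *\<^sub>C 1"
        by (simp add: distrib_left distrib_right mult_scaleC_left mult_scaleC_right scaleC_scaleC scaleC_add_right)
      also have "(\<i> * t) *\<^sub>C a + (- (\<i> * t)) *\<^sub>C a = 0"
        using scaleC_add_left[of "\<i> * t" "- (\<i> * t)" a] by simp
      also have "- (\<i> * t) * (\<i> * t) = complex_of_real (t\<^sup>2)"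
        by (simp add: power2_eq_square complex_eq_iff)
      finally show ?thesis by (simp only: scaleC_of_real) simp
    qed
    then have "(norm ?x)\<^sup>2 = norm (a * a + (t\<^sup>2) *\<^sub>R 1)"
      by (simp flip: cstar_identity)
    also have "\<dots> \<le> (norm a)\<^sup>2 + t\<^sup>2"
      using norm_triangle_ineq[of "a * a" "(t\<^sup>2) *\<^sub>R (1::'a)"] norm_mult_ineq[of a a]
      by (simp add: power2_eq_square)
    finally have nx: "(norm ?x)\<^sup>2 \<le> (norm a)\<^sup>2 + t\<^sup>2" .
    have "\<omega> ?x = \<omega> a + \<i> * t"
      using lin(1)[OF a(1) scaleC_mem[OF one_mem], of "\<i> * t"] lin(2)[OF one_mem, of "\<i> * t"] charactersD(4)[OF \<omega>] by simp
    then have "(\<beta> + t)\<^sup>2 \<le> (cmod (\<omega> ?x))\<^sup>2"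
      by (simp add: \<beta>_def cmod_power2)
    also have "\<dots> \<le> (norm ?x)\<^sup>2"
      using character_norm_le[OF \<omega> x] by (intro power_mono) auto
    finally show ?thesis using nx by (simp add: power2_sum)
  qed
  have "\<beta> = 0"
  proof (rule ccontr)
    assume "\<beta> \<noteq> 0"
    then show False
      \<comment> \<open>This \<open>t\<close> makes \<open>2 * \<beta> * t\<close> exceed the
        right-hand side by 1.\<close>
      using ineq[of "((norm a)\<^sup>2 + 1) / (2 * \<beta>)"] zero_le_power2[of \<beta>] by simp
  qed
  then show ?thesis by (simp add: \<beta>_def complex_is_Real_iff)
qed

end

subsection \<open>States are dominated by characters\<close>

context comm_subalgebra
begin

text \<open>When \<open>\<psi>\<close> is integration against a measure, this is the normalised
  measure with density \<open>1 + s\<close>.\<close>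

definition tilt :: "('a \<Rightarrow> complex) \<Rightarrow> 'a \<Rightarrow> 'a \<Rightarrow> complex" where
  "tilt \<psi> s = (\<lambda>a\<in>M. \<psi> ((1 + s) * a) / \<psi> (1 + s))"

text \<open>For a commutative algebra, \<open>\<psi>\<close> is a convex combination of \<open>tilt \<psi> s\<close> and \<open>tilt \<psi> (-s)\<close>. Hence a
  state that is fixed by all these tilts (for instance an extreme point) is multiplicative.\<close>

lemma tilt_weight:
  assumes \<psi>: "\<psi> \<in> states M" and s: "s \<in> M" "adj s = s" "norm s < 1"
  shows "\<psi> (1 + s) = of_real (1 + Re (\<psi> s))" "0 < 1 + Re (\<psi> s)"
proof -
  note lin = clinear_onD[OF statesD(2)[OF \<psi>]]
  have "\<psi> s \<in> \<real>" "cmod (\<psi> s) < 1"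
    using state_selfadjoint[OF \<psi> s(1,2)] s(3) by auto
  then show "\<psi> (1 + s) = of_real (1 + Re (\<psi> s))" "0 < 1 + Re (\<psi> s)"
    using lin(1)[OF one_mem s(1)] statesD(4)[OF \<psi>] abs_Re_le_cmod[of "\<psi> s"]
    by (auto simp: complex_is_Real_iff complex_eq_iff)
qed

text \<open>With \<open>1 + s = b * b\<close> and \<open>b\<close> self-adjoint, commutativity turns
  \<open>(1 + s) * (adj a * a)\<close> into \<open>adj (a * b) * (a * b)\<close>, where the state is
  nonnegative.\<close>

lemma tilt_state:
  assumes \<psi>: "\<psi> \<in> states M" and s: "s \<in> M" "adj s = s" "norm s < 1"
  shows "tilt \<psi> s \<in> states M"
proof -
  note lin = clinear_onD[OF statesD(2)[OF \<psi>]]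
  have s1: "1 + s \<in> M" using s one_mem by (intro add_mem)
  have nz: "\<psi> (1 + s) \<noteq> 0" using tilt_weight[OF \<psi> s] by (metis less_irrefl of_real_eq_0_iff)
  have "clinear_on M (tilt \<psi> s)"
    unfolding clinear_on_def
  proof (intro conjI ballI allI)
    show "tilt \<psi> s (x + y) = tilt \<psi> s x + tilt \<psi> s y" if "x \<in> M" "y \<in> M" for x y
      using lin(1)[OF mult_mem[OF s1 that(1)] mult_mem[OF s1 that(2)]] that
      by (simp add: tilt_def add_mem add_divide_distrib ring_distribs(1))
    show "tilt \<psi> s (c *\<^sub>C x) = c * tilt \<psi> s x" if "x \<in> M" for c x
      using lin(2)[OF mult_mem[OF s1 that]] that by (simp add: tilt_def scaleC_mem mult_scaleC_right)
  qed
  moreover have "tilt \<psi> s (adj a * a) \<in> \<real>\<^sub>\<ge>\<^sub>0" if a: "a \<in> M" for a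
  proof -
    obtain b where b: "b \<in> M" "adj b = b" "b * b = 1 + s" using sqrt_exists[OF s] by blast
    have "adj (a * b) * (a * b) = (b * (adj a * a)) * b"
      by (simp add: adj_mult b(2) mult.assoc)
    also have "\<dots> = b * (b * (adj a * a))"
      using a b by (intro commute mult_mem adj_mem)
    also have "\<dots> = (1 + s) * (adj a * a)" by (simp add: b(3) flip: mult.assoc)
    finally have "\<psi> ((1 + s) * (adj a * a)) \<in> \<real>\<^sub>\<ge>\<^sub>0"
      using statesD(3)[OF \<psi> mult_mem[OF a b(1)]] by simp
    moreover have "\<psi> (1 + s) \<in> \<real>\<^sub>\<ge>\<^sub>0"
      unfolding tilt_weight(1)[OF \<psi> s] nonneg_Reals_of_real_iff
      using tilt_weight(2)[OF \<psi> s] by (rule less_imp_le)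
    ultimately show ?thesis
      using a by (simp add: tilt_def mult_mem adj_mem)
  qed
  moreover have "tilt \<psi> s 1 = 1" using nz by (simp add: tilt_def one_mem)
  moreover have "tilt \<psi> s \<in> extensional M" by (simp add: tilt_def)
  ultimately show ?thesis by (simp add: states_def)
qed

lemma tilt_convex:
  assumes \<psi>: "\<psi> \<in> states M" and s: "s \<in> M" "adj s = s" "norm s < 1" and a: "a \<in> M"
  shows "2 * \<psi> a = (1 + Re (\<psi> s)) *\<^sub>R tilt \<psi> s a + (1 - Re (\<psi> s)) *\<^sub>R tilt \<psi> (- s) a"
proof -
  note lin = clinear_onD[OF statesD(2)[OF \<psi>]]
  have ms: "- s \<in> M" "adj (- s) = - s" "norm (- s) < 1" using s by (auto simp: minus_mem adj_minus)
  have "\<psi> (- s) = - \<psi> s" using lin(3)[OF s(1), of "-1"] by simp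
  then have w: "1 - Re (\<psi> s) = 1 + Re (\<psi> (- s))" by simp
  have t: "(1 + Re (\<psi> x)) *\<^sub>R tilt \<psi> x a = \<psi> ((1 + x) * a)"
    if "x \<in> M" "adj x = x" "norm x < 1" for x
  proof -
    have "complex_of_real (1 + Re (\<psi> x)) \<noteq> 0"
      using tilt_weight(2)[OF \<psi> that] by (metis less_irrefl of_real_eq_0_iff)
    then show ?thesis
      unfolding tilt_def scaleR_conv_of_real tilt_weight(1)[OF \<psi> that] using a by simp
  qed
  have "\<psi> ((1 + s) * a) + \<psi> ((1 + - s) * a) = \<psi> ((1 + s) * a + (1 + - s) * a)"
    using s ms a by (intro lin(1)[symmetric] mult_mem add_mem one_mem)
  also have "(1 + s) * a + (1 + - s) * a = 2 *\<^sub>R a"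
    by (simp add: distrib_right left_diff_distrib scaleR_2)
  also have "\<psi> (2 *\<^sub>R a) = 2 * \<psi> a" using lin(3)[OF a, of 2] by (simp add: scaleR_conv_of_real)
  finally show ?thesis unfolding w t[OF s] t[OF ms] by simp
qed

text \<open>Being fixed means that \<open>1 + s\<close>, and hence \<open>s\<close>, can be split
  off as a factor. Scaling removes the bound on the norm of \<open>s\<close>, and real and imaginary
  parts give all first factors.\<close>

lemma tilt_fixed_imp_character:
  assumes \<omega>: "\<omega> \<in> states M"
    and fixed: "\<And>s. s \<in> M \<Longrightarrow> adj s = s \<Longrightarrow> norm s < 1 \<Longrightarrow> tilt \<omega> s = \<omega>"
  shows "\<omega> \<in> characters M"
proof -
  note lin = clinear_onD[OF statesD(2)[OF \<omega>]]
  have small: "\<omega> (s * a) = \<omega> s * \<omega> a" if s: "s \<in> M" "adj s = s" "norm s < 1" and a: "a \<in> M" for s a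
  proof -
    have nz: "\<omega> (1 + s) \<noteq> 0" using tilt_weight[OF \<omega> s] by (metis less_irrefl of_real_eq_0_iff)
    have "\<omega> a = \<omega> ((1 + s) * a) / \<omega> (1 + s)"
      using fun_cong[OF fixed[OF s], of a] a by (simp add: tilt_def)
    then have "\<omega> a * \<omega> (1 + s) = \<omega> ((1 + s) * a)" using nz by (simp add: field_simps)
    then show ?thesis
      using lin(1)[OF one_mem s(1)] lin(1)[OF a mult_mem[OF s(1) a]] statesD(4)[OF \<omega>]
      by (simp add: distrib_left distrib_right mult.commute)
  qed
  have sa: "\<omega> (s * a) = \<omega> s * \<omega> a" if s: "s \<in> M" "adj s = s" and a: "a \<in> M" for s a
  proof -
    define r where "r = 1 + norm s"
    have r: "r > 0" "norm s < r" by (simp_all add: r_def add_pos_nonneg)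
    define x where "x = (1 / r) *\<^sub>R s"
    have x: "x \<in> M" "adj x = x" "norm x < 1"
      using r s by (auto simp: x_def scaleR_mem adj_scaleR)
    have "s = r *\<^sub>R x" using r by (simp add: x_def)
    then show ?thesis
      using small[OF x a] lin(3)[OF x(1), of r] lin(3)[OF mult_mem[OF x(1) a], of r] by simp
  qed
  have "\<omega> (x * y) = \<omega> x * \<omega> y" if x: "x \<in> M" and y: "y \<in> M" for x y
  proof -
    let ?r = "re_part x" and ?i = "im_part x"
    have r: "?r \<in> M" "adj ?r = ?r" and i: "?i \<in> M" "adj ?i = ?i"
      using x re_part_selfadjoint[of x] im_part_selfadjoint[of x]
      by (simp_all add: re_part_mem im_part_mem selfadjoint_iff)
    have "x * y = ?r * y + \<i> *\<^sub>C (?i * y)"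
      using re_part_im_part[of x] by (metis distrib_right mult_scaleC_left)
    then have "\<omega> (x * y) = \<omega> (?r * y) + \<i> * \<omega> (?i * y)"
      using lin(1)[OF mult_mem[OF r(1) y] scaleC_mem[OF mult_mem[OF i(1) y]], of \<i>] lin(2)[OF mult_mem[OF i(1) y]]
      by simp
    moreover have "\<omega> x = \<omega> ?r + \<i> * \<omega> ?i"
      using lin(1)[OF r(1) scaleC_mem[OF i(1)], of \<i>] lin(2)[OF i(1)] re_part_im_part[of x] by simp
    ultimately show ?thesis
      using sa[OF r y] sa[OF i y] by (simp add: algebra_simps)
  qed
  then show ?thesis
    using statesD[OF \<omega>] by (simp add: characters_def)
qed

text \<open>This plays the role of a nonempty closed face of the state space: a face contains both
  tilts whenever it contains their convex combination. Only these decompositions occur in the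
  argument.\<close>

definition tilt_closed :: "('a \<Rightarrow> complex) set \<Rightarrow> bool" where
  "tilt_closed F \<longleftrightarrow> closedin (weak_topology M) F \<and> F \<subseteq> states M \<and> F \<noteq> {} \<and>
     (\<forall>\<psi>\<in>F. \<forall>s\<in>M. adj s = s \<longrightarrow> norm s < 1 \<longrightarrow> tilt \<psi> s \<in> F)"

lemma tilt_closedD:
  assumes "tilt_closed F"
  shows "closedin (weak_topology M) F" "F \<subseteq> states M" "F \<noteq> {}"
    "\<psi> \<in> F \<Longrightarrow> s \<in> M \<Longrightarrow> adj s = s \<Longrightarrow> norm s < 1 \<Longrightarrow> tilt \<psi> s \<in> F"
  using assms unfolding tilt_closed_def by blast+

lemma tilt_closed_compactin:
  assumes "tilt_closed F" shows "compactin (weak_topology M) F"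
  using closed_compactin[OF compactin_states] tilt_closedD(1,2)[OF assms] by blast

text \<open>At a minimiser the two tilts have values at least \<open>m\<close> and a weighted mean
  equal to \<open>m\<close>; as both weights are positive, both values are \<open>m\<close>.
  Compactness provides the minimum.\<close>

lemma tilt_closed_minimizers:
  assumes F: "tilt_closed F" and f: "f \<in> M"
  obtains m where "tilt_closed {\<psi> \<in> F. Re (\<psi> f) = m}" "\<And>\<psi>. \<psi> \<in> F \<Longrightarrow> m \<le> Re (\<psi> f)"
proof -
  let ?W = "weak_topology M"
  have cont: "continuous_map ?W euclideanreal (\<lambda>\<psi>. Re (\<psi> f))"
  proof -
    have "continuous_map euclidean euclideanreal Re" by (auto intro!: continuous_intros)
    from continuous_map_compose[OF continuous_map_eval[OF f] this] show ?thesis by (simp add: o_def)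
  qed
  have "compact ((\<lambda>\<psi>. Re (\<psi> f)) ` F)"
    using image_compactin[OF tilt_closed_compactin[OF F] cont] by simp
  moreover have "(\<lambda>\<psi>. Re (\<psi> f)) ` F \<noteq> {}" using tilt_closedD(3)[OF F] by simp
  ultimately obtain m where m: "m \<in> (\<lambda>\<psi>. Re (\<psi> f)) ` F" "\<forall>r\<in>(\<lambda>\<psi>. Re (\<psi> f)) ` F. m \<le> r"
    using compact_attains_inf by blast
  then have m_le: "m \<le> Re (\<psi> f)" if "\<psi> \<in> F" for \<psi>
    using that by simp
  have "tilt_closed {\<psi> \<in> F. Re (\<psi> f) = m}"
    unfolding tilt_closed_def
  proof (intro conjI ballI impI)
    have "{\<psi> \<in> F. Re (\<psi> f) = m} = F \<inter> {\<psi> \<in> topspace ?W. Re (\<psi> f) \<in> {m}}"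
      using closedin_subset[OF tilt_closedD(1)[OF F]] by auto
    then show "closedin ?W {\<psi> \<in> F. Re (\<psi> f) = m}"
      using tilt_closedD(1)[OF F] closedin_continuous_map_preimage[OF cont, of "{m}"] by (simp add: closedin_Int)
    show "{\<psi> \<in> F. Re (\<psi> f) = m} \<subseteq> states M" using tilt_closedD(2)[OF F] by blast
    show "{\<psi> \<in> F. Re (\<psi> f) = m} \<noteq> {}" using m(1) by blast
    fix \<psi> s assume \<psi>: "\<psi> \<in> {\<psi> \<in> F. Re (\<psi> f) = m}" and s: "s \<in> M" "adj s = s" "norm s < 1"
    have \<psi>S: "\<psi> \<in> states M" using \<psi> tilt_closedD(2)[OF F] by blast
    have ms: "- s \<in> M" "adj (- s) = - s" "norm (- s) < 1" using s by (auto simp: minus_mem adj_minus)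
    have t: "tilt \<psi> s \<in> F" "tilt \<psi> (- s) \<in> F"
      using tilt_closedD(4)[OF F, of \<psi>] \<psi> s ms by blast+
    have w: "0 < 1 + Re (\<psi> s)" "0 < 1 - Re (\<psi> s)"
      using tilt_weight(2)[OF \<psi>S s] tilt_weight(2)[OF \<psi>S ms]
        clinear_onD(3)[OF statesD(2)[OF \<psi>S] s(1), of "-1"] by auto
    have "2 * m = (1 + Re (\<psi> s)) * Re (tilt \<psi> s f) + (1 - Re (\<psi> s)) * Re (tilt \<psi> (- s) f)"
      using arg_cong[OF tilt_convex[OF \<psi>S s f], of Re] \<psi> by simp
    moreover have "(1 - Re (\<psi> s)) * m \<le> (1 - Re (\<psi> s)) * Re (tilt \<psi> (- s) f)"
      using w m_le[OF t(2)] by (intro mult_left_mono) auto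
    ultimately have "(1 + Re (\<psi> s)) * Re (tilt \<psi> s f) \<le> (1 + Re (\<psi> s)) * m"
      by (simp add: algebra_simps)
    then have "Re (tilt \<psi> s f) \<le> m" using w by simp
    then show "tilt \<psi> s \<in> {\<psi> \<in> F. Re (\<psi> f) = m}" using t(1) m_le[OF t(1)] by simp
  qed
  then show ?thesis using that m_le by blast
qed

text \<open>Zorn's lemma gives maximal sets, so it is applied to the open sets \<open>U\<close> for
  which \<open>F - U\<close> is tilt-closed. Along a chain the only question is whether the
  intersection stays nonempty, and this is compactness of \<open>F\<close>.\<close>

lemma minimal_tilt_closed:
  assumes F: "tilt_closed F"
  obtains E where "tilt_closed E" "E \<subseteq> F" "\<And>E'. tilt_closed E' \<Longrightarrow> E' \<subseteq> E \<Longrightarrow> E' = E"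
proof -
  let ?W = "weak_topology M"
  let ?A = "{U. openin ?W U \<and> tilt_closed (F - U)}"
  have "\<exists>U\<in>?A. \<forall>V\<in>?A. U \<subseteq> V \<longrightarrow> V = U"
  proof (rule subset_Zorn_nonempty)
    show "?A \<noteq> {}" using F by (auto intro: exI[of _ "{}"])
  next
    fix C assume C: "C \<noteq> {}" "subset.chain ?A C"
    then have CA: "\<And>U. U \<in> C \<Longrightarrow> openin ?W U \<and> tilt_closed (F - U)"
      by (auto simp: subset_chain_def)
    have op: "openin ?W (\<Union>C)" using CA by blast
    have "F - \<Union>C \<noteq> {}"
    proof
      \<comment> \<open>A finite subcover taken from a chain has a largest member, which alone would
        cover \<open>F\<close>.\<close>
      assume "F - \<Union>C = {}"
      then have "F \<subseteq> \<Union>C" by blast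
      then obtain D where D: "finite D" "D \<subseteq> C" "F \<subseteq> \<Union>D"
        using compactinD[OF tilt_closed_compactin[OF F], of C] CA by blast
      have "D \<noteq> {}" using D(3) tilt_closedD(3)[OF F] by blast
      moreover have "subset.chain ?A D"
        using C(2) D(2) unfolding subset_chain_def by (meson order_trans subsetD)
      ultimately have "\<Union>D \<in> D" using D(1) by (intro Union_in_chain)
      then show False using D CA tilt_closedD(3) by blast
    qed
    moreover have "closedin ?W (F - \<Union>C)" using tilt_closedD(1)[OF F] op by (rule closedin_diff)
    moreover have "tilt \<psi> s \<in> F - \<Union>C"
      if "\<psi> \<in> F - \<Union>C" "s \<in> M" "adj s = s" "norm s < 1" for \<psi> s
    proof -
      have "tilt \<psi> s \<in> F - U" if "U \<in> C" for U
        using tilt_closedD(4)[of "F - U" \<psi> s] CA[OF that] \<open>\<psi> \<in> F - \<Union>C\<close> \<open>s \<in> M\<close> \<open>adj s = s\<close> \<open>norm s < 1\<close> that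
        by blast
      then show ?thesis using C(1) by blast
    qed
    ultimately have "tilt_closed (F - \<Union>C)"
      using tilt_closedD(2)[OF F] unfolding tilt_closed_def by blast
    then show "\<Union>C \<in> ?A" using op by simp
  qed
  then obtain U where U: "openin ?W U" "tilt_closed (F - U)"
    and max: "\<And>V. openin ?W V \<Longrightarrow> tilt_closed (F - V) \<Longrightarrow> U \<subseteq> V \<Longrightarrow> V = U"
    by blast
  have "E' = F - U" if E': "tilt_closed E'" "E' \<subseteq> F - U" for E'
  proof -
    have "F - (topspace ?W - E') = E'"
      using E'(2) closedin_subset[OF tilt_closedD(1)[OF F]] by blast
    moreover have "U \<subseteq> topspace ?W - E'"
      using E'(2) openin_subset[OF U(1)] by blast
    moreover have "openin ?W (topspace ?W - E')"
      using tilt_closedD(1)[OF E'(1)] by blast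
    ultimately have "topspace ?W - E' = U" using max E'(1) by metis
    then show ?thesis using \<open>F - (topspace ?W - E') = E'\<close> by simp
  qed
  then show ?thesis using that U(2) by blast
qed

lemma clinear_on_eqI:
  assumes "\<phi> \<in> extensional M" "\<psi> \<in> extensional M" "clinear_on M \<phi>" "clinear_on M \<psi>"
    and eq: "\<And>a. a \<in> M \<Longrightarrow> adj a = a \<Longrightarrow> \<phi> a = \<psi> a"
  shows "\<phi> = \<psi>"
proof (rule extensionalityI[OF assms(1,2)])
  fix a assume a: "a \<in> M"
  have r: "re_part a \<in> M" "adj (re_part a) = re_part a" and i: "im_part a \<in> M" "adj (im_part a) = im_part a"
    using a re_part_selfadjoint[of a] im_part_selfadjoint[of a]
    by (simp_all add: re_part_mem im_part_mem selfadjoint_iff)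
  have "\<theta> a = \<theta> (re_part a) + \<i> * \<theta> (im_part a)" if "clinear_on M \<theta>" for \<theta>
    using clinear_onD(1)[OF that r(1) scaleC_mem[OF i(1)], of \<i>] clinear_onD(2)[OF that i(1)]
      re_part_im_part[of a] by simp
  from this[OF assms(3)] this[OF assms(4)] show "\<phi> a = \<psi> a"
    using eq[OF r] eq[OF i] by simp
qed

theorem exists_character_le:
  assumes \<phi>: "\<phi> \<in> states M" and f: "f \<in> M"
  obtains \<omega> where "\<omega> \<in> characters M" "Re (\<omega> f) \<le> Re (\<phi> f)"
proof -
  have "tilt_closed (states M)"
    unfolding tilt_closed_def using closedin_states tilt_state \<phi> by blast
  then obtain m where m: "tilt_closed {\<psi> \<in> states M. Re (\<psi> f) = m}" "\<And>\<psi>. \<psi> \<in> states M \<Longrightarrow> m \<le> Re (\<psi> f)"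
    using tilt_closed_minimizers[OF _ f] by blast
  obtain E where E: "tilt_closed E" "E \<subseteq> {\<psi> \<in> states M. Re (\<psi> f) = m}"
    and min: "\<And>E'. tilt_closed E' \<Longrightarrow> E' \<subseteq> E \<Longrightarrow> E' = E"
    using minimal_tilt_closed[OF m(1)] by blast
  obtain \<omega> where \<omega>: "\<omega> \<in> E" using tilt_closedD(3)[OF E(1)] by blast
  \<comment> \<open>The minimisers of any \<open>a\<close> over \<open>E\<close> are again
    tilt-closed, so by minimality they are all of \<open>E\<close>. Hence no element separates
    points of \<open>E\<close>, and \<open>E\<close> is a singleton; as tilts stay in
    \<open>E\<close>, its point is fixed by them.\<close>
  have const: "Re (\<psi> a) = Re (\<psi>' a)" if mem: "\<psi> \<in> E" "\<psi>' \<in> E" and a: "a \<in> M" for \<psi> \<psi>' a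
  proof -
    obtain k where "tilt_closed {\<psi> \<in> E. Re (\<psi> a) = k}"
      using tilt_closed_minimizers[OF E(1) a] by blast
    then have "{\<psi> \<in> E. Re (\<psi> a) = k} = E" by (rule min) auto
    then have "E \<subseteq> {\<psi> \<in> E. Re (\<psi> a) = k}" by simp
    then show ?thesis using mem by auto
  qed
  have eq: "\<psi> = \<omega>" if "\<psi> \<in> E" for \<psi>
  proof -
    have S: "\<psi> \<in> states M" "\<omega> \<in> states M" using that \<omega> E(2) by auto
    show ?thesis
    proof (rule clinear_on_eqI[OF statesD(1)[OF S(1)] statesD(1)[OF S(2)] statesD(2)[OF S(1)] statesD(2)[OF S(2)]])
      fix a assume "a \<in> M" "adj a = a"
      then show "\<psi> a = \<omega> a"
        using state_selfadjoint(1)[OF S(1)] state_selfadjoint(1)[OF S(2)] const[OF that \<omega>]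
        by (simp add: complex_is_Real_iff complex_eq_iff)
    qed
  qed
  have "\<omega> \<in> characters M"
  proof (rule tilt_fixed_imp_character)
    show "\<omega> \<in> states M" using \<omega> E(2) by blast
    show "tilt \<omega> s = \<omega>" if "s \<in> M" "adj s = s" "norm s < 1" for s
      using tilt_closedD(4)[OF E(1) \<omega> that] eq by blast
  qed
  moreover have "Re (\<omega> f) \<le> Re (\<phi> f)" using m(2)[OF \<phi>] \<omega> E(2) by auto
  ultimately show ?thesis by (rule that)
qed

end

section \<open>Representing measures on the Gelfand spectrum\<close>

text \<open>The Stone-Weierstrass theorem of the library lives on a type of class \<open>t2_space\<close>. The function type
  itself cannot be an instance (it is already a metric space for countable domains), hence a copy of it.\<close>

typedef 'a functional = "UNIV :: ('a \<Rightarrow> complex) set"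
  morphisms apply_functional Functional ..

instantiation functional :: (type) t2_space
begin

definition open_functional :: "'a functional set \<Rightarrow> bool" where
  "open_functional U \<longleftrightarrow> open (Functional -` U)"

instance
proof
  show "open (UNIV :: 'a functional set)" by (simp add: open_functional_def)
  show "open (S \<inter> T)" if "open S" "open T" for S T :: "'a functional set"
    using that by (simp add: open_functional_def open_Int)
  show "open (\<Union>K)" if "\<forall>S\<in>K. open S" for K :: "'a functional set set"
    using that by (auto simp: open_functional_def vimage_Union)
  fix x y :: "'a functional"
  assume "x \<noteq> y"
  then obtain i where "apply_functional x i \<noteq> apply_functional y i"
    by (metis apply_functional_inject ext)
  then obtain U V where UV: "open U" "open V" "apply_functional x i \<in> U" "apply_functional y i \<in> V" "U \<inter> V = {}"
    using hausdorff by metis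
  have "open {\<phi> :: 'a \<Rightarrow> complex. \<phi> i \<in> B}" if "open B" for B
    using open_vimage[OF that continuous_on_product_coordinates] by (simp add: vimage_def)
  then show "\<exists>U V. open U \<and> open V \<and> x \<in> U \<and> y \<in> V \<and> U \<inter> V = {}"
    using UV
    by (intro exI[of _ "{z. apply_functional z i \<in> U}"] exI[of _ "{z. apply_functional z i \<in> V}"])
      (auto simp: open_functional_def vimage_def Functional_inverse)
qed

end

lemma continuous_on_apply_functional: "continuous_on UNIV (\<lambda>x. apply_functional x a)"
proof -
  have "open {\<phi> :: 'a \<Rightarrow> complex. \<phi> a \<in> B}" if "open B" for B
    using open_vimage[OF that continuous_on_product_coordinates] by (simp add: vimage_def)
  then show ?thesis
    by (auto simp: continuous_on_open_vimage open_functional_def vimage_def Functional_inverse)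
qed

context comm_subalgebra
begin

section \<open>Topology of the Gelfand spectrum\<close>

lemma topspace_gelfand_spectrum: "topspace (gelfand_spectrum M) = characters M"
  by (auto simp: gelfand_spectrum_def characters_def PiE_def)

lemma compact_gelfand_spectrum: "compact_space (gelfand_spectrum M)"
  unfolding gelfand_spectrum_def by (rule compact_space_subtopology[OF compactin_characters])

lemma Hausdorff_gelfand_spectrum: "Hausdorff_space (gelfand_spectrum M)"
  unfolding gelfand_spectrum_def
  by (intro Hausdorff_space_subtopology) (simp add: Hausdorff_space_product_topology)

lemma continuous_map_gelfand:
  "a \<in> M \<Longrightarrow> continuous_map (gelfand_spectrum M) euclidean (\<lambda>\<omega>. \<omega> a)"
  unfolding gelfand_spectrum_def by (intro continuous_map_from_subtopology continuous_map_eval)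

lemma continuous_map_gelfand_Re:
  assumes "a \<in> M"
  shows "continuous_map (gelfand_spectrum M) euclideanreal (\<lambda>\<omega>. Re (\<omega> a))"
proof -
  have "continuous_map euclidean euclideanreal Re" by (auto intro!: continuous_intros)
  from continuous_map_compose[OF continuous_map_gelfand[OF assms] this] show ?thesis by (simp add: o_def)
qed

lemma continuous_map_Functional: "continuous_map (gelfand_spectrum M) euclidean Functional"
proof -
  have 1: "continuous_map (gelfand_spectrum M) euclidean (\<lambda>\<omega>. \<omega>)"
    unfolding euclidean_product_topology[symmetric]
  proof (rule continuous_map_coordinatewise_then_product)
    fix a :: 'a
    show "continuous_map (gelfand_spectrum M) euclidean (\<lambda>\<omega>. \<omega> a)"
    proof (cases "a \<in> M")
      \<comment> \<open>Off \<open>M\<close> every character has the value \<open>undefined\<close>,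
        so these coordinates are constant.\<close>
      case False
      have "continuous_map (gelfand_spectrum M) euclidean (\<lambda>_. undefined :: complex)" by simp
      then show ?thesis
      proof (rule continuous_map_eq)
        show "undefined = \<omega> a" if "\<omega> \<in> topspace (gelfand_spectrum M)" for \<omega>
          using extensional_arb[OF charactersD(1)[of \<omega> M] False] that
          by (simp add: topspace_gelfand_spectrum)
      qed
    qed (rule continuous_map_gelfand)
  qed (auto simp: extensional_def)
  have 2: "continuous_map euclidean euclidean (Functional :: ('a \<Rightarrow> complex) \<Rightarrow> _)"
    by (simp add: continuous_on_open_vimage open_functional_def)
  from continuous_map_compose[OF 1 2] show ?thesis by (simp add: o_def)
qed

text \<open>The inverse of \<open>Functional\<close> on the characters, used to transport functions
  on the spectrum to the copied type. The restriction to \<open>M\<close> makes the map land in the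
  extensional functions everywhere, not only on characters.\<close>

lemma continuous_map_restrict_functional:
  "continuous_map (top_of_set (Functional ` characters M)) (gelfand_spectrum M)
    (\<lambda>x. restrict (apply_functional x) M)"
proof -
  have "continuous_map euclidean (weak_topology M) (\<lambda>x. restrict (apply_functional x) M)"
  proof (rule continuous_map_coordinatewise_then_product)
    show "continuous_map euclidean euclidean (\<lambda>x. restrict (apply_functional x) M a)" if "a \<in> M" for a
      using that continuous_on_apply_functional[of a] by simp
  qed auto
  moreover have "restrict \<omega> M = \<omega>" if "\<omega> \<in> characters M" for \<omega>
    using charactersD(1)[OF that] by (rule extensional_restrict)
  ultimately show ?thesis
    unfolding gelfand_spectrum_def
    by (intro continuous_map_into_subtopology continuous_map_from_subtopology)
      (auto simp: Functional_inverse)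
qed

lemma character_re_im:
  assumes "\<omega> \<in> characters M" "a \<in> M"
  shows "\<omega> a = of_real (Re (\<omega> (re_part a))) + \<i> * of_real (Re (\<omega> (im_part a)))"
proof -
  note lin = clinear_onD[OF charactersD(2)[OF assms(1)]]
  have r: "re_part a \<in> M" "adj (re_part a) = re_part a" and i: "im_part a \<in> M" "adj (im_part a) = im_part a"
    using assms re_part_selfadjoint[of a] im_part_selfadjoint[of a]
    by (simp_all add: re_part_mem im_part_mem selfadjoint_iff)
  have "\<omega> a = \<omega> (re_part a) + \<i> * \<omega> (im_part a)"
    using lin(1)[OF r(1) scaleC_mem[OF i(1)], of \<i>] lin(2)[OF i(1)] re_part_im_part[of a] by simp
  then show ?thesis
    using character_selfadjoint_real[OF assms(1) r] character_selfadjoint_real[OF assms(1) i]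
    by (simp add: of_real_Re)
qed

theorem representing_measure_exists:
  assumes \<phi>: "\<phi> \<in> states M"
  obtains m where "represents_state M m \<phi>"
proof -
  let ?X = "gelfand_spectrum M"
  note lin = clinear_onD[OF statesD(2)[OF \<phi>]]
  text \<open>The relation only demands agreement on the spectrum: elsewhere \<open>\<omega>\<close> is not linear and the
    functions \<open>\<omega> \<mapsto> Re (\<omega> f)\<close> do not form a vector space.\<close>
  define H where "H = {(g, r). continuous_map ?X euclideanreal g \<and>
    (\<exists>f\<in>M. adj f = f \<and> (\<forall>\<omega>\<in>characters M. g \<omega> = Re (\<omega> f)) \<and> r = Re (\<phi> f))}"
  have "positive_linear_relation (topspace ?X) H"
    unfolding positive_linear_relation_def
  proof (intro conjI allI impI)
    have "Re (\<omega> 1) = 1" if "\<omega> \<in> characters M" for \<omega>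
      using charactersD(4)[OF that] by simp
    then show "((\<lambda>_. 1), 1) \<in> H"
      using one_mem statesD(4)[OF \<phi>] by (auto simp: H_def intro!: bexI[of _ 1])
  next
    fix g r h s assume "(g, r) \<in> H" "(h, s) \<in> H"
    then obtain a b where ab: "a \<in> M" "adj a = a" "b \<in> M" "adj b = b"
      "\<forall>\<omega>\<in>characters M. g \<omega> = Re (\<omega> a)" "r = Re (\<phi> a)" "\<forall>\<omega>\<in>characters M. h \<omega> = Re (\<omega> b)" "s = Re (\<phi> b)"
      and c: "continuous_map ?X euclideanreal g" "continuous_map ?X euclideanreal h"
      by (auto simp: H_def)
    have "Re (\<omega> (a + b)) = Re (\<omega> a) + Re (\<omega> b)" if "\<omega> \<in> characters M" for \<omega>
      using clinear_onD(1)[OF charactersD(2)[OF that] ab(1,3)] by simp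
    then show "((\<lambda>\<omega>. g \<omega> + h \<omega>), r + s) \<in> H"
      using ab c lin(1)[OF ab(1,3)] unfolding H_def
      by (auto intro!: continuous_map_add bexI[of _ "a + b"] add_mem simp: adj_add)
  next
    fix k g r assume "(g, r) \<in> H"
    then obtain a where a: "a \<in> M" "adj a = a" "\<forall>\<omega>\<in>characters M. g \<omega> = Re (\<omega> a)" "r = Re (\<phi> a)"
      and c: "continuous_map ?X euclideanreal g"
      by (auto simp: H_def)
    have "Re (\<omega> (k *\<^sub>R a)) = k * Re (\<omega> a)" if "\<omega> \<in> characters M" for \<omega>
      using clinear_onD(3)[OF charactersD(2)[OF that] a(1)] by simp
    then show "((\<lambda>\<omega>. k * g \<omega>), k * r) \<in> H"
      using a c lin(3)[OF a(1)] unfolding H_def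
      by (auto intro!: continuous_map_real_mult bexI[of _ "k *\<^sub>R a"] scaleR_mem simp: adj_scaleR)
  next
    fix g r assume "(g, r) \<in> H" and nn: "\<forall>\<omega>\<in>topspace ?X. 0 \<le> g \<omega>"
    then obtain a where a: "a \<in> M" "\<forall>\<omega>\<in>characters M. g \<omega> = Re (\<omega> a)" "r = Re (\<phi> a)"
      by (auto simp: H_def)
    \<comment> \<open>Nonnegativity of \<open>g\<close> is known at characters only; a character
      lying below \<open>\<phi>\<close> at \<open>a\<close> transfers it to
      \<open>r\<close>.\<close>
    obtain \<omega> where "\<omega> \<in> characters M" "Re (\<omega> a) \<le> Re (\<phi> a)"
      using exists_character_le[OF \<phi> a(1)] by blast
    then show "0 \<le> r" using nn a topspace_gelfand_spectrum by force
  qed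
  moreover have "continuous_map ?X euclideanreal g" if "(g, r) \<in> H" for g r
    using that by (simp add: H_def)
  ultimately obtain m where m: "m \<in> radon_probability ?X" "\<And>g r. (g, r) \<in> H \<Longrightarrow> (\<integral>\<omega>. g \<omega> \<partial>m) = r"
    using positive_linear_relation_radon_measure[OF compact_gelfand_spectrum Hausdorff_gelfand_spectrum]
    by blast
  have sa: "(\<integral>\<omega>. Re (\<omega> f) \<partial>m) = Re (\<phi> f)" if "f \<in> M" "adj f = f" for f
    using that continuous_map_gelfand_Re[OF that(1)] by (intro m(2)) (auto simp: H_def)
  \<comment> \<open>States and characters are real on self-adjoint elements, so the real identities
    for the two parts of \<open>f\<close> recover the complex one.\<close>
  have "\<phi> f = (\<integral>\<omega>. \<omega> f \<partial>m)" if f: "f \<in> M" for f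
  proof -
    let ?r = "re_part f" and ?i = "im_part f"
    have r: "?r \<in> M" "adj ?r = ?r" and i: "?i \<in> M" "adj ?i = ?i"
      using f re_part_selfadjoint[of f] im_part_selfadjoint[of f]
      by (simp_all add: re_part_mem im_part_mem selfadjoint_iff)
    note int = integrable_continuous_map[OF compact_gelfand_spectrum m(1) continuous_map_gelfand_Re]
    have "(\<integral>\<omega>. \<omega> f \<partial>m) = (\<integral>\<omega>. of_real (Re (\<omega> ?r)) + \<i> * of_real (Re (\<omega> ?i)) \<partial>m)"
      using character_re_im[OF _ f] radon_probabilityD(1)[OF m(1)] topspace_gelfand_spectrum
      by (intro Bochner_Integration.integral_cong) auto
    also have "\<dots> = of_real (\<integral>\<omega>. Re (\<omega> ?r) \<partial>m) + \<i> * of_real (\<integral>\<omega>. Re (\<omega> ?i) \<partial>m)"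
      using int[OF r(1)] int[OF i(1)] by simp
    also have "\<dots> = \<phi> ?r + \<i> * \<phi> ?i"
      using sa[OF r] sa[OF i] state_selfadjoint(1)[OF \<phi> r] state_selfadjoint(1)[OF \<phi> i]
      by (simp add: of_real_Re)
    also have "\<dots> = \<phi> f"
      using lin(1)[OF r(1) scaleC_mem[OF i(1)], of \<i>] lin(2)[OF i(1)] re_part_im_part[of f] by simp
    finally show ?thesis by simp
  qed
  then have "represents_state M m \<phi>" using m(1) by (simp add: represents_state_def)
  then show ?thesis by (rule that)
qed

text \<open>Stone-Weierstrass for the transforms of self-adjoint elements. They are real, and they
  are closed under products because commuting self-adjoint elements have a self-adjoint product.
  They separate characters because a functional linear on \<open>M\<close> is determined there by
  its values on self-adjoint elements.\<close>

lemma gelfand_transform_dense: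
  assumes h: "continuous_map (gelfand_spectrum M) euclideanreal h" and "e > 0"
  obtains f where "f \<in> M" "adj f = f" "\<And>\<omega>. \<omega> \<in> characters M \<Longrightarrow> \<bar>h \<omega> - Re (\<omega> f)\<bar> < e"
proof -
  let ?S = "Functional ` characters M"
  let ?P = "\<lambda>g. continuous_on ?S g \<and>
    (\<exists>f\<in>M. adj f = f \<and> (\<forall>\<omega>\<in>characters M. g (Functional \<omega>) = Re (\<omega> f)))"
  have "compactin euclidean ?S"
    using image_compactin[OF _ continuous_map_Functional] compact_gelfand_spectrum topspace_gelfand_spectrum
    by (metis compact_space_def)
  then have S: "compact ?S" by simp
  have real: "\<omega> f = of_real (Re (\<omega> f))" if "\<omega> \<in> characters M" "f \<in> M" "adj f = f" for \<omega> f
    using character_selfadjoint_real[OF that] by (simp add: of_real_Re)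
  have "continuous_on ?S (\<lambda>x. h (restrict (apply_functional x) M))"
    using continuous_map_compose[OF continuous_map_restrict_functional h] by (simp add: o_def)
  moreover have "?P (\<lambda>_. c)" for c
  proof -
    have "Re (\<omega> (c *\<^sub>R 1)) = c" if "\<omega> \<in> characters M" for \<omega>
      using clinear_onD(3)[OF charactersD(2)[OF that] one_mem, of c] charactersD(4)[OF that] by simp
    then show ?thesis
      by (auto intro!: bexI[of _ "c *\<^sub>R 1"] scaleR_mem one_mem simp: adj_scaleR)
  qed
  moreover have "?P (\<lambda>x. f x + g x)" if "?P f \<and> ?P g" for f g
  proof -
    obtain a b where ab: "a \<in> M" "adj a = a" "b \<in> M" "adj b = b"
      "\<forall>\<omega>\<in>characters M. f (Functional \<omega>) = Re (\<omega> a)" "\<forall>\<omega>\<in>characters M. g (Functional \<omega>) = Re (\<omega> b)"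
      using that \<open>?P f \<and> ?P g\<close> by blast
    have "Re (\<omega> (a + b)) = Re (\<omega> a) + Re (\<omega> b)" if "\<omega> \<in> characters M" for \<omega>
      using clinear_onD(1)[OF charactersD(2)[OF that] ab(1,3)] by simp
    then show ?thesis using ab conjunct1[OF conjunct1[OF \<open>?P f \<and> ?P g\<close>]] conjunct1[OF conjunct2[OF \<open>?P f \<and> ?P g\<close>]]
      by (auto intro!: continuous_on_add bexI[of _ "a + b"] add_mem simp: adj_add)
  qed
  moreover have "?P (\<lambda>x. f x * g x)" if "?P f \<and> ?P g" for f g
  proof -
    obtain a b where ab: "a \<in> M" "adj a = a" "b \<in> M" "adj b = b"
      "\<forall>\<omega>\<in>characters M. f (Functional \<omega>) = Re (\<omega> a)" "\<forall>\<omega>\<in>characters M. g (Functional \<omega>) = Re (\<omega> b)"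
      using that \<open>?P f \<and> ?P g\<close> by blast
    have "Re (\<omega> (a * b)) = Re (\<omega> a) * Re (\<omega> b)" if "\<omega> \<in> characters M" for \<omega>
      using charactersD(3)[OF that ab(1,3)] real[OF that ab(1,2)] real[OF that ab(3,4)]
      by (metis Re_complex_of_real of_real_mult)
    then show ?thesis using ab conjunct1[OF conjunct1[OF \<open>?P f \<and> ?P g\<close>]] conjunct1[OF conjunct2[OF \<open>?P f \<and> ?P g\<close>]]
      by (auto intro!: continuous_on_mult bexI[of _ "a * b"] mult_mem simp: adj_mult commute[OF ab(1,3)])
  qed
  moreover have "\<exists>f. ?P f \<and> f x \<noteq> f y" if xy: "x \<in> ?S \<and> y \<in> ?S \<and> x \<noteq> y" for x y
  proof -
    obtain \<omega> \<omega>' where w: "\<omega> \<in> characters M" "\<omega>' \<in> characters M" "x = Functional \<omega>" "y = Functional \<omega>'" "\<omega> \<noteq> \<omega>'"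
      using xy by blast
    then obtain a where a: "a \<in> M" "adj a = a" "\<omega> a \<noteq> \<omega>' a"
      using clinear_on_eqI[of \<omega> \<omega>'] charactersD(1,2) by blast
    have "continuous_on ?S (\<lambda>x. apply_functional x a)"
      using continuous_on_apply_functional by (rule continuous_on_subset) simp
    then have "?P (\<lambda>x. Re (apply_functional x a))"
      using a by (auto intro!: continuous_on_Re bexI[of _ a] simp: Functional_inverse)
    moreover have "Re (apply_functional x a) \<noteq> Re (apply_functional y a)"
      using a(3) real[OF w(1) a(1,2)] real[OF w(2) a(1,2)] w(3,4) by (auto simp: Functional_inverse)
    ultimately show ?thesis by blast
  qed
  ultimately obtain g where g: "?P g" "\<forall>x\<in>?S. \<bar>h (restrict (apply_functional x) M) - g x\<bar> < e"
    using Stone_Weierstrass_HOL[of ?S ?P "\<lambda>x. h (restrict (apply_functional x) M)" e] S \<open>e > 0\<close> by blast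
  then obtain f where f: "f \<in> M" "adj f = f" "\<forall>\<omega>\<in>characters M. g (Functional \<omega>) = Re (\<omega> f)" by blast
  have "\<bar>h \<omega> - Re (\<omega> f)\<bar> < e" if "\<omega> \<in> characters M" for \<omega>
    using g(2) f(3) that extensional_restrict[OF charactersD(1)[OF that]] by (fastforce simp: Functional_inverse)
  then show ?thesis using that f by blast
qed

text \<open>Both integrals of \<open>h\<close> are close to the same number
  \<open>Re (\<phi> f)\<close> once the transform of \<open>f\<close> is uniformly close to
  \<open>h\<close>.\<close>

theorem representing_measure_unique:
  assumes "represents_state M m \<phi>" "represents_state M m' \<phi>"
  shows "m = m'"
proof -
  let ?X = "gelfand_spectrum M"
  have m: "m \<in> radon_probability ?X" "m' \<in> radon_probability ?X"
    using assms by (auto simp: represents_state_def)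
  show ?thesis
  proof (rule radon_probability_eqI[OF compact_gelfand_spectrum Hausdorff_gelfand_spectrum m])
    fix h assume h: "continuous_map ?X euclideanreal h"
    have close: "\<bar>(\<integral>\<omega>. h \<omega> \<partial>m) - Re (\<phi> f)\<bar> \<le> e"
      if m: "represents_state M m \<phi>" and f: "f \<in> M" "adj f = f" "\<And>\<omega>. \<omega> \<in> characters M \<Longrightarrow> \<bar>h \<omega> - Re (\<omega> f)\<bar> < e"
      for m f e
    proof -
      have mr: "m \<in> radon_probability ?X" using m by (auto simp: represents_state_def)
      interpret prob_space m using radon_probabilityD(3)[OF mr] .
      note int = integrable_continuous_map[OF compact_gelfand_spectrum mr]
      have "Re (\<phi> f) = Re (\<integral>\<omega>. \<omega> f \<partial>m)" using m f(1) by (simp add: represents_state_def)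
      also have "\<dots> = (\<integral>\<omega>. Re (\<omega> f) \<partial>m)"
        using int[OF continuous_map_gelfand[OF f(1)]] by simp
      finally have "(\<integral>\<omega>. h \<omega> \<partial>m) - Re (\<phi> f) = (\<integral>\<omega>. h \<omega> - Re (\<omega> f) \<partial>m)"
        using int[OF h] int[OF continuous_map_gelfand_Re[OF f(1)]] by simp
      also have "\<bar>\<dots>\<bar> \<le> (\<integral>\<omega>. \<bar>h \<omega> - Re (\<omega> f)\<bar> \<partial>m)"
        by (rule integral_abs_bound)
      also have "\<dots> \<le> (\<integral>\<omega>. e \<partial>m)"
      proof (rule integral_mono)
        show "integrable m (\<lambda>\<omega>. \<bar>h \<omega> - Re (\<omega> f)\<bar>)"
          using int[OF h] int[OF continuous_map_gelfand_Re[OF f(1)]] by simp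
        show "\<bar>h \<omega> - Re (\<omega> f)\<bar> \<le> e" if "\<omega> \<in> space m" for \<omega>
          using f(3)[of \<omega>] that radon_probabilityD(1)[OF mr] topspace_gelfand_spectrum by simp
      qed simp
      finally show ?thesis using prob_space by simp
    qed
    show "(\<integral>\<omega>. h \<omega> \<partial>m) = (\<integral>\<omega>. h \<omega> \<partial>m')"
    proof (rule ccontr)
      \<comment> \<open>A third of the gap, so two errors of at most \<open>e\<close> cannot bridge
        it.\<close>
      define e where "e = \<bar>(\<integral>\<omega>. h \<omega> \<partial>m) - (\<integral>\<omega>. h \<omega> \<partial>m')\<bar> / 3"
      assume "(\<integral>\<omega>. h \<omega> \<partial>m) \<noteq> (\<integral>\<omega>. h \<omega> \<partial>m')"
      then have "e > 0" by (simp add: e_def)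
      then obtain f where "f \<in> M" "adj f = f" "\<And>\<omega>. \<omega> \<in> characters M \<Longrightarrow> \<bar>h \<omega> - Re (\<omega> f)\<bar> < e"
        using gelfand_transform_dense[OF h] by blast
      from close[OF assms(1) this] close[OF assms(2) this] \<open>e > 0\<close>
      show False unfolding e_def by (simp add: abs_if split: if_splits)
    qed
  qed
qed

end

section \<open>Maximal commutative subalgebras\<close>

text \<open>Zorn's lemma is run on commuting sets closed under \<open>adj\<close> that contain
  \<open>a\<close>, a condition preserved by unions of chains. The algebraic operations and
  topological closedness then follow from maximality.\<close>

lemma selfadjoint_mem_maximal_subalgebra:
  fixes a :: "'a::unital_cstar_algebra"
  assumes "adj a = a"
  obtains M where "maximal_unital_comm_cstar_subalgebra M" "a \<in> M"
proof -
  let ?A = "{T. a \<in> T \<and> (\<forall>x\<in>T. adj x \<in> T) \<and> (\<forall>x\<in>T. \<forall>y\<in>T. x * y = y * x)}"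
  have "\<exists>M\<in>?A. \<forall>X\<in>?A. M \<subseteq> X \<longrightarrow> X = M"
  proof (rule subset_Zorn_nonempty)
    show "?A \<noteq> {}" using assms by (auto intro!: exI[of _ "{a}"])
  next
    fix C assume C: "C \<noteq> {}" "subset.chain ?A C"
    then have CA: "\<And>T. T \<in> C \<Longrightarrow> a \<in> T \<and> (\<forall>x\<in>T. adj x \<in> T) \<and> (\<forall>x\<in>T. \<forall>y\<in>T. x * y = y * x)"
      by (auto simp: subset_chain_def)
    have "x * y = y * x" if xy: "x \<in> \<Union>C" "y \<in> \<Union>C" for x y
    proof -
      obtain T T' where T: "T \<in> C" "x \<in> T" "T' \<in> C" "y \<in> T'" using xy by auto
      moreover have "T \<subseteq> T' \<or> T' \<subseteq> T" using C(2) T(1,3) by (simp add: subset_chain_def)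
      ultimately show ?thesis using CA by blast
    qed
    moreover have "a \<in> \<Union>C" "\<forall>x\<in>\<Union>C. adj x \<in> \<Union>C" using C(1) CA by blast+
    ultimately show "\<Union>C \<in> ?A" by blast
  qed
  then obtain T where TA: "T \<in> ?A" and max': "\<forall>X\<in>?A. T \<subseteq> X \<longrightarrow> X = T" ..
  have T: "a \<in> T" "\<And>x. x \<in> T \<Longrightarrow> adj x \<in> T" "\<And>x y. x \<in> T \<Longrightarrow> y \<in> T \<Longrightarrow> x * y = y * x"
    using TA by simp_all
  have max: "X = T" if "X \<in> ?A" "T \<subseteq> X" for X
    using max'[rule_format, OF that] .
  \<comment> \<open>Normality of \<open>x\<close> is exactly what keeps the set commuting after both
    \<open>x\<close> and \<open>adj x\<close> are added.\<close>
  have in_T: "x \<in> T" if x: "\<And>t. t \<in> T \<Longrightarrow> x * t = t * x" and n: "x * adj x = adj x * x" for x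
  proof -
    have "adj x * t = t * adj x" if t: "t \<in> T" for t
      using arg_cong[OF x[OF T(2)[OF t]], of adj] by (simp add: adj_mult adj_adj)
    then have "insert x (insert (adj x) T) \<in> ?A"
      using T x n by (auto simp: adj_adj)
    then show ?thesis using max[of "insert x (insert (adj x) T)"] by blast
  qed
  have sub: "unital_comm_cstar_subalgebra T"
    unfolding unital_comm_cstar_subalgebra_def
  proof (intro conjI ballI allI)
    show "1 \<in> T" by (rule in_T) simp_all
    show "x + y \<in> T" if "x \<in> T" "y \<in> T" for x y
      using T that by (intro in_T) (simp_all add: adj_add distrib_left distrib_right)
    show "c *\<^sub>C x \<in> T" if "x \<in> T" for c x
      using T(2,3) that
      by (intro in_T) (simp_all add: adj_scaleC mult_scaleC_left mult_scaleC_right scaleC_scaleC mult.commute)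
    show "x * y \<in> T" if xy: "x \<in> T" "y \<in> T" for x y
    proof -
      have c: "(u * v) * t = t * (u * v)" if "u * t = t * u" "v * t = t * v" for u v t :: 'a
      proof -
        have "(u * v) * t = u * (t * v)" by (simp only: mult.assoc that(2))
        also have "\<dots> = (t * u) * v" by (simp only: that(1) flip: mult.assoc)
        finally show ?thesis by (simp only: mult.assoc)
      qed
      have ax: "adj x \<in> T" and ay: "adj y \<in> T" using xy T(2) by auto
      show ?thesis
      proof (rule in_T)
        show "(x * y) * t = t * (x * y)" if "t \<in> T" for t
          using T(3) xy that by (intro c) auto
        have "x * (adj y * adj x) = (adj y * adj x) * x" "y * (adj y * adj x) = (adj y * adj x) * y"
          by (intro c[symmetric] T(3) ax ay xy)+
        then show "(x * y) * adj (x * y) = adj (x * y) * (x * y)"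
          unfolding adj_mult by (rule c)
      qed
    qed
    show "adj x \<in> T" if "x \<in> T" for x using T(2) that .
    show "x * y = y * x" if "x \<in> T" "y \<in> T" for x y using T(3) that .
    show "closed T"
    proof -
      have commutant: "closed {z. z * t = t * z}" for t :: 'a
        by (intro closed_Collect_eq continuous_intros)
      have "x \<in> T" if x: "x \<in> closure T" for x
      proof -
        have xt: "x * t = t * x" if "t \<in> T" for t
          using closure_minimal[of T "{z. z * t = t * z}"] commutant x T(3) that by blast
        \<comment> \<open>Commuting with \<open>T\<close> passes to the closure of \<open>T\<close>,
          which contains \<open>x\<close>; this gives the normality that \<open>in_T\<close> asks
          for.\<close>
        have "t * adj x = adj x * t" if "t \<in> T" for t
          using arg_cong[OF xt[OF T(2)[OF that]], of adj] by (simp add: adj_mult adj_adj)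
        then have "x * adj x = adj x * x"
          using closure_minimal[of T "{z. z * adj x = adj x * z}"] commutant x by blast
        then show ?thesis using xt by (intro in_T)
      qed
      then have "closure T \<subseteq> T" by blast
      then show ?thesis by (simp add: closure_subset_eq)
    qed
  qed
  have "N = T" if N: "unital_comm_cstar_subalgebra N" "T \<subseteq> N" for N
  proof -
    interpret comm_subalgebra N using N(1) by unfold_locales
    have "N \<in> ?A" using N(2) T(1) adj_mem commute by blast
    then show ?thesis using max N(2) by blast
  qed
  then show ?thesis
    using that[of T] sub T(1) by (simp add: maximal_unital_comm_cstar_subalgebra_def)
qed

section \<open>The Wasserstein distance of a commutative subalgebra\<close>

text \<open>Choose \<open>a\<close> and \<open>b\<close> within \<open>e / 2\<close> of the infima.
  An infimum over an empty set of couplings is \<open>top\<close>, which makes the bound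
  trivial.\<close>

lemma le_INF_add_INF:
  fixes x :: ennreal
  assumes le: "\<And>a b. a \<in> A \<Longrightarrow> b \<in> B \<Longrightarrow> x \<le> f a + g b"
  shows "x \<le> (INF a\<in>A. f a) + (INF b\<in>B. g b)"
proof (cases "(INF a\<in>A. f a) = top \<or> (INF b\<in>B. g b) = top")
  case False
  show ?thesis
  proof (rule ennreal_le_epsilon)
    fix e :: real assume "0 < e"
    have less: "I < I + ennreal (e / 2)" if "I \<noteq> top" for I
      using that \<open>0 < e\<close> by (cases I) (auto simp flip: ennreal_plus simp: ennreal_less_iff)
    obtain a b where "a \<in> A" "f a < (INF a\<in>A. f a) + ennreal (e / 2)"
        "b \<in> B" "g b < (INF b\<in>B. g b) + ennreal (e / 2)"
      using less[of "INF a\<in>A. f a"] less[of "INF b\<in>B. g b"] False by (auto simp: INF_less_iff)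
    then have "x \<le> ((INF a\<in>A. f a) + ennreal (e / 2)) + ((INF b\<in>B. g b) + ennreal (e / 2))"
      using le by (meson add_mono less_imp_le order_trans)
    also have "\<dots> = ((INF a\<in>A. f a) + (INF b\<in>B. g b)) + (ennreal (e / 2) + ennreal (e / 2))"
      by (simp add: ac_simps)
    also have "ennreal (e / 2) + ennreal (e / 2) = ennreal e"
      using \<open>0 < e\<close> by (simp flip: ennreal_plus)
    finally show "x \<le> (INF a\<in>A. f a) + (INF b\<in>B. g b) + ennreal e" .
  qed
qed auto

lemma state_dist_self [simp]: "state_dist L M \<phi> \<phi> = 0"
  unfolding state_dist_def by (intro antisym SUP_least) auto

lemma state_dist_commute: "state_dist L M \<phi> \<psi> = state_dist L M \<psi> \<phi>"
  unfolding state_dist_def by (simp add: norm_minus_commute)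

lemma state_dist_triangle: "state_dist L M \<phi> \<theta> \<le> state_dist L M \<phi> \<psi> + state_dist L M \<psi> \<theta>"
  unfolding state_dist_def[of L M \<phi> \<theta>]
proof (rule SUP_least)
  fix f assume f: "f \<in> {f \<in> M. f \<in> selfadjoint \<and> L f \<le> 1}"
  have "ennreal (cmod (\<phi> f - \<theta> f)) \<le> ennreal (cmod (\<phi> f - \<psi> f)) + ennreal (cmod (\<psi> f - \<theta> f))"
    using norm_triangle_ineq[of "\<phi> f - \<psi> f" "\<psi> f - \<theta> f"] by (simp flip: ennreal_plus)
  also have "\<dots> \<le> state_dist L M \<phi> \<psi> + state_dist L M \<psi> \<theta>"
    using f unfolding state_dist_def by (intro add_mono SUP_upper)
  finally show "ennreal (cmod (\<phi> f - \<theta> f)) \<le> state_dist L M \<phi> \<psi> + state_dist L M \<psi> \<theta>" .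
qed

lemma openin_ennreal_superlevel:
  assumes "continuous_map X euclideanreal f"
  shows "openin X {x \<in> topspace X. y < ennreal (f x)}"
proof -
  have "open {r. y < ennreal r}"
  proof (cases y)
    case (real t)
    then have "{r. y < ennreal r} = {t<..}" by (auto simp: ennreal_less_iff)
    then show ?thesis by simp
  qed simp
  then show ?thesis
    using openin_continuous_map_preimage[OF assms, of "{r. y < ennreal r}"] by simp
qed

context comm_subalgebra
begin

section \<open>Couplings on the square of the spectrum and their cost\<close>

abbreviation (input) spectrum :: "('a \<Rightarrow> complex) topology" where
  "spectrum \<equiv> gelfand_spectrum M"

abbreviation (input) spectrum2 :: "(('a \<Rightarrow> complex) \<times> ('a \<Rightarrow> complex)) topology" where
  "spectrum2 \<equiv> prod_topology (gelfand_spectrum M) (gelfand_spectrum M)"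

lemma Hausdorff_spectrum2: "Hausdorff_space spectrum2"
  by (simp add: Hausdorff_space_prod_topology Hausdorff_gelfand_spectrum)

lemma compact_spectrum2: "compact_space spectrum2"
  by (simp add: compact_space_prod_topology compact_gelfand_spectrum)

lemma measurable_fst_spectrum2:
  "sets N = sets (borel_measure_space spectrum2) \<Longrightarrow> fst \<in> measurable N (borel_measure_space spectrum)"
  by (rule continuous_map_measurable[OF _ continuous_map_fst])

lemma measurable_snd_spectrum2:
  "sets N = sets (borel_measure_space spectrum2) \<Longrightarrow> snd \<in> measurable N (borel_measure_space spectrum)"
  by (rule continuous_map_measurable[OF _ continuous_map_snd])

lemma continuous_map_fst_eval: "f \<in> M \<Longrightarrow> continuous_map spectrum2 euclidean (\<lambda>z. fst z f)"
  using continuous_map_compose[OF continuous_map_fst continuous_map_gelfand] by (simp add: o_def)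

lemma continuous_map_snd_eval: "f \<in> M \<Longrightarrow> continuous_map spectrum2 euclidean (\<lambda>z. snd z f)"
  using continuous_map_compose[OF continuous_map_snd continuous_map_gelfand] by (simp add: o_def)

text \<open>A supremum of continuous functions is lower semicontinuous. Its superlevel sets are
  possibly uncountable unions of open sets, hence Borel for the product topology.\<close>

lemma state_dist_measurable:
  assumes "sets N = sets (borel_measure_space spectrum2)"
  shows "(\<lambda>z. state_dist L M (fst z) (snd z)) \<in> borel_measurable N"
proof (rule borel_measurableI_greater)
  fix y :: ennreal
  let ?F = "{f \<in> M. f \<in> selfadjoint \<and> L f \<le> 1}"
  have sp: "space N = topspace spectrum2" using sets_eq_imp_space_eq[OF assms] by simp
  have "openin spectrum2 {z \<in> topspace spectrum2. y < ennreal (cmod (fst z f - snd z f))}" if "f \<in> ?F" for f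
    using that
    by (intro openin_ennreal_superlevel continuous_map_norm continuous_map_diff
        continuous_map_fst_eval continuous_map_snd_eval) auto
  then have "openin spectrum2 (\<Union>f\<in>?F. {z \<in> topspace spectrum2. y < ennreal (cmod (fst z f - snd z f))})"
    by blast
  moreover have "{z \<in> space N. y < state_dist L M (fst z) (snd z)} =
      (\<Union>f\<in>?F. {z \<in> topspace spectrum2. y < ennreal (cmod (fst z f - snd z f))})"
    unfolding sp state_dist_def less_SUP_iff by auto
  ultimately show "{z \<in> space N. y < state_dist L M (fst z) (snd z)} \<in> sets N"
    by (simp only: assms openin_sets_borel_measure_space)
qed

definition transport_cost ::
    "('a \<Rightarrow> ennreal) \<Rightarrow> real \<Rightarrow> (('a \<Rightarrow> complex) \<times> ('a \<Rightarrow> complex)) measure \<Rightarrow> ennreal" where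
  "transport_cost L p \<pi> = ennreal_powr (\<integral>\<^sup>+ z. ennreal_powr (state_dist L M (fst z) (snd z)) p \<partial>\<pi>) (1 / p)"

lemma wasserstein_eq: "wasserstein L p M \<phi> \<psi> = (INF \<pi>\<in>couplings M \<phi> \<psi>. transport_cost L p \<pi>)"
  unfolding wasserstein_def transport_cost_def ..

lemma couplingsD:
  assumes "\<pi> \<in> couplings M \<phi> \<psi>"
  shows "\<pi> \<in> radon_probability spectrum2"
    "represents_state M (distr \<pi> (borel_measure_space spectrum) fst) \<phi>"
    "represents_state M (distr \<pi> (borel_measure_space spectrum) snd) \<psi>"
    "sets \<pi> = sets (borel_measure_space spectrum2)"
  using assms radon_probabilityD(2) unfolding couplings_def by auto

lemma transport_cost_distr:
  assumes N: "sets N = sets (borel_measure_space Y)" and f: "continuous_map Y spectrum2 f"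
  shows "transport_cost L p (distr N (borel_measure_space spectrum2) f) =
    ennreal_powr (\<integral>\<^sup>+ w. ennreal_powr (state_dist L M (fst (f w)) (snd (f w))) p \<partial>N) (1 / p)"
  unfolding transport_cost_def
  using continuous_map_measurable[OF N f]
  by (subst nn_integral_distr) (auto intro!: ennreal_powr_measurable state_dist_measurable)

text \<open>The diagonal, the swapped and the glued coupling are all images of a known measure under
  a continuous map into the square, so each reduces to its two coordinate images.\<close>

lemma coupling_distrI:
  assumes N: "N \<in> radon_probability Y" and f: "continuous_map Y spectrum2 f"
    and 1: "represents_state M (distr N (borel_measure_space spectrum) (\<lambda>w. fst (f w))) \<phi>"
    and 2: "represents_state M (distr N (borel_measure_space spectrum) (\<lambda>w. snd (f w))) \<psi>"
  shows "distr N (borel_measure_space spectrum2) f \<in> couplings M \<phi> \<psi>"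
proof -
  note fm = continuous_map_measurable[OF radon_probabilityD(2)[OF N] f]
  have "distr (distr N (borel_measure_space spectrum2) f) (borel_measure_space spectrum) fst =
      distr N (borel_measure_space spectrum) (\<lambda>w. fst (f w))"
    using distr_distr[OF measurable_fst_spectrum2[OF refl] fm] by (simp add: o_def)
  moreover have "distr (distr N (borel_measure_space spectrum2) f) (borel_measure_space spectrum) snd =
      distr N (borel_measure_space spectrum) (\<lambda>w. snd (f w))"
    using distr_distr[OF measurable_snd_spectrum2[OF refl] fm] by (simp add: o_def)
  ultimately show ?thesis
    using 1 2 radon_probability_distr[OF f Hausdorff_spectrum2 N] by (simp add: couplings_def)
qed

text \<open>The diagonal image of a representing measure is a coupling of cost zero; existence of
  that measure keeps the infimum from being \<open>top\<close>.\<close>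

lemma wasserstein_self:
  assumes \<phi>: "\<phi> \<in> states M"
  shows "wasserstein L p M \<phi> \<phi> = 0"
proof -
  obtain m where m: "represents_state M m \<phi>" using representing_measure_exists[OF \<phi>] .
  then have mr: "m \<in> radon_probability spectrum" by (simp add: represents_state_def)
  have diag: "continuous_map spectrum spectrum2 (\<lambda>\<omega>. (\<omega>, \<omega>))"
    by (intro continuous_map_pairedI) auto
  have "distr m (borel_measure_space spectrum) (\<lambda>\<omega>. \<omega>) = m"
    using radon_probabilityD(2)[OF mr] by (intro distr_id2) simp
  then have c: "distr m (borel_measure_space spectrum2) (\<lambda>\<omega>. (\<omega>, \<omega>)) \<in> couplings M \<phi> \<phi>"
    using m by (intro coupling_distrI[OF mr diag]) simp_all
  have "wasserstein L p M \<phi> \<phi> \<le> transport_cost L p (distr m (borel_measure_space spectrum2) (\<lambda>\<omega>. (\<omega>, \<omega>)))"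
    unfolding wasserstein_eq by (rule INF_lower[OF c])
  also have "\<dots> = 0"
    unfolding transport_cost_distr[OF radon_probabilityD(2)[OF mr] diag] by simp
  finally show ?thesis by simp
qed

lemma wasserstein_commute: "wasserstein L p M \<phi> \<psi> = wasserstein L p M \<psi> \<phi>"
proof -
  have "wasserstein L p M \<phi> \<psi> \<le> wasserstein L p M \<psi> \<phi>" for \<phi> \<psi>
    unfolding wasserstein_eq
  proof (rule INF_mono)
    fix \<pi> assume \<pi>: "\<pi> \<in> couplings M \<psi> \<phi>"
    have swap: "continuous_map spectrum2 spectrum2 (\<lambda>z. (snd z, fst z))"
      by (intro continuous_map_pairedI continuous_map_fst continuous_map_snd)
    have c: "distr \<pi> (borel_measure_space spectrum2) (\<lambda>z. (snd z, fst z)) \<in> couplings M \<phi> \<psi>"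
      using couplingsD[OF \<pi>] by (intro coupling_distrI[OF _ swap]) simp_all
    have "transport_cost L p (distr \<pi> (borel_measure_space spectrum2) (\<lambda>z. (snd z, fst z))) =
        transport_cost L p \<pi>"
      unfolding transport_cost_distr[OF couplingsD(4)[OF \<pi>] swap]
      by (simp add: transport_cost_def state_dist_commute)
    then show "\<exists>\<pi>'\<in>couplings M \<phi> \<psi>. transport_cost L p \<pi>' \<le> transport_cost L p \<pi>"
      by (intro bexI[OF _ c]) simp
  qed
  then show ?thesis by (intro antisym)
qed

text \<open>The measure \<open>\<rho>\<close> on the triple product carries both couplings at once,
  and its first and third coordinates form a coupling of the outer states. All three costs become
  integrals over \<open>\<rho>\<close>.\<close>

lemma wasserstein_triangle:
  assumes p: "1 \<le> p"
  shows "wasserstein L p M \<phi> \<theta> \<le> wasserstein L p M \<phi> \<psi> + wasserstein L p M \<psi> \<theta>"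
  unfolding wasserstein_eq[of L p \<phi> \<psi>] wasserstein_eq[of L p \<psi> \<theta>]
proof (rule le_INF_add_INF)
  fix \<pi>1 \<pi>2 assume \<pi>1: "\<pi>1 \<in> couplings M \<phi> \<psi>" and \<pi>2: "\<pi>2 \<in> couplings M \<psi> \<theta>"
  let ?B = "borel_measure_space spectrum" and ?B2 = "borel_measure_space spectrum2"
  let ?T = "prod_topology spectrum spectrum2"
  have "distr \<pi>1 ?B snd = distr \<pi>2 ?B fst"
    by (rule representing_measure_unique[OF couplingsD(3)[OF \<pi>1] couplingsD(2)[OF \<pi>2]])
  from gluing[OF compact_gelfand_spectrum Hausdorff_gelfand_spectrum compact_gelfand_spectrum
      Hausdorff_gelfand_spectrum compact_gelfand_spectrum Hausdorff_gelfand_spectrum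
      couplingsD(1)[OF \<pi>1] couplingsD(1)[OF \<pi>2] this]
  obtain \<rho> where \<rho>: "\<rho> \<in> radon_probability ?T" "distr \<rho> ?B2 (\<lambda>w. (fst w, fst (snd w))) = \<pi>1"
      "distr \<rho> ?B2 snd = \<pi>2" .
  note R = radon_probabilityD(2)[OF \<rho>(1)]
  have f2: "continuous_map ?T spectrum (\<lambda>w. fst (snd w))" and f3: "continuous_map ?T spectrum (\<lambda>w. snd (snd w))"
    using continuous_map_compose[OF continuous_map_snd continuous_map_fst]
      continuous_map_compose[OF continuous_map_snd continuous_map_snd] by (auto simp: o_def)
  have p12: "continuous_map ?T spectrum2 (\<lambda>w. (fst w, fst (snd w)))"
    and p13: "continuous_map ?T spectrum2 (\<lambda>w. (fst w, snd (snd w)))"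
    and p23: "continuous_map ?T spectrum2 snd"
    by (intro continuous_map_pairedI continuous_map_fst f2 f3 continuous_map_snd)+
  have "distr \<rho> ?B fst = distr \<pi>1 ?B fst"
    unfolding \<rho>(2)[symmetric]
    using distr_distr[OF measurable_fst_spectrum2[OF refl] continuous_map_measurable[OF R p12]] by (simp add: o_def)
  moreover have "distr \<rho> ?B (\<lambda>w. snd (snd w)) = distr \<pi>2 ?B snd"
    unfolding \<rho>(3)[symmetric]
    using distr_distr[OF measurable_snd_spectrum2[OF refl] continuous_map_measurable[OF R p23]] by (simp add: o_def)
  ultimately have c13: "distr \<rho> ?B2 (\<lambda>w. (fst w, snd (snd w))) \<in> couplings M \<phi> \<theta>"
    using couplingsD(2)[OF \<pi>1] couplingsD(3)[OF \<pi>2] by (intro coupling_distrI[OF \<rho>(1) p13]) simp_all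
  let ?d = "\<lambda>x y. state_dist L M x y"
  have m12: "(\<lambda>w. ?d (fst w) (fst (snd w))) \<in> borel_measurable \<rho>"
    using measurable_compose[OF continuous_map_measurable[OF R p12] state_dist_measurable[OF refl]] by simp
  have m23: "(\<lambda>w. ?d (fst (snd w)) (snd (snd w))) \<in> borel_measurable \<rho>"
    using measurable_compose[OF continuous_map_measurable[OF R p23] state_dist_measurable[OF refl]] by simp
  have "wasserstein L p M \<phi> \<theta> \<le> transport_cost L p (distr \<rho> ?B2 (\<lambda>w. (fst w, snd (snd w))))"
    unfolding wasserstein_eq by (rule INF_lower[OF c13])
  also have "\<dots> = ennreal_powr (\<integral>\<^sup>+ w. ennreal_powr (?d (fst w) (snd (snd w))) p \<partial>\<rho>) (1 / p)"
    unfolding transport_cost_distr[OF R p13] by simp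
  also have "\<dots> \<le> ennreal_powr (\<integral>\<^sup>+ w. ennreal_powr (?d (fst w) (fst (snd w)) + ?d (fst (snd w)) (snd (snd w))) p \<partial>\<rho>) (1 / p)"
    using p by (intro ennreal_powr_mono nn_integral_mono state_dist_triangle) auto
  also have "\<dots> \<le> ennreal_powr (\<integral>\<^sup>+ w. ennreal_powr (?d (fst w) (fst (snd w))) p \<partial>\<rho>) (1 / p) +
      ennreal_powr (\<integral>\<^sup>+ w. ennreal_powr (?d (fst (snd w)) (snd (snd w))) p \<partial>\<rho>) (1 / p)"
    by (rule nn_integral_minkowski[OF m12 m23 p])
  also have "\<dots> = transport_cost L p \<pi>1 + transport_cost L p \<pi>2"
    using transport_cost_distr[OF R p12, of L p] transport_cost_distr[OF R p23, of L p] \<rho>(2,3) by simp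
  finally show "wasserstein L p M \<phi> \<theta> \<le> transport_cost L p \<pi>1 + transport_cost L p \<pi>2" .
qed

text \<open>The easy half of Kantorovich duality: by definition of \<open>state_dist\<close>, such a
  \<open>g\<close> is 1-Lipschitz on the spectrum, and this is integrated against the
  coupling.\<close>

lemma coupling_cmod_diff_le:
  assumes \<pi>: "\<pi> \<in> couplings M \<phi> \<psi>" and g: "g \<in> M" "g \<in> selfadjoint" "L g \<le> 1"
  shows "ennreal (cmod (\<phi> g - \<psi> g)) \<le> (\<integral>\<^sup>+ z. state_dist L M (fst z) (snd z) \<partial>\<pi>)"
proof -
  note C = couplingsD[OF \<pi>]
  note int = integrable_continuous_map[OF compact_spectrum2 C(1)]
  have ev: "(\<lambda>\<omega>. \<omega> g) \<in> borel_measurable (borel_measure_space spectrum)"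
    by (rule continuous_map_borel_measurable[OF refl continuous_map_gelfand[OF g(1)]])
  have "\<phi> g = (\<integral>z. fst z g \<partial>\<pi>)" "\<psi> g = (\<integral>z. snd z g \<partial>\<pi>)"
    using C(2,3) g(1) integral_distr[OF measurable_fst_spectrum2[OF C(4)] ev]
      integral_distr[OF measurable_snd_spectrum2[OF C(4)] ev]
    by (simp_all add: represents_state_def)
  then have "\<phi> g - \<psi> g = (\<integral>z. fst z g - snd z g \<partial>\<pi>)"
    using int[OF continuous_map_fst_eval[OF g(1)]] int[OF continuous_map_snd_eval[OF g(1)]] by simp
  then have "ennreal (cmod (\<phi> g - \<psi> g)) \<le> (\<integral>\<^sup>+ z. ennreal (cmod (fst z g - snd z g)) \<partial>\<pi>)"
    using integral_norm_bound_ennreal[of \<pi> "\<lambda>z. fst z g - snd z g"]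
      int[OF continuous_map_fst_eval[OF g(1)]] int[OF continuous_map_snd_eval[OF g(1)]] by simp
  also have "\<dots> \<le> (\<integral>\<^sup>+ z. state_dist L M (fst z) (snd z) \<partial>\<pi>)"
    unfolding state_dist_def using g by (intro nn_integral_mono SUP_upper) simp
  finally show ?thesis .
qed

text \<open>Rescale \<open>f\<close> to a \<open>g\<close> of seminorm at most 1. Couplings of
  arbitrarily small p-th cost have arbitrarily small mean distance, which bounds the difference at
  \<open>g\<close>.\<close>

lemma wasserstein_eq_zero_imp_eq:
  assumes p: "1 \<le> p" and L: "partially_defined_L_seminorm L"
    and W: "wasserstein L p M \<phi> \<psi> = 0" and \<phi>: "clinear_on M \<phi>" "clinear_on M \<psi>"
    and f: "f \<in> L_domain L" "f \<in> M"
  shows "\<phi> f = \<psi> f"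
proof -
  \<comment> \<open>The added 1 keeps \<open>c\<close> positive when \<open>L f\<close> is
    zero.\<close>
  define c where "c = enn2real (L f) + 1"
  have c: "c > 0" "L f \<le> ennreal c"
  proof -
    show "c > 0" using enn2real_nonneg[of "L f"] by (simp add: c_def add_nonneg_pos)
    have "L f = ennreal (enn2real (L f))" using f(1) by (simp add: L_domain_def)
    also have "\<dots> \<le> ennreal c" by (intro ennreal_leI) (simp add: c_def)
    finally show "L f \<le> ennreal c" .
  qed
  define g where "g = (1 / c) *\<^sub>R f"
  have fs: "f \<in> selfadjoint" using f(1) by (simp add: L_domain_def)
  have g: "g \<in> M" "g \<in> selfadjoint"
    using f(2) fs by (simp_all add: g_def scaleR_mem selfadjoint_iff adj_scaleR)
  have Lg: "L g \<le> 1"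
  proof -
    have "L g = ennreal (1 / c) * L f"
      using L fs c(1) unfolding g_def partially_defined_L_seminorm_def by simp
    also have "\<dots> \<le> ennreal (1 / c) * ennreal c" using c(2) by (rule mult_left_mono) simp
    also have "\<dots> = 1" using c(1) by (simp flip: ennreal_mult)
    finally show ?thesis .
  qed
  have "cmod (\<phi> g - \<psi> g) \<le> e" if "e > 0" for e
  proof -
    \<comment> \<open>The mean distance will be bounded by two terms, each equal to
      \<open>\<delta>\<close>.\<close>
    define \<delta> where "\<delta> = e / 2"
    have \<delta>: "\<delta> > 0" using that by (simp add: \<delta>_def)
    have "(INF \<pi>\<in>couplings M \<phi> \<psi>. transport_cost L p \<pi>) < ennreal \<delta>"
      using W \<delta> unfolding wasserstein_eq by simp
    then obtain \<pi> where \<pi>: "\<pi> \<in> couplings M \<phi> \<psi>" "transport_cost L p \<pi> < ennreal \<delta>"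
      unfolding INF_less_iff by blast
    interpret prob_space \<pi> using radon_probabilityD(3)[OF couplingsD(1)[OF \<pi>(1)]] .
    let ?d = "\<lambda>z. state_dist L M (fst z) (snd z)"
    have meas: "?d \<in> borel_measurable \<pi>" by (rule state_dist_measurable[OF couplingsD(4)[OF \<pi>(1)]])
    have "(\<integral>\<^sup>+ z. ennreal_powr (?d z) p \<partial>\<pi>) = ennreal_powr (transport_cost L p \<pi>) p"
      using p unfolding transport_cost_def by (simp add: ennreal_powr_inverse)
    also have "\<dots> \<le> ennreal_powr (ennreal \<delta>) p"
      using \<pi>(2) p by (intro ennreal_powr_mono) auto
    finally have I: "(\<integral>\<^sup>+ z. ennreal_powr (?d z) p \<partial>\<pi>) \<le> ennreal (\<delta> powr p)"
      using \<delta> by (simp add: ennreal_powr_ennreal)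
    \<comment> \<open>Above \<open>\<delta>\<close> the bound is
      \<open>t = t powr (1 - p) * t powr p\<close> with a nonpositive exponent \<open>1 - p\<close>.
      Integrated against a measure of mass 1, it replaces the mean by the mean p-th power.\<close>
    have pt: "t \<le> ennreal \<delta> + ennreal (\<delta> powr (1 - p)) * ennreal_powr t p" for t :: ennreal
    proof (cases t)
      case (real r)
      have "r \<le> \<delta> + \<delta> powr (1 - p) * r powr p"
      proof (cases "r \<le> \<delta>")
        case False
        have "r = r powr (1 - p) * r powr p" using False \<delta> by (simp flip: powr_add)
        also have "\<dots> \<le> \<delta> powr (1 - p) * r powr p"
          using False \<delta> p by (intro mult_right_mono powr_mono2') auto
        finally show ?thesis using \<delta> by simp
      qed (simp add: add_increasing2)
      then show ?thesis
        using real \<delta> by (simp add: ennreal_powr_ennreal flip: ennreal_plus ennreal_mult)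
    next
      case top
      then show ?thesis using \<delta> by (simp add: ennreal_mult_top)
    qed
    have "ennreal (cmod (\<phi> g - \<psi> g)) \<le> (\<integral>\<^sup>+ z. ?d z \<partial>\<pi>)"
      by (rule coupling_cmod_diff_le[where L=L, OF \<pi>(1) g Lg])
    also have "\<dots> \<le> (\<integral>\<^sup>+ z. ennreal \<delta> + ennreal (\<delta> powr (1 - p)) * ennreal_powr (?d z) p \<partial>\<pi>)"
      by (intro nn_integral_mono pt)
    also have "\<dots> = ennreal \<delta> + ennreal (\<delta> powr (1 - p)) * (\<integral>\<^sup>+ z. ennreal_powr (?d z) p \<partial>\<pi>)"
      using meas by (simp add: nn_integral_add nn_integral_cmult ennreal_powr_measurable emeasure_space_1)
    also have "\<dots> \<le> ennreal \<delta> + ennreal (\<delta> powr (1 - p)) * ennreal (\<delta> powr p)"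
      using I by (intro add_left_mono mult_left_mono) auto
    also have "\<dots> = ennreal e"
    proof -
      have "\<delta> + \<delta> powr (1 - p) * \<delta> powr p = e"
        using \<delta> by (simp add: \<delta>_def flip: powr_add)
      then show ?thesis using \<delta> by (simp flip: ennreal_plus ennreal_mult)
    qed
    finally show ?thesis using that by simp
  qed
  then have "cmod (\<phi> g - \<psi> g) \<le> 0" by (rule field_le_epsilon[of _ 0, simplified])
  then have "\<phi> g = \<psi> g" by simp
  moreover have "f = c *\<^sub>R g" using c(1) by (simp add: g_def)
  ultimately show ?thesis
    using clinear_onD(3)[OF \<phi>(1) g(1), of c] clinear_onD(3)[OF \<phi>(2) g(1), of c] by simp
qed

lemma quasi_state_restrict:
  assumes "\<mu> \<in> quasi_states"
  shows "restrict \<mu> M \<in> states M"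
proof -
  have \<mu>: "clinear_on M \<mu>" "\<And>a. \<mu> (adj a * a) \<in> \<real>\<^sub>\<ge>\<^sub>0" "\<mu> 1 = 1"
    using assms subalgebra by (auto simp: quasi_states_def)
  have "clinear_on M (restrict \<mu> M)"
    using clinear_onD(1,2)[OF \<mu>(1)] by (simp add: clinear_on_def add_mem scaleC_mem)
  then show ?thesis
    using \<mu>(2,3) by (simp add: states_def mult_mem adj_mem one_mem)
qed

end

section \<open>The projective Wasserstein distance\<close>

theorem projective_wasserstein_pseudo_distance:
  fixes L :: "'a::unital_cstar_algebra \<Rightarrow> ennreal"
  assumes p: "1 \<le> p"
  shows "pseudo_distance_on quasi_states (projective_wasserstein L p)"
proof -
  have comm: "comm_subalgebra M" if "M \<in> {M. unital_comm_cstar_subalgebra M}" for M :: "'a set"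
    using that by unfold_locales simp
  show ?thesis
    unfolding pseudo_distance_on_def
  proof (intro conjI ballI)
    fix \<mu> :: "'a \<Rightarrow> complex" assume "\<mu> \<in> quasi_states"
    then have "wasserstein L p M (restrict \<mu> M) (restrict \<mu> M) = 0" if "M \<in> {M. unital_comm_cstar_subalgebra M}" for M
      using comm_subalgebra.wasserstein_self[OF comm[OF that]]
        comm_subalgebra.quasi_state_restrict[OF comm[OF that]] by blast
    then show "projective_wasserstein L p \<mu> \<mu> = 0"
      unfolding projective_wasserstein_def by (intro antisym SUP_least) auto
  next
    fix \<mu> \<nu> :: "'a \<Rightarrow> complex"
    show "projective_wasserstein L p \<mu> \<nu> = projective_wasserstein L p \<nu> \<mu>"
      unfolding projective_wasserstein_def
      by (intro SUP_cong refl comm_subalgebra.wasserstein_commute comm)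
  next
    fix \<mu> \<nu> \<theta> :: "'a \<Rightarrow> complex"
    show "projective_wasserstein L p \<mu> \<theta> \<le> projective_wasserstein L p \<mu> \<nu> + projective_wasserstein L p \<nu> \<theta>"
      unfolding projective_wasserstein_def[of L p \<mu> \<theta>]
    proof (rule SUP_least)
      fix M :: "'a set" assume M: "M \<in> {M. unital_comm_cstar_subalgebra M}"
      have "wasserstein L p M (restrict \<mu> M) (restrict \<theta> M) \<le>
          wasserstein L p M (restrict \<mu> M) (restrict \<nu> M) + wasserstein L p M (restrict \<nu> M) (restrict \<theta> M)"
        by (rule comm_subalgebra.wasserstein_triangle[OF comm[OF M] p])
      also have "\<dots> \<le> projective_wasserstein L p \<mu> \<nu> + projective_wasserstein L p \<nu> \<theta>"
        unfolding projective_wasserstein_def using M by (intro add_mono SUP_upper)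
      finally show "wasserstein L p M (restrict \<mu> M) (restrict \<theta> M) \<le>
          projective_wasserstein L p \<mu> \<nu> + projective_wasserstein L p \<nu> \<theta>" .
    qed
  qed
qed

theorem projective_wasserstein_eq_zero_imp_eq:
  fixes L :: "'a::unital_cstar_algebra \<Rightarrow> ennreal"
  assumes p: "1 \<le> p" and L: "solid_L_seminorm L"
    and \<mu>: "\<mu> \<in> quasi_states" and \<nu>: "\<nu> \<in> quasi_states"
    and zero: "projective_wasserstein L p \<mu> \<nu> = 0"
  shows "\<mu> = \<nu>"
proof -
  have pL: "partially_defined_L_seminorm L"
    using L by (simp add: solid_L_seminorm_def L_seminorm_def)
  have sa: "\<mu> a = \<nu> a" if a: "a \<in> selfadjoint" for a
  proof -
    obtain M where max: "maximal_unital_comm_cstar_subalgebra M" and aM: "a \<in> M"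
      using selfadjoint_mem_maximal_subalgebra a by (metis selfadjoint_iff)
    then have M: "unital_comm_cstar_subalgebra M" by (simp add: maximal_unital_comm_cstar_subalgebra_def)
    interpret comm_subalgebra M using M by unfold_locales
    note S = quasi_state_restrict[OF \<mu>] quasi_state_restrict[OF \<nu>]
    have "wasserstein L p M (restrict \<mu> M) (restrict \<nu> M) \<le> projective_wasserstein L p \<mu> \<nu>"
      unfolding projective_wasserstein_def using M by (intro SUP_upper) simp
    then have "wasserstein L p M (restrict \<mu> M) (restrict \<nu> M) = 0" using zero by simp
    then have eq: "restrict \<mu> M f = restrict \<nu> M f" if "f \<in> L_domain L \<inter> M" for f
      using wasserstein_eq_zero_imp_eq[OF p pL _ statesD(2)[OF S(1)] statesD(2)[OF S(2)]] that by blast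
    have "separates_points_of (L_domain L \<inter> M) (states M)"
      using L max by (simp add: solid_L_seminorm_def)
    then have "restrict \<mu> M = restrict \<nu> M"
      using S eq unfolding separates_points_of_def by blast
    then show ?thesis using aM by (metis restrict_apply')
  qed
  show ?thesis
  proof
    fix a :: 'a
    \<comment> \<open>The two parts of \<open>a\<close> need not commute, so linearity on
      commutative subalgebras does not apply; the splitting is the separate axiom for
      quasi-states.\<close>
    have q: "\<theta> a = \<theta> (re_part a) + \<i> * \<theta> (im_part a)" if "\<theta> \<in> quasi_states" for \<theta> :: "'a \<Rightarrow> complex"
    proof -
      have "\<theta> (re_part a + \<i> *\<^sub>C im_part a) = \<theta> (re_part a) + \<i> * \<theta> (im_part a)"
        using that re_part_selfadjoint im_part_selfadjoint unfolding quasi_states_def by blast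
      then show ?thesis by (simp flip: re_part_im_part)
    qed
    show "\<mu> a = \<nu> a"
      using q[OF \<mu>] q[OF \<nu>] sa[OF re_part_selfadjoint, of a] sa[OF im_part_selfadjoint, of a] by simp
  qed
qed

theorem proposition5p8:
  fixes L :: "'a::unital_cstar_algebra \<Rightarrow> ennreal" and p :: real
  assumes "1 \<le> p"
    and "partially_defined_L_seminorm L"
  shows "pseudo_distance_on (quasi_states :: ('a \<Rightarrow> complex) set) (projective_wasserstein L p) \<and>
    (solid_L_seminorm L \<longrightarrow>
      distance_on (quasi_states :: ('a \<Rightarrow> complex) set) (projective_wasserstein L p))"
  using projective_wasserstein_pseudo_distance[OF assms(1)]
    projective_wasserstein_eq_zero_imp_eq[OF assms(1)]
  unfolding distance_on_def by blast

end
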